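(* Let $n,k\ge 1$, let $A\in\mathbb{R}^{n\times n}$, $B\in\mathbb{R}^{n\times k}$, and let $Q\in\mathbb{R}^{n\times n}$ be symmetric. Assume the controllability condition: there exists $m>0$ such that $\operatorname{rank}(B,AB,\ldots,A^{m-1}B)=n$. Let $$\vec H=\begin{pmatrix}-A^* & -Q\\ BB^* & A\end{pmatrix}\in\mathbb{R}^{2n\times 2n}$$ be the Hamiltonian matrix of the associated linear quadratic optimal control problem. Then the following dichotomy holds. (1) If $\vec H$ (over $\mathbb{C}$) has at least one Jordan block of odd dimension corresponding to a pure imaginary eigenvalue (that is, an eigenvalue $i\beta$ with $\beta\in\mathbb{R}$, $\beta\neq 0$), then the number of conjugate times in the interval $[0,T]$ (meaning $[T,0]$ when $T<0$) grows to infinity for $T\to+\infty$ and for $T\to-\infty$. (2) If $\vec H$ has no Jordan block of odd dimension corresponding to a pure imaginary eigenvalue, then there are no conjugate times.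
   Context: Coordinates on $\mathbb{R}^{2n}$ are $(p,x)$ with $p,x\in\mathbb{R}^n$, and $M^*$ denotes the transpose of $M$. Put $\mathcal V=\{(p,0): p\in\mathbb{R}^n\}\subset\mathbb{R}^{2n}$. The Jacobi curve is the family of subspaces $J(t)=e^{-t\vec H}\mathcal V$, $t\in\mathbb{R}$. A real number $t\neq 0$ is a conjugate time if $J(t)\cap\mathcal V\neq\{0\}$; its multiplicity is $\dim (J(t)\cap\mathcal V)$. The underlying control problem is $\dot x=Ax+Bu$ with fixed endpoints $x(0)=x_0$, $x(t_1)=x_1$ and cost $\frac12\int_0^{t_1}(u^*u-x^*Qx)\,dt$ to be minimized. A pure imaginary eigenvalue means $i\beta$ with $\beta$ real and nonzero; the eigenvalue $0$ is not counted as pure imaginary. *)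

theory Defs
  imports
    Complex_Main
    "Jordan_Normal_Form.Jordan_Normal_Form_Existence"
    "Jordan_Normal_Form.DL_Rank"
begin

definition kalman_mat :: "real mat \<Rightarrow> real mat \<Rightarrow> nat \<Rightarrow> real mat" where
  \<comment> \<open>The block row (B, AB, ..., A^(m-1) B): column j is column (j mod k) of A^(j div k) B,
      where k is the number of columns of B.\<close>
  "kalman_mat A B m = mat (dim_row A) (m * dim_col B)
     (\<lambda>(i, j). (A ^\<^sub>m (j div dim_col B) * B) $$ (i, j mod dim_col B))"

definition controllable :: "nat \<Rightarrow> real mat \<Rightarrow> real mat \<Rightarrow> bool" where
  "controllable n A B \<longleftrightarrow> (\<exists>m>0. vec_space.rank n (kalman_mat A B m) = n)"

definition hamiltonian_mat :: "real mat \<Rightarrow> real mat \<Rightarrow> real mat \<Rightarrow> real mat" where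
  "hamiltonian_mat A B Q =
     four_block_mat (- transpose_mat A) (- Q) (B * transpose_mat B) A"

definition mat_exp :: "real mat \<Rightarrow> real mat" where
  \<comment> \<open>The exponential series taken entrywise, since the type of matrices carries no topology.
      For square matrices every entry series converges absolutely.\<close>
  "mat_exp M = mat (dim_row M) (dim_col M) (\<lambda>(i, j). \<Sum>l. (M ^\<^sub>m l) $$ (i, j) / fact l)"

definition vertical_space :: "nat \<Rightarrow> real vec set" where
  "vertical_space n = {p @\<^sub>v 0\<^sub>v n | p. p \<in> carrier_vec n}"

definition jacobi_curve :: "nat \<Rightarrow> real mat \<Rightarrow> real \<Rightarrow> real vec set" where
  "jacobi_curve n H t = (\<lambda>v. mat_exp ((- t) \<cdot>\<^sub>m H) *\<^sub>v v) ` vertical_space n"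

definition conjugate_time :: "nat \<Rightarrow> real mat \<Rightarrow> real \<Rightarrow> bool" where
  "conjugate_time n H t \<longleftrightarrow>
     t \<noteq> 0 \<and> jacobi_curve n H t \<inter> vertical_space n \<noteq> {0\<^sub>v (2 * n)}"

definition has_odd_imaginary_jordan_block :: "complex mat \<Rightarrow> bool" where
  \<comment> \<open>A Jordan normal form exists for every square complex matrix and is unique up to permuting
      its blocks, so the choice of \<open>n_as\<close> (block dimensions and eigenvalues) is immaterial.\<close>
  "has_odd_imaginary_jordan_block M \<longleftrightarrow>
     (\<exists>n_as. jordan_nf M n_as \<and>
        (\<exists>d \<beta>. (d, \<i> * complex_of_real \<beta>) \<in> set n_as \<and> odd d \<and> \<beta> \<noteq> 0))"

end

theory Submission
  imports Defs "Jordan_Normal_Form.Jordan_Normal_Form_Uniqueness" "HOL-Complex_Analysis.Conformal_Mappings"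
begin

text \<open>
  Put \<open>D = B B\<^sup>T\<close>. All statements are compared with the solvability of the Riccati equation
  \<open>S D S + S A + A\<^sup>T S + Q = 0\<close> in symmetric matrices \<open>S\<close>. A solution is the same thing as an
  invariant Lagrangian subspace of \<open>H\<close>, namely its graph \<open>{(S x, x)}\<close>: if \<open>L\<close> is such a subspace and
  \<open>(p, 0) \<in> L\<close>, then \<open>0 = \<omega>((p, 0), H (p, 0)) = |B\<^sup>T p|\<^sup>2\<close>, so \<open>(A\<^sup>T p, 0) \<in> L\<close>, and controllability
  gives \<open>p = 0\<close>.

  Given a solution \<open>S\<close>, the coordinate \<open>y = p - S x\<close> satisfies \<open>y' = - (A + D S)\<^sup>T y\<close> and
  \<open>(y \<bullet> x)' = |B\<^sup>T y|\<^sup>2\<close> along the flow, so an orbit cannot meet the vertical space twice: there are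
  no conjugate times. The same computation over the complex numbers, for \<open>N = H - i b\<close>, shows that
  \<open>N\<^sup>2\<^sup>m\<^sup>+\<^sup>1 v = 0\<close> forces \<open>N\<^sup>m v\<close> into the graph, which is isotropic; hence the form
  \<open>\<omega>(u, N\<^sup>2\<^sup>m v)\<close> vanishes on the kernel of \<open>N\<^sup>2\<^sup>m\<^sup>+\<^sup>1\<close> and there is no block of size \<open>2 m + 1\<close>.

  If all blocks at nonzero imaginary eigenvalues are even, the subspaces \<open>ker N\<^sup>j \<inter> im N\<^sup>j\<close> make up
  half of each of these blocks and are isotropic. A maximal isotropic subspace that contains them and
  is invariant under \<open>H\<close> and under complex conjugation is Lagrangian: eigenvalues off the imaginary
  axis cause no obstruction, and neither does \<open>0\<close>, because a real vector is isotropic.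

  If the conjugate times stop at \<open>T\<close>, then for \<open>t > T\<close> the Jacobi curve consists of graphs of
  symmetric matrices that are monotone in \<open>t\<close>. It therefore converges in the Lagrangian Grassmannian,
  its limit is invariant, and the Riccati equation is solvable. So without a solution the conjugate
  times, which are zeros of an analytic function, are infinitely many.
\<close>

hide_type (open) Finite_Cartesian_Product.vec
hide_const (open) Finite_Cartesian_Product.vec Finite_Cartesian_Product.mat
  Finite_Cartesian_Product.row Finite_Cartesian_Product.transpose Determinants.det
no_notation vec_nth (infixl "$" 90)
unbundle no inner_syntax
no_notation fps_nth (infixl "$" 75)

subsection \<open>Separation of a vector from a subspace\<close>

text \<open>On a Jordan block of size d of N = H - i b, ker N^j and im N^j meet in dimension min(j,
  d - j). For even d this reaches an isotropic half; for odd d a middle direction is left over.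
  Linear algebra alone does not forbid an invariant Lagrangian subspace when odd blocks occur, since
  left-over directions of opposite sign can combine into an isotropic one. It is the sign of |B^T
  y|^2, together with controllability, that excludes this. Dimensions are hardly counted. A
  Lagrangian subspace is an isotropic one that contains its own orthogonal complement, and a Jordan
  block is detected by comparing kernels and ranges of powers; both are handled with separating
  vectors. Since \<open>mat\<close> and \<open>vec\<close> carry no topology, exp(t H) is a matrix
  of power series in t. Algebraic identities are proved on coefficients and then evaluated. That the
  determinant governing conjugate times is a nonzero series is essential for the count:
  \<open>card\<close> of an infinite set is 0, so finiteness on bounded intervals has to be known
  before growth can be stated.\<close>

definition lin_subspace :: "nat \<Rightarrow> 'a::field vec set \<Rightarrow> bool" where
  "lin_subspace n U \<longleftrightarrow> U \<subseteq> carrier_vec n \<and> 0\<^sub>v n \<in> U \<and>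
     (\<forall>u\<in>U. \<forall>v\<in>U. u + v \<in> U) \<and> (\<forall>c. \<forall>u\<in>U. c \<cdot>\<^sub>v u \<in> U)"

lemma lin_subspaceD:
  assumes "lin_subspace n U"
  shows "U \<subseteq> carrier_vec n" "0\<^sub>v n \<in> U"
    "\<And>u v. u \<in> U \<Longrightarrow> v \<in> U \<Longrightarrow> u + v \<in> U"
    "\<And>c u. u \<in> U \<Longrightarrow> c \<cdot>\<^sub>v u \<in> U"
    "\<And>u v. u \<in> U \<Longrightarrow> v \<in> U \<Longrightarrow> u - v \<in> U"
proof -
  show 1: "U \<subseteq> carrier_vec n" "0\<^sub>v n \<in> U"
    and add: "\<And>u v. u \<in> U \<Longrightarrow> v \<in> U \<Longrightarrow> u + v \<in> U"
    and smult: "\<And>c u. u \<in> U \<Longrightarrow> c \<cdot>\<^sub>v u \<in> U"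
    using assms by (simp_all only: lin_subspace_def)
  show "u - v \<in> U" if "u \<in> U" "v \<in> U" for u v
  proof -
    have uv: "u \<in> carrier_vec n" "v \<in> carrier_vec n"
      by (rule subsetD[OF 1(1)], rule that)+
    have "u + (-1) \<cdot>\<^sub>v v = u - v" by (rule eq_vecI) (use uv in auto)
    from subst[OF this, of "\<lambda>x. x \<in> U", OF add[OF that(1) smult[OF that(2), of "-1"]]] show ?thesis .
  qed
qed

lemma vCons_ops:
  fixes v w :: "'a::ring_1 vec"
  shows "v \<in> carrier_vec n \<Longrightarrow> w \<in> carrier_vec n \<Longrightarrow> vCons a v + vCons b w = vCons (a + b) (v + w)"
    "c \<cdot>\<^sub>v vCons a v = vCons (c * a) (c \<cdot>\<^sub>v v)"
    "v \<in> carrier_vec n \<Longrightarrow> w \<in> carrier_vec n \<Longrightarrow> vCons a v - vCons b w = vCons (a - b) (v - w)"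
  by (rule eq_vecI; auto simp: vec_index_vCons)+

lemma carrier_vec_SucE:
  assumes "v \<in> carrier_vec (Suc n)"
  obtains a w where "v = vCons a w" "w \<in> carrier_vec n"
proof (cases v)
  case vNil
  with assms show ?thesis by simp
next
  case (vCons a w)
  with assms that show ?thesis by simp
qed

text \<open>Elimination of the first coordinate, by induction on the dimension; \<open>U0\<close> is
  the slice of \<open>U\<close> with head 0. Later on this takes the place of dimension counts for
  kernels, ranges and Lagrangian subspaces.\<close>

lemma separating_functional:
  fixes U :: "'a::field vec set"
  assumes "lin_subspace n U" "w \<in> carrier_vec n" "w \<notin> U"
  shows "\<exists>q \<in> carrier_vec n. (\<forall>u\<in>U. q \<bullet> u = 0) \<and> q \<bullet> w \<noteq> 0"
  using assms
proof (induction n arbitrary: U w)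
  case 0
  then have "w = 0\<^sub>v 0" by auto
  with 0 show ?case using lin_subspaceD(2) by blast
next
  case (Suc n)
  note U = lin_subspaceD[OF Suc.prems(1)]
  define U0 where "U0 = {v \<in> carrier_vec n. vCons 0 v \<in> U}"
  have U0: "lin_subspace n U0"
    unfolding lin_subspace_def
  proof (intro conjI ballI allI)
    show "U0 \<subseteq> carrier_vec n" "0\<^sub>v n \<in> U0"
      using U(2) by (auto simp: U0_def zero_vec_Suc)
    show "u + v \<in> U0" if "u \<in> U0" "v \<in> U0" for u v
      using that U(3)[of "vCons 0 u" "vCons 0 v"] by (auto simp: U0_def vCons_ops(1)[of _ n])
    show "c \<cdot>\<^sub>v u \<in> U0" if "u \<in> U0" for c u
      using that U(4)[of "vCons 0 u" c] by (auto simp: U0_def vCons_ops(2))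
  qed
  obtain b w' where w: "w = vCons b w'" and w': "w' \<in> carrier_vec n"
    using Suc.prems(2) by (rule carrier_vec_SucE)
  show ?case
  proof (cases "\<exists>a v. vCons a v \<in> U \<and> a \<noteq> 0")
    case True
    then obtain a v where av: "vCons a v \<in> U" "a \<noteq> 0" by blast
    define u' where "u' = inverse a \<cdot>\<^sub>v v"
    have u: "vCons 1 u' \<in> U"
      using U(4)[OF av(1), of "inverse a"] av(2) by (simp add: vCons_ops u'_def)
    have u': "u' \<in> carrier_vec n" using u U(1) by auto
    have red: "v - a \<cdot>\<^sub>v u' \<in> U0 \<longleftrightarrow> vCons a v \<in> U" if v: "v \<in> carrier_vec n" for a v
    proof -
      have eq: "vCons 0 (v - a \<cdot>\<^sub>v u') = vCons a v - a \<cdot>\<^sub>v vCons 1 u'"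
        using v u' by (simp add: vCons_ops(2) vCons_ops(3)[of _ n])
      have "v - a \<cdot>\<^sub>v u' + a \<cdot>\<^sub>v u' = v" using v u' by (intro eq_vecI) auto
      then have eq2: "vCons a v = vCons 0 (v - a \<cdot>\<^sub>v u') + a \<cdot>\<^sub>v vCons 1 u'"
        using v u' by (simp add: vCons_ops(2) vCons_ops(1)[of _ n])
      have c: "v - a \<cdot>\<^sub>v u' \<in> carrier_vec n" using v u' by auto
      show ?thesis
      proof
        assume "v - a \<cdot>\<^sub>v u' \<in> U0"
        then have "vCons 0 (v - a \<cdot>\<^sub>v u') \<in> U" by (simp add: U0_def)
        from U(3)[OF this U(4)[OF u]] show "vCons a v \<in> U" unfolding eq2 .
      next
        assume "vCons a v \<in> U"
        from U(5)[OF this U(4)[OF u, of a]] c eq show "v - a \<cdot>\<^sub>v u' \<in> U0"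
          by (simp add: U0_def)
      qed
    qed
    have "w' - b \<cdot>\<^sub>v u' \<notin> U0" using red[OF w'] w Suc.prems(3) by auto
    then obtain q where q: "q \<in> carrier_vec n" "\<forall>u\<in>U0. q \<bullet> u = 0" "q \<bullet> (w' - b \<cdot>\<^sub>v u') \<noteq> 0"
      using Suc.IH[OF U0, of "w' - b \<cdot>\<^sub>v u'"] w' u' by auto
    \<comment> \<open>The head is chosen so that \<open>q'\<close> annihilates
      \<open>vCons 1 u'\<close>; on any vector it then acts as \<open>q\<close> does after the head
      has been eliminated.\<close>
    define q' where "q' = vCons (- (q \<bullet> u')) q"
    have ev: "q' \<bullet> vCons a v = q \<bullet> (v - a \<cdot>\<^sub>v u')" if "v \<in> carrier_vec n" for a v
      using that q(1) u' by (simp add: q'_def scalar_prod_minus_distrib[of _ n] algebra_simps)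
    have "q' \<bullet> u = 0" if "u \<in> U" for u
    proof -
      obtain a v where "u = vCons a v" "v \<in> carrier_vec n"
        using subsetD[OF U(1) \<open>u \<in> U\<close>] by (rule carrier_vec_SucE)
      then show ?thesis using ev red q(2) that by auto
    qed
    moreover have "q' \<bullet> w \<noteq> 0" using ev[OF w'] q(3) w by simp
    moreover have "q' \<in> carrier_vec (Suc n)" using q(1) by (auto simp: q'_def)
    ultimately show ?thesis by blast
  next
    case False
    have hd0: "\<exists>v \<in> U0. u = vCons 0 v" if "u \<in> U" for u
    proof -
      obtain a v where "u = vCons a v" "v \<in> carrier_vec n"
        using subsetD[OF U(1) \<open>u \<in> U\<close>] by (rule carrier_vec_SucE)
      then show ?thesis using False that by (auto simp: U0_def)
    qed
    show ?thesis
    proof (cases "b = 0")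
      case True
      then have "w' \<notin> U0" using w Suc.prems(3) unfolding U0_def by auto
      then obtain q where q: "q \<in> carrier_vec n" "\<forall>u\<in>U0. q \<bullet> u = 0" "q \<bullet> w' \<noteq> 0"
        using Suc.IH[OF U0 w'] by auto
      have "vCons 0 q \<bullet> u = 0" if "u \<in> U" for u
        using hd0[OF that] q(2) by auto
      moreover have "vCons 0 q \<bullet> w \<noteq> 0" using q(3) w by simp
      ultimately show ?thesis using q(1) by (intro bexI[of _ "vCons 0 q"]) auto
    next
      case False
      \<comment> \<open>No element of \<open>U\<close> has a nonzero head, so the first coordinate
        itself separates.\<close>
      have "vCons 1 (0\<^sub>v n) \<bullet> u = 0" if "u \<in> U" for u
        using hd0[OF that] by (auto simp: U0_def)
      then show ?thesis
        by (intro bexI[of _ "vCons 1 (0\<^sub>v n)"]) (use False w w' in auto)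
    qed
  qed
qed

subsection \<open>Detecting Jordan blocks\<close>

text \<open>The condition \<open>N\<^sup>d\<^sup>-\<^sup>1 (ker N\<^sup>d) \<subseteq> im N\<^sup>d\<close> fails exactly for a Jordan block of size \<open>d\<close> at the
  eigenvalue \<open>0\<close>. Only \<open>d > 0\<close> is meaningful, as \<open>d - 1\<close> is truncated.\<close>

definition no_jordan_block :: "nat \<Rightarrow> 'a::field mat \<Rightarrow> nat \<Rightarrow> bool" where
  "no_jordan_block n N d \<longleftrightarrow> (\<forall>v\<in>carrier_vec n. (((*\<^sub>v) N ^^ d) v = 0\<^sub>v n) \<longrightarrow>
     (\<exists>w\<in>carrier_vec n. ((*\<^sub>v) N ^^ (d - 1)) v = ((*\<^sub>v) N ^^ d) w))"

lemma funpow_mult_carrier: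
  "N \<in> carrier_mat n n \<Longrightarrow> v \<in> carrier_vec n \<Longrightarrow> ((*\<^sub>v) N ^^ k) v \<in> carrier_vec n"
  by (induction k) (auto intro: mult_mat_vec_carrier)

lemma funpow_mult_zero:
  "N \<in> carrier_mat n n \<Longrightarrow> ((*\<^sub>v) N ^^ k) (0\<^sub>v n) = 0\<^sub>v n"
  by (induction k) (auto intro!: eq_vecI)

lemma funpow_four_block_diag:
  assumes "N1 \<in> carrier_mat n n" "N2 \<in> carrier_mat m m" "v \<in> carrier_vec n" "w \<in> carrier_vec m"
  shows "((*\<^sub>v) (four_block_mat N1 (0\<^sub>m n m) (0\<^sub>m m n) N2) ^^ k) (v @\<^sub>v w) =
     (((*\<^sub>v) N1 ^^ k) v) @\<^sub>v (((*\<^sub>v) N2 ^^ k) w)"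
  using assms
  by (induction k) (simp_all add: mult_mat_vec_split funpow_mult_carrier)

lemma append_vec_eq_zero:
  fixes v w :: "'a::zero vec"
  assumes "v \<in> carrier_vec n" "w \<in> carrier_vec m"
  shows "v @\<^sub>v w = 0\<^sub>v (n + m) \<longleftrightarrow> v = 0\<^sub>v n \<and> w = 0\<^sub>v m"
proof -
  have "0\<^sub>v (n + m) = (0\<^sub>v n :: 'a vec) @\<^sub>v 0\<^sub>v m" by (rule eq_vecI) auto
  then show ?thesis using append_vec_eq[OF assms(1), of "0\<^sub>v n" w "0\<^sub>v m"] by simp
qed

lemma bex_vec_append:
  "(\<exists>x\<in>carrier_vec (n + m). P x) \<longleftrightarrow> (\<exists>x1\<in>carrier_vec n. \<exists>x2\<in>carrier_vec m. P (x1 @\<^sub>v x2))"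
  using all_vec_append[of n m "\<lambda>x. \<not> P x"] by blast

text \<open>Kernels and ranges of the powers split along the two blocks. To recover the condition
  for one block, its vector is padded with zero in the other.\<close>

lemma no_jordan_block_four_block_diag:
  assumes N: "N1 \<in> carrier_mat n n" "N2 \<in> carrier_mat m m"
  shows "no_jordan_block (n + m) (four_block_mat N1 (0\<^sub>m n m) (0\<^sub>m m n) N2) d \<longleftrightarrow>
     no_jordan_block n N1 d \<and> no_jordan_block m N2 d"
proof -
  let ?N = "four_block_mat N1 (0\<^sub>m n m) (0\<^sub>m m n) N2"
  have zero: "(((*\<^sub>v) ?N ^^ d) (v @\<^sub>v w) = 0\<^sub>v (n + m)) \<longleftrightarrow>
      ((*\<^sub>v) N1 ^^ d) v = 0\<^sub>v n \<and> ((*\<^sub>v) N2 ^^ d) w = 0\<^sub>v m"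
    if "v \<in> carrier_vec n" "w \<in> carrier_vec m" for v w
    using that N by (simp add: funpow_four_block_diag append_vec_eq_zero funpow_mult_carrier)
  have eq: "((*\<^sub>v) ?N ^^ (d - 1)) (v @\<^sub>v w) = ((*\<^sub>v) ?N ^^ d) (v' @\<^sub>v w') \<longleftrightarrow>
      ((*\<^sub>v) N1 ^^ (d - 1)) v = ((*\<^sub>v) N1 ^^ d) v' \<and> ((*\<^sub>v) N2 ^^ (d - 1)) w = ((*\<^sub>v) N2 ^^ d) w'"
    if "v \<in> carrier_vec n" "w \<in> carrier_vec m" "v' \<in> carrier_vec n" "w' \<in> carrier_vec m" for v w v' w'
    using that N append_vec_eq[of "((*\<^sub>v) N1 ^^ (d - 1)) v" n "((*\<^sub>v) N1 ^^ d) v'"]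
    by (simp add: funpow_four_block_diag funpow_mult_carrier)
  have "no_jordan_block (n + m) ?N d \<longleftrightarrow> (\<forall>v\<in>carrier_vec n. \<forall>w\<in>carrier_vec m.
      ((*\<^sub>v) N1 ^^ d) v = 0\<^sub>v n \<longrightarrow> ((*\<^sub>v) N2 ^^ d) w = 0\<^sub>v m \<longrightarrow>
      (\<exists>v'\<in>carrier_vec n. ((*\<^sub>v) N1 ^^ (d - 1)) v = ((*\<^sub>v) N1 ^^ d) v') \<and>
      (\<exists>w'\<in>carrier_vec m. ((*\<^sub>v) N2 ^^ (d - 1)) w = ((*\<^sub>v) N2 ^^ d) w'))"
    unfolding no_jordan_block_def all_vec_append bex_vec_append
    by (intro ball_cong refl) (simp add: zero eq del: One_nat_def; blast)
  also have "\<dots> \<longleftrightarrow> no_jordan_block n N1 d \<and> no_jordan_block m N2 d"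
    unfolding no_jordan_block_def
    using funpow_mult_zero[OF N(1), of d] funpow_mult_zero[OF N(2), of d]
      zero_carrier_vec[of n] zero_carrier_vec[of m] by blast
  finally show ?thesis .
qed

lemma funpow_similar:
  assumes "similar_mat_wit A B P Q" "A \<in> carrier_mat n n" "v \<in> carrier_vec n"
  shows "((*\<^sub>v) A ^^ k) (P *\<^sub>v v) = P *\<^sub>v ((*\<^sub>v) B ^^ k) v"
proof -
  note w = similar_mat_witD2[OF assms(2,1)]
  have "A *\<^sub>v (P *\<^sub>v u) = P *\<^sub>v (B *\<^sub>v u)" if u: "u \<in> carrier_vec n" for u
  proof -
    have "Q *\<^sub>v (P *\<^sub>v u) = u"
      using w u by (simp flip: assoc_mult_mat_vec[of _ n n _ n])
    moreover have "A *\<^sub>v (P *\<^sub>v u) = P *\<^sub>v (B *\<^sub>v (Q *\<^sub>v (P *\<^sub>v u)))"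
      unfolding w(3) using w u
      by (simp add: assoc_mult_mat_vec[of _ n n _ n] mult_carrier_mat[of _ n n _ n])
    ultimately show ?thesis by simp
  qed
  then show ?thesis using w(5) assms(3) by (induction k) (simp_all add: funpow_mult_carrier)
qed

lemma no_jordan_block_similar:
  assumes "similar_mat_wit A B P Q" "A \<in> carrier_mat n n" "no_jordan_block n B d"
  shows "no_jordan_block n A d"
  unfolding no_jordan_block_def
proof (intro ballI impI)
  note w = similar_mat_witD2[OF assms(2,1)]
  fix v assume v: "v \<in> carrier_vec n" and 0: "((*\<^sub>v) A ^^ d) v = 0\<^sub>v n"
  let ?u = "Q *\<^sub>v v"
  have u: "?u \<in> carrier_vec n" using w(7) v by simp
  have Pu: "P *\<^sub>v ?u = v"
    using w v by (simp flip: assoc_mult_mat_vec[of _ n n _ n])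
  have "P *\<^sub>v ((*\<^sub>v) B ^^ d) ?u = 0\<^sub>v n"
    using funpow_similar[OF assms(1,2) u, of d] Pu 0 by simp
  then have "Q *\<^sub>v (P *\<^sub>v ((*\<^sub>v) B ^^ d) ?u) = 0\<^sub>v n" using w(7) by (auto intro!: eq_vecI)
  then have "((*\<^sub>v) B ^^ d) ?u = 0\<^sub>v n"
    using w funpow_mult_carrier[OF w(5) u] by (simp flip: assoc_mult_mat_vec[of _ n n _ n])
  then obtain x where x: "x \<in> carrier_vec n" "((*\<^sub>v) B ^^ (d - 1)) ?u = ((*\<^sub>v) B ^^ d) x"
    using assms(3) u unfolding no_jordan_block_def by blast
  have "((*\<^sub>v) A ^^ (d - 1)) v = ((*\<^sub>v) A ^^ d) (P *\<^sub>v x)"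
    using funpow_similar[OF assms(1,2) u, of "d - 1"] funpow_similar[OF assms(1,2) x(1), of d] Pu x(2)
    by simp
  moreover have "P *\<^sub>v x \<in> carrier_vec n" using w(6) x(1) by simp
  ultimately show "\<exists>w\<in>carrier_vec n. ((*\<^sub>v) A ^^ (d - 1)) v = ((*\<^sub>v) A ^^ d) w" by blast
qed

lemma jordan_block_zero_mult_vec:
  fixes v :: "'a::field vec"
  assumes "v \<in> carrier_vec n"
  shows "jordan_block n 0 *\<^sub>v v = vec n (\<lambda>i. if Suc i < n then v $ Suc i else 0)"
proof (rule eq_vecI)
  fix i assume "i < dim_vec (vec n (\<lambda>i. if Suc i < n then v $ Suc i else 0))"
  then have i: "i < n" by simp
  have "(jordan_block n 0 *\<^sub>v v) $ i = row (jordan_block n 0) i \<bullet> v" using i by simp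
  also have "\<dots> = (\<Sum>j = 0..<n. (if Suc i = j then v $ j else 0))"
    unfolding scalar_prod_def using i assms by (intro sum.cong) auto
  also have "\<dots> = (if Suc i < n then v $ Suc i else 0)"
    by (simp add: sum.delta)
  finally show "(jordan_block n 0 *\<^sub>v v) $ i = vec n (\<lambda>i. if Suc i < n then v $ Suc i else 0) $ i"
    using i by simp
qed simp

lemma funpow_jordan_block_zero:
  fixes v :: "'a::field vec"
  assumes "v \<in> carrier_vec n"
  shows "((*\<^sub>v) (jordan_block n 0) ^^ k) v = vec n (\<lambda>i. if i + k < n then v $ (i + k) else 0)"
proof (induction k)
  case 0
  then show ?case using assms by (intro eq_vecI) auto
next
  case (Suc k)
  then show ?case by (auto simp: jordan_block_zero_mult_vec intro!: eq_vecI)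
qed

text \<open>For a nonzero eigenvalue the block is invertible and all kernels are trivial. For
  eigenvalue 0 it is the left shift: if n = d, the last unit vector violates the condition; if n <
  d, its power d - 1 is already 0; if n > d, a vector killed by power d can be shifted right by one
  position.\<close>

lemma no_jordan_block_jordan_block:
  fixes a :: "'a::field"
  assumes "n > 0" "d > 0"
  shows "no_jordan_block n (jordan_block n a) d \<longleftrightarrow> \<not> (a = 0 \<and> n = d)"
proof (cases "a = 0")
  case False
  have "det (jordan_block n a) = a ^ n"
    by (subst det_upper_triangular[of _ n]) (auto simp: prod_list_diag_prod)
  then have "jordan_block n a *\<^sub>v v = 0\<^sub>v n \<Longrightarrow> v \<in> carrier_vec n \<Longrightarrow> v = 0\<^sub>v n" for v
    using False det_0_iff_vec_prod_zero_field[OF jordan_block_carrier[of n a]] by auto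
  then have "((*\<^sub>v) (jordan_block n a) ^^ k) v = 0\<^sub>v n \<Longrightarrow> v \<in> carrier_vec n \<Longrightarrow> v = 0\<^sub>v n" for k v
    by (induction k) (auto simp: funpow_mult_carrier[OF jordan_block_carrier])
  then have "no_jordan_block n (jordan_block n a) d"
    unfolding no_jordan_block_def
    by (metis funpow_mult_zero[OF jordan_block_carrier] zero_carrier_vec)
  then show ?thesis using False by simp
next
  case a: True
  show ?thesis
  proof (cases "n = d")
    case True
    let ?v = "unit_vec n (n - 1) :: 'a vec"
    have v: "?v \<in> carrier_vec n" by simp
    have "((*\<^sub>v) (jordan_block n 0) ^^ d) ?v = 0\<^sub>v n"
      unfolding funpow_jordan_block_zero[OF v] using True by (intro eq_vecI) auto
    moreover have "((*\<^sub>v) (jordan_block n 0) ^^ (d - 1)) ?v \<noteq> ((*\<^sub>v) (jordan_block n 0) ^^ d) w"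
      if "w \<in> carrier_vec n" for w
    proof
      assume "((*\<^sub>v) (jordan_block n 0) ^^ (d - 1)) ?v = ((*\<^sub>v) (jordan_block n 0) ^^ d) w"
      then have "((*\<^sub>v) (jordan_block n 0) ^^ (d - 1)) ?v $ 0 = ((*\<^sub>v) (jordan_block n 0) ^^ d) w $ 0"
        by simp
      then show False
        unfolding funpow_jordan_block_zero[OF v] funpow_jordan_block_zero[OF that]
        using True assms by simp
    qed
    ultimately show ?thesis using True a v unfolding no_jordan_block_def by blast
  next
    case nd: False
    have "\<exists>w\<in>carrier_vec n. ((*\<^sub>v) (jordan_block n 0) ^^ (d - 1)) v = ((*\<^sub>v) (jordan_block n 0) ^^ d) w"
      if v: "v \<in> carrier_vec n" and 0: "((*\<^sub>v) (jordan_block n 0) ^^ d) v = 0\<^sub>v n" for v :: "'a vec"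
    proof -
      \<comment> \<open>The right shift undoes one application of the block except that it drops the
        last coordinate; for d < n that coordinate is 0 because power d kills
        \<open>v\<close>.\<close>
      let ?w = "vec n (\<lambda>i. if i = 0 then 0 else v $ (i - 1))"
      have w: "?w \<in> carrier_vec n" by simp
      have "v $ (n - 1) = 0" if "d < n"
      proof -
        have "((*\<^sub>v) (jordan_block n 0) ^^ d) v $ (n - 1 - d) = 0" using 0 that by simp
        then show ?thesis unfolding funpow_jordan_block_zero[OF v] using that by simp
      qed
      then have "((*\<^sub>v) (jordan_block n 0) ^^ (d - 1)) v = ((*\<^sub>v) (jordan_block n 0) ^^ d) ?w"
        unfolding funpow_jordan_block_zero[OF v] funpow_jordan_block_zero[OF w]
      proof (intro eq_vecI)
        fix i assume *: "d < n \<Longrightarrow> v $ (n - 1) = 0"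
          and "i < dim_vec (vec n (\<lambda>i. if i + d < n then ?w $ (i + d) else 0))"
        then have i: "i < n" by simp
        have "v $ (i + (d - 1)) = 0" if "i + (d - 1) < n" "\<not> i + d < n"
        proof -
          have "i + (d - 1) = n - 1" "d < n" using that i nd assms by auto
          then show ?thesis using * by simp
        qed
        then show "vec n (\<lambda>i. if i + (d - 1) < n then v $ (i + (d - 1)) else 0) $ i =
            vec n (\<lambda>i. if i + d < n then ?w $ (i + d) else 0) $ i"
          using i assms by auto
      qed simp
      then show ?thesis using w by blast
    qed
    then show ?thesis using a nd unfolding no_jordan_block_def by blast
  qed
qed

lemma char_matrix_four_block_diag:
  assumes "A \<in> carrier_mat n n" "B \<in> carrier_mat m m"
  shows "char_matrix (four_block_mat A (0\<^sub>m n m) (0\<^sub>m m n) B) e =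
    four_block_mat (char_matrix A e) (0\<^sub>m n m) (0\<^sub>m m n) (char_matrix B e)"
  using assms unfolding char_matrix_def by (intro eq_matI) auto

lemma char_matrix_jordan_matrix_Cons:
  fixes b :: "'a::field"
  shows "char_matrix (jordan_matrix ((m, a) # n_as)) b =
    four_block_mat (jordan_block m (a - b)) (0\<^sub>m m (sum_list (map fst n_as)))
      (0\<^sub>m (sum_list (map fst n_as)) m) (char_matrix (jordan_matrix n_as) b)"
  unfolding jordan_matrix_Cons
  by (simp add: char_matrix_four_block_diag char_matrix_jordan_block)

lemma no_jordan_block_jordan_matrix:
  fixes l :: "'a::field"
  assumes "d > 0" "0 \<notin> fst ` set n_as"
  shows "no_jordan_block (sum_list (map fst n_as)) (char_matrix (jordan_matrix n_as) l) d
    \<longleftrightarrow> (d, l) \<notin> set n_as"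
  using assms(2)
proof (induction n_as)
  case Nil
  have "((*\<^sub>v) (char_matrix (jordan_matrix []) l) ^^ k) v = 0\<^sub>v 0" if "v \<in> carrier_vec 0" for k v
  proof -
    have "(jordan_matrix [] :: 'a mat) \<in> carrier_mat 0 0"
      using jordan_matrix_carrier[of "[] :: (nat \<times> 'a) list"] by simp
    from funpow_mult_carrier[OF char_matrix_closed[OF this, of l] that, of k]
    show ?thesis by (intro eq_vecI) auto
  qed
  then show ?case unfolding no_jordan_block_def by auto
next
  case (Cons na n_as)
  obtain m a where na: "na = (m, a)" by force
  show ?case
    unfolding na char_matrix_jordan_matrix_Cons list.map fst_conv sum_list.Cons
    by (subst no_jordan_block_four_block_diag)
      (use Cons na assms(1) in \<open>auto simp: no_jordan_block_jordan_block\<close>)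
qed

text \<open>The right-hand side does not mention \<open>n_as\<close>, so this also shows that the
  occurrence of a block does not depend on the chosen normal form.\<close>

lemma jordan_nf_block_iff:
  fixes M :: "'a::field mat"
  assumes "M \<in> carrier_mat n n" "jordan_nf M n_as" "d > 0"
  shows "(d, l) \<in> set n_as \<longleftrightarrow> \<not> no_jordan_block n (char_matrix M l) d"
proof -
  have 0: "0 \<notin> fst ` set n_as" using assms(2) by (simp add: jordan_nf_def)
  obtain P Q where wit: "similar_mat_wit M (jordan_matrix n_as) P Q"
    using assms(2) unfolding jordan_nf_def similar_mat_def by blast
  have n: "n = sum_list (map fst n_as)"
    using similar_mat_witD2(5)[OF assms(1) wit] by auto
  note wit' = similar_mat_wit_char_matrix[OF wit, of l]
  have "no_jordan_block n (char_matrix M l) d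
    \<longleftrightarrow> no_jordan_block n (char_matrix (jordan_matrix n_as) l) d"
    using no_jordan_block_similar[OF wit'] no_jordan_block_similar[OF similar_mat_wit_sym[OF wit']]
      assms(1) n by auto
  then show ?thesis using no_jordan_block_jordan_matrix[OF assms(3) 0, of l] n by simp
qed

section \<open>Annihilating products of linear factors\<close>

definition shifts :: "'a::field mat \<Rightarrow> 'a list \<Rightarrow> 'a vec \<Rightarrow> 'a vec" where
  "shifts M ls = fold (\<lambda>l v. char_matrix M l *\<^sub>v v) ls"

lemma shifts_simps [simp]:
  "shifts M [] v = v" "shifts M (l # ls) v = shifts M ls (char_matrix M l *\<^sub>v v)"
  "shifts M (ls @ ls') v = shifts M ls' (shifts M ls v)"
  by (simp_all add: shifts_def)

lemma shifts_carrier: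
  "M \<in> carrier_mat n n \<Longrightarrow> v \<in> carrier_vec n \<Longrightarrow> shifts M ls v \<in> carrier_vec n"
  by (induction ls arbitrary: v) (auto intro: mult_mat_vec_carrier[OF char_matrix_closed])

lemma shifts_zero: "M \<in> carrier_mat n n \<Longrightarrow> shifts M ls (0\<^sub>v n) = 0\<^sub>v n"
proof (induction ls)
  case (Cons l ls)
  have "char_matrix M l *\<^sub>v 0\<^sub>v n = 0\<^sub>v n" 
    using char_matrix_closed[OF Cons.prems, of l] by (intro eq_vecI) auto
  then show ?case using Cons by simp
qed simp

lemma shifts_four_block_diag:
  assumes "A \<in> carrier_mat n n" "B \<in> carrier_mat m m" "v \<in> carrier_vec n" "w \<in> carrier_vec m"
  shows "shifts (four_block_mat A (0\<^sub>m n m) (0\<^sub>m m n) B) ls (v @\<^sub>v w) = shifts A ls v @\<^sub>v shifts B ls w"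
  using assms(3,4)
proof (induction ls arbitrary: v w)
  case (Cons l ls)
  show ?case
    using Cons assms(1,2) 
    by (simp add: char_matrix_four_block_diag mult_mat_vec_split[of _ n _ m] 
        mult_mat_vec_carrier[OF char_matrix_closed])
qed simp

lemma shifts_jordan_block:
  fixes v :: "'a::field vec"
  assumes "v \<in> carrier_vec m"
  shows "shifts (jordan_block m a) (replicate m a) v = 0\<^sub>v m"
proof -
  have "shifts (jordan_block m a) (replicate k a) v = ((*\<^sub>v) (jordan_block m 0) ^^ k) v" for k
    unfolding funpow_swap1
    by (induction k arbitrary: v) (simp_all add: char_matrix_jordan_block funpow_swap1)
  from this[of m] show ?thesis
    unfolding funpow_jordan_block_zero[OF assms] by (auto intro!: eq_vecI)
qed

lemma shifts_jordan_matrix: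
  "\<exists>ls. \<forall>v\<in>carrier_vec (sum_list (map fst n_as)).
     shifts (jordan_matrix (n_as :: (nat \<times> 'a::field) list)) ls v = 0\<^sub>v (sum_list (map fst n_as))"
proof (induction n_as)
  case (Cons na n_as)
  obtain m a where na: "na = (m, a)" by force
  define s where "s = sum_list (map fst n_as)"
  obtain ls where ls: "\<forall>v\<in>carrier_vec s. shifts (jordan_matrix n_as) ls v = 0\<^sub>v s"
    using Cons s_def by blast
  have J: "jordan_matrix n_as \<in> carrier_mat s s" by (simp add: s_def)
  have "shifts (jordan_matrix (na # n_as)) (replicate m a @ ls) (v @\<^sub>v w) = 0\<^sub>v (m + s)"
    if v: "v \<in> carrier_vec m" and w: "w \<in> carrier_vec s" for v w
  proof -
    have "shifts (jordan_matrix n_as) (replicate m a @ ls) w = 0\<^sub>v s"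
      using ls shifts_carrier[OF J w, of "replicate m a"] by simp
    moreover have "shifts (jordan_block m a) (replicate m a @ ls) v = 0\<^sub>v m"
      using shifts_jordan_block[OF v] shifts_zero[of "jordan_block m a" m] by simp
    ultimately show ?thesis
      unfolding na jordan_matrix_Cons s_def[symmetric]
      by (subst shifts_four_block_diag[OF _ J v w]) (auto simp: append_vec_eq_zero)
  qed
  then show ?case unfolding na list.map fst_conv sum_list.Cons s_def[symmetric] all_vec_append 
    using na by blast
next
  case Nil
  show ?case by (rule exI[of _ "[]"]) auto
qed

text \<open>A factored annihilating polynomial, read off from the Jordan form by repeating each
  eigenvalue as often as its block is long. Keeping the factors in a list allows the later arguments
  to peel off one \<open>M - l\<close> at a time.\<close>

lemma shifts_annihilating:
  fixes M :: "complex mat"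
  assumes M: "M \<in> carrier_mat n n"
  obtains ls where "\<And>v. v \<in> carrier_vec n \<Longrightarrow> shifts M ls v = 0\<^sub>v n"
proof -
  obtain n_as where jnf: "jordan_nf M n_as"
    using char_poly_factorized[OF M] jordan_nf_exists[OF M] by blast
  obtain P Q where wit: "similar_mat_wit M (jordan_matrix n_as) P Q"
    using jnf unfolding jordan_nf_def similar_mat_def by blast
  note w = similar_mat_witD2[OF M wit]
  have n: "n = sum_list (map fst n_as)" using w(5) by auto
  obtain ls where ls: "\<And>v. v \<in> carrier_vec n \<Longrightarrow> shifts (jordan_matrix n_as) ls v = 0\<^sub>v n"
    using shifts_jordan_matrix[of n_as] n by blast
  have conj: "shifts M ls' (P *\<^sub>v v) = P *\<^sub>v shifts (jordan_matrix n_as) ls' v" if "v \<in> carrier_vec n" for ls' v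
    using that
  proof (induction ls' arbitrary: v)
    case (Cons l ls')
    have "char_matrix M l *\<^sub>v (P *\<^sub>v v) = P *\<^sub>v (char_matrix (jordan_matrix n_as) l *\<^sub>v v)"
      using funpow_similar[OF similar_mat_wit_char_matrix[OF wit, of l] char_matrix_closed[OF M] Cons.prems, of 1]
      by simp
    moreover have "char_matrix (jordan_matrix n_as) l *\<^sub>v v \<in> carrier_vec n"
      using mult_mat_vec_carrier[OF char_matrix_closed[OF w(5)] Cons.prems] .
    ultimately show ?case using Cons.IH by simp
  qed simp
  have "shifts M ls v = 0\<^sub>v n" if v: "v \<in> carrier_vec n" for v
  proof -
    have Qv: "Q *\<^sub>v v \<in> carrier_vec n" using w(7) v by simp
    have "P *\<^sub>v (Q *\<^sub>v v) = v" using w v by (simp flip: assoc_mult_mat_vec[of _ n n _ n])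
    then have "shifts M ls v = P *\<^sub>v 0\<^sub>v n" using conj[OF Qv, of ls] ls[OF Qv] by simp
    then show ?thesis using w(6) by (auto intro!: eq_vecI)
  qed
  then show thesis using that by blast
qed

subsection \<open>Invariant Lagrangian subspaces\<close>

text \<open>Defined as a closure, so that isotropy and invariance spread from the generators by rule
  induction.\<close>

inductive_set lspan :: "nat \<Rightarrow> 'a::field vec set \<Rightarrow> 'a vec set" for n S where
  zero: "0\<^sub>v n \<in> lspan n S"
| base: "u \<in> S \<Longrightarrow> u \<in> lspan n S"
| add: "u \<in> lspan n S \<Longrightarrow> v \<in> lspan n S \<Longrightarrow> u + v \<in> lspan n S"
| smult: "u \<in> lspan n S \<Longrightarrow> c \<cdot>\<^sub>v u \<in> lspan n S"

lemma lspan_carrier: "S \<subseteq> carrier_vec n \<Longrightarrow> u \<in> lspan n S \<Longrightarrow> u \<in> carrier_vec n"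
  by (rotate_tac, induction rule: lspan.induct) auto

lemma lin_subspace_lspan: "S \<subseteq> carrier_vec n \<Longrightarrow> lin_subspace n (lspan n S)"
  unfolding lin_subspace_def by (blast intro: lspan_carrier lspan.intros)

lemma smult_mat_mult_vec:
  fixes v :: "'a::comm_ring_1 vec"
  assumes "A \<in> carrier_mat n k" "v \<in> carrier_vec k"
  shows "(c \<cdot>\<^sub>m A) *\<^sub>v v = c \<cdot>\<^sub>v (A *\<^sub>v v)"
  using assms by (intro eq_vecI) (auto simp: smult_scalar_prod_distrib[of _ k])

lemma smult_zero_vec [simp]: "c \<cdot>\<^sub>v 0\<^sub>v n = (0\<^sub>v n :: 'a::mult_zero vec)"
  by (rule eq_vecI) auto

lemma char_matrix_mult_vec:
  assumes "M \<in> carrier_mat m m" "v \<in> carrier_vec m"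
  shows "char_matrix M l *\<^sub>v v = M *\<^sub>v v - l \<cdot>\<^sub>v v"
proof -
  have "char_matrix M l *\<^sub>v v = M *\<^sub>v v + (-l) \<cdot>\<^sub>v v"
    using assms unfolding char_matrix_def
    by (subst add_mult_distrib_mat_vec[of _ m m]) (auto simp: smult_mat_mult_vec[of _ m m])
  also have "\<dots> = M *\<^sub>v v - l \<cdot>\<^sub>v v"
    using assms by (intro eq_vecI) auto
  finally show ?thesis .
qed

lemma funpow_mult_add:
  "N \<in> carrier_mat n n \<Longrightarrow> u \<in> carrier_vec n \<Longrightarrow> v \<in> carrier_vec n \<Longrightarrow>
    ((*\<^sub>v) N ^^ k) (u + v) = ((*\<^sub>v) N ^^ k) u + ((*\<^sub>v) N ^^ k) v"
  by (induction k) (auto simp: mult_add_distrib_mat_vec funpow_mult_carrier)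

lemma funpow_mult_smult:
  fixes N :: "'a::field mat"
  shows "N \<in> carrier_mat n n \<Longrightarrow> u \<in> carrier_vec n \<Longrightarrow>
    ((*\<^sub>v) N ^^ k) (c \<cdot>\<^sub>v u) = c \<cdot>\<^sub>v ((*\<^sub>v) N ^^ k) u"
  by (induction k) (auto simp: mult_mat_vec[of _ n n] funpow_mult_carrier)

lemma funpow_mult_minus:
  fixes N :: "'a::field mat"
  assumes "N \<in> carrier_mat n n" "u \<in> carrier_vec n" "v \<in> carrier_vec n"
  shows "((*\<^sub>v) N ^^ k) (u - v) = ((*\<^sub>v) N ^^ k) u - ((*\<^sub>v) N ^^ k) v"
  using assms by (induction k) (auto simp: mult_minus_distrib_mat_vec funpow_mult_carrier)

lemma add_vec_interchange:
  fixes u v w z :: "'a::ab_semigroup_add vec"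
  assumes "u \<in> carrier_vec n" "v \<in> carrier_vec n" "w \<in> carrier_vec n" "z \<in> carrier_vec n"
  shows "(u + v) + (w + z) = (u + w) + (v + z)"
  using assms by (intro eq_vecI) (auto simp: ac_simps)

lemma vec_diff_add:
  fixes u v :: "'a::group_add vec"
  assumes "u \<in> carrier_vec n" "v \<in> carrier_vec n"
  shows "u - v + v = u"
  using assms by (intro eq_vecI) auto

text \<open>The form \<open>h\<close> stands for \<open>h u v = \<omega>(cnj u, v)\<close>, with \<open>\<omega>\<close> a real symplectic form and \<open>M\<close> a real
  Hamiltonian matrix. On the imaginary axis \<open>M - i b\<close> is again skew for \<open>h\<close>.\<close>

locale hermitian_hamiltonian =
  fixes m :: nat and M :: "complex mat" and h :: "complex vec \<Rightarrow> complex vec \<Rightarrow> complex"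
  assumes M [simp]: "M \<in> carrier_mat m m"
    and h_add_right: "\<And>u v w. u \<in> carrier_vec m \<Longrightarrow> v \<in> carrier_vec m \<Longrightarrow> w \<in> carrier_vec m \<Longrightarrow>
          h u (v + w) = h u v + h u w"
    and h_smult_right: "\<And>u v c. u \<in> carrier_vec m \<Longrightarrow> v \<in> carrier_vec m \<Longrightarrow> h u (c \<cdot>\<^sub>v v) = c * h u v"
    and h_skew: "\<And>u v. u \<in> carrier_vec m \<Longrightarrow> v \<in> carrier_vec m \<Longrightarrow> h v u = - cnj (h u v)"
    and h_M: "\<And>u v. u \<in> carrier_vec m \<Longrightarrow> v \<in> carrier_vec m \<Longrightarrow> h (M *\<^sub>v u) v = - h u (M *\<^sub>v v)"
    and h_separating: "\<And>U w. lin_subspace m U \<Longrightarrow> w \<in> carrier_vec m \<Longrightarrow> w \<notin> U \<Longrightarrow>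
          \<exists>q\<in>carrier_vec m. (\<forall>u\<in>U. h q u = 0) \<and> h q w \<noteq> 0"
    and M_conjugate: "\<And>u. u \<in> carrier_vec m \<Longrightarrow> M *\<^sub>v conjugate u = conjugate (M *\<^sub>v u)"
    and h_conjugate: "\<And>u v. u \<in> carrier_vec m \<Longrightarrow> v \<in> carrier_vec m \<Longrightarrow> h (conjugate u) (conjugate v) = cnj (h u v)"
begin

abbreviation C :: "complex vec set" where "C \<equiv> carrier_vec m"

definition N :: "real \<Rightarrow> complex mat" where
  "N b = char_matrix M (\<i> * complex_of_real b)"

definition T :: "real \<Rightarrow> nat \<Rightarrow> complex vec \<Rightarrow> complex vec" where
  "T b j = ((*\<^sub>v) (N b) ^^ j)"

lemma N [simp]: "N b \<in> carrier_mat m m" by (simp add: N_def)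

lemma Mv [simp]: "v \<in> C \<Longrightarrow> M *\<^sub>v v \<in> C" by (rule mult_mat_vec_carrier[OF M])

lemma T_carrier [simp]: "v \<in> C \<Longrightarrow> T b j v \<in> C"
  by (simp add: T_def funpow_mult_carrier)

lemma T_0 [simp]: "T b 0 v = v" by (simp add: T_def)
lemma T_zero [simp]: "T b j (0\<^sub>v m) = 0\<^sub>v m" by (simp add: T_def funpow_mult_zero)
lemma T_T: "T b i (T b j v) = T b (i + j) v" by (simp add: T_def funpow_add)
lemma T_Suc: "T b (Suc j) v = N b *\<^sub>v T b j v" by (simp add: T_def)
lemma T_1: "T b 1 v = N b *\<^sub>v v" by (simp add: T_def)
lemma T_add: "u \<in> C \<Longrightarrow> v \<in> C \<Longrightarrow> T b j (u + v) = T b j u + T b j v"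
  by (simp add: T_def funpow_mult_add[OF N])
lemma T_minus: "u \<in> C \<Longrightarrow> v \<in> C \<Longrightarrow> T b j (u - v) = T b j u - T b j v"
  by (simp add: T_def funpow_mult_minus[OF N])
lemma T_smult: "u \<in> C \<Longrightarrow> T b j (c \<cdot>\<^sub>v u) = c \<cdot>\<^sub>v T b j u"
  by (simp add: T_def funpow_mult_smult[OF N])

lemma Nv: "v \<in> C \<Longrightarrow> N b *\<^sub>v v = M *\<^sub>v v - (\<i> * complex_of_real b) \<cdot>\<^sub>v v"
  unfolding N_def by (rule char_matrix_mult_vec[OF M])

lemma h_add_left: "u \<in> C \<Longrightarrow> v \<in> C \<Longrightarrow> w \<in> C \<Longrightarrow> h (u + v) w = h u w + h v w"
  using h_skew[of w "u + v"] h_skew[of w u] h_skew[of w v] h_add_right[of w u v] by simp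

lemma h_smult_left: "u \<in> C \<Longrightarrow> v \<in> C \<Longrightarrow> h (c \<cdot>\<^sub>v u) v = cnj c * h u v"
  using h_skew[of v "c \<cdot>\<^sub>v u"] h_skew[of v u] h_smult_right[of v u c] by simp

lemma h_zero_right [simp]: "u \<in> C \<Longrightarrow> h u (0\<^sub>v m) = 0"
  using h_smult_right[of u "0\<^sub>v m" 0] by (simp add: smult_zero_vec)
lemma h_zero_left [simp]: "u \<in> C \<Longrightarrow> h (0\<^sub>v m) u = 0"
  using h_skew[of u "0\<^sub>v m"] by simp

lemma vec_minus: "u \<in> C \<Longrightarrow> v \<in> C \<Longrightarrow> u - v = u + (-1) \<cdot>\<^sub>v v"
  by (rule eq_vecI) auto

lemma h_minus_right: "u \<in> C \<Longrightarrow> v \<in> C \<Longrightarrow> w \<in> C \<Longrightarrow> h u (v - w) = h u v - h u w"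
  by (simp add: vec_minus[of v w] h_add_right h_smult_right)
lemma h_minus_left: "u \<in> C \<Longrightarrow> v \<in> C \<Longrightarrow> w \<in> C \<Longrightarrow> h (u - v) w = h u w - h v w"
  by (simp add: vec_minus[of u v] h_add_left h_smult_left)

lemma h_sym0: "u \<in> C \<Longrightarrow> v \<in> C \<Longrightarrow> h u v = 0 \<Longrightarrow> h v u = 0"
  using h_skew[of u v] by simp

lemma h_N: "u \<in> C \<Longrightarrow> v \<in> C \<Longrightarrow> h (N b *\<^sub>v u) v = - h u (N b *\<^sub>v v)"
  by (simp add: Nv h_minus_left h_minus_right h_M h_smult_left h_smult_right)

lemma h_T: "u \<in> C \<Longrightarrow> v \<in> C \<Longrightarrow> h (T b j u) v = (-1) ^ j * h u (T b j v)"
proof (induction j arbitrary: v)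
  case (Suc j)
  have "h (T b (Suc j) u) v = - h (T b j u) (T b 1 v)"
    unfolding T_Suc using Suc.prems by (simp only: h_N T_carrier T_1)
  also have "\<dots> = - ((-1) ^ j * h u (T b j (T b 1 v)))"
    using Suc.IH[OF Suc.prems(1) T_carrier[OF Suc.prems(2)], of b 1] by simp
  finally show ?case by (simp add: T_T)
qed simp

lemma h_nondegenerate: "w \<in> C \<Longrightarrow> (\<And>u. u \<in> C \<Longrightarrow> h u w = 0) \<Longrightarrow> w = 0\<^sub>v m"
  using h_separating[of "{0\<^sub>v m}" w] by (auto simp: lin_subspace_def)

lemma lin_subspace_range: "lin_subspace m (T b j ` C)"
  unfolding lin_subspace_def
proof (intro conjI ballI allI)
  show "0\<^sub>v m \<in> T b j ` C" by (rule image_eqI[of _ _ "0\<^sub>v m"]) auto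
  show "u + v \<in> T b j ` C" if "u \<in> T b j ` C" "v \<in> T b j ` C" for u v
    using that by (auto simp flip: T_add)
  show "c \<cdot>\<^sub>v u \<in> T b j ` C" if "u \<in> T b j ` C" for u c
    using that by (auto simp flip: T_smult)
qed auto

lemma kernel_if_orthogonal_range:
  assumes q: "q \<in> C" and orth: "\<And>x. x \<in> C \<Longrightarrow> h q (T b j x) = 0"
  shows "T b j q = 0\<^sub>v m"
proof (rule h_nondegenerate)
  show "h u (T b j q) = 0" if "u \<in> C" for u
    using orth[OF that] h_T[OF q that, of b j] q that by - (rule h_sym0, auto)
qed (use q in simp)

text \<open>The Fredholm alternative for an operator that is skew for \<open>h\<close>: a vector
  \<open>q\<close> that separates \<open>w\<close> from the range is orthogonal to the range, hence
  lies in the kernel, where \<open>orth\<close> applies to it.\<close>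

lemma range_if_orthogonal_kernel:
  assumes w: "w \<in> C" and orth: "\<And>u. u \<in> C \<Longrightarrow> T b j u = 0\<^sub>v m \<Longrightarrow> h u w = 0"
  shows "w \<in> T b j ` C"
proof (rule ccontr)
  assume "w \<notin> T b j ` C"
  from h_separating[OF lin_subspace_range w this]
  obtain q where q: "q \<in> C" "\<forall>u\<in>T b j ` C. h q u = 0" "h q w \<noteq> 0" by blast
  then have "T b j q = 0\<^sub>v m" by (intro kernel_if_orthogonal_range) auto
  with orth q show False by blast
qed

definition ker_plus_range :: "real \<Rightarrow> nat \<Rightarrow> complex vec set" where
  "ker_plus_range b j = {u + T b j x | u x. u \<in> C \<and> x \<in> C \<and> T b j u = 0\<^sub>v m}"

lemma ker_plus_rangeI:
  "u \<in> C \<Longrightarrow> x \<in> C \<Longrightarrow> T b j u = 0\<^sub>v m \<Longrightarrow> u + T b j x \<in> ker_plus_range b j"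
  unfolding ker_plus_range_def by blast

lemma lin_subspace_ker_plus_range: "lin_subspace m (ker_plus_range b j)"
  unfolding lin_subspace_def
proof (intro conjI ballI allI)
  show "ker_plus_range b j \<subseteq> C" by (auto simp: ker_plus_range_def)
  show "0\<^sub>v m \<in> ker_plus_range b j"
    unfolding ker_plus_range_def by (intro CollectI exI[of _ "0\<^sub>v m"]) auto
next
  fix u v assume "u \<in> ker_plus_range b j" "v \<in> ker_plus_range b j"
  then obtain a x c y where *: "u = a + T b j x" "v = c + T b j y" "a \<in> C" "x \<in> C" "c \<in> C" "y \<in> C"
    "T b j a = 0\<^sub>v m" "T b j c = 0\<^sub>v m" unfolding ker_plus_range_def by blast
  have "u + v = (a + c) + T b j (x + y)"
    unfolding *(1,2) T_add[OF *(4,6)]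
    by (rule add_vec_interchange[of _ m]) (use *(3-6) in simp_all)
  moreover have "T b j (a + c) = 0\<^sub>v m" using * by (simp add: T_add)
  ultimately show "u + v \<in> ker_plus_range b j"
    unfolding ker_plus_range_def using *(3-6) by (intro CollectI exI[of _ "a + c"] exI[of _ "x + y"]) simp
next
  fix u c assume "u \<in> ker_plus_range b j"
  then obtain a x where *: "u = a + T b j x" "a \<in> C" "x \<in> C" "T b j a = 0\<^sub>v m"
    unfolding ker_plus_range_def by blast
  have "c \<cdot>\<^sub>v u = c \<cdot>\<^sub>v a + T b j (c \<cdot>\<^sub>v x)"
    using * by (simp add: T_smult smult_add_distrib_vec[of _ m])
  moreover have "T b j (c \<cdot>\<^sub>v a) = 0\<^sub>v m" using * by (simp add: T_smult)
  ultimately show "c \<cdot>\<^sub>v u \<in> ker_plus_range b j"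
    unfolding ker_plus_range_def using * by (intro CollectI exI[of _ "c \<cdot>\<^sub>v a"] exI[of _ "c \<cdot>\<^sub>v x"]) simp
qed

text \<open>On a Jordan block of \<open>N b\<close> of size d this is the span of the first min(j, d
  - j) vectors of the chain, so j = d / 2 yields exactly half of an even block.\<close>

definition ker_cap_range :: "real \<Rightarrow> nat \<Rightarrow> complex vec set" where
  "ker_cap_range b j = {u \<in> C. T b j u = 0\<^sub>v m \<and> (\<exists>x\<in>C. u = T b j x)}"

text \<open>Kernel and range of \<open>T b j\<close> are each other's orthogonal complements. A
  vector separating \<open>w\<close> from their sum is therefore orthogonal to both, hence lies in
  both, contrary to \<open>orth\<close>.\<close>

lemma ker_plus_range_if_orthogonal:
  assumes w: "w \<in> C" and orth: "\<And>u. u \<in> ker_cap_range b j \<Longrightarrow> h u w = 0"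
  shows "w \<in> ker_plus_range b j"
proof (rule ccontr)
  assume "w \<notin> ker_plus_range b j"
  from h_separating[OF lin_subspace_ker_plus_range w this]
  obtain q where q: "q \<in> C" "\<forall>u\<in>ker_plus_range b j. h q u = 0" "h q w \<noteq> 0" by blast
  have "h u q = 0" if "u \<in> C" "T b j u = 0\<^sub>v m" for u
  proof -
    have "u \<in> ker_plus_range b j" using ker_plus_rangeI[OF that(1) zero_carrier_vec that(2)] that by simp
    then show ?thesis using q that by - (rule h_sym0, auto)
  qed
  from range_if_orthogonal_kernel[OF q(1) this] have "\<exists>x\<in>C. q = T b j x" by blast
  moreover have "h q (T b j x) = 0" if "x \<in> C" for x
  proof -
    have "T b j x \<in> ker_plus_range b j"
      using ker_plus_rangeI[OF zero_carrier_vec that T_zero] that by simp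
    then show ?thesis using q by blast
  qed
  then have "T b j q = 0\<^sub>v m" by (rule kernel_if_orthogonal_range[OF q(1)])
  ultimately have "q \<in> ker_cap_range b j" using q(1) by (simp add: ker_cap_range_def)
  with orth q(3) show False by blast
qed

text \<open>If i <= j, the vector lies in the kernel of power j, otherwise in the range of power j.
  This keeps membership in all \<open>ker_plus_range\<close> stable when elements of
  \<open>ker_cap_range\<close> are subtracted.\<close>

lemma ker_cap_range_subset:
  assumes "u \<in> ker_cap_range b i"
  shows "u \<in> ker_plus_range b j"
proof (cases "i \<le> j")
  case True
  have "T b j u = T b (j - i) (T b i u)" unfolding T_T using True by simp
  then have "u + T b j (0\<^sub>v m) \<in> ker_plus_range b j"
    using assms by (intro ker_plus_rangeI) (auto simp: ker_cap_range_def)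
  then show ?thesis using assms by (simp add: ker_cap_range_def)
next
  case False
  obtain x where x: "x \<in> C" "u = T b i x" using assms by (auto simp: ker_cap_range_def)
  have "u = 0\<^sub>v m + T b j (T b (i - j) x)" unfolding T_T x(2) using False x(1) by simp
  then show ?thesis
    using ker_plus_rangeI[OF zero_carrier_vec T_carrier[OF x(1)] T_zero] by simp
qed

text \<open>For i <= j, write v = N^j x and move N^j to the other argument: it kills
  \<open>u\<close>. The opposite order follows by skew symmetry.\<close>

lemma h_ker_cap_range:
  assumes "u \<in> ker_cap_range b i" "v \<in> ker_cap_range b j"
  shows "h u v = 0"
proof -
  have *: "h u v = 0" if ui: "u \<in> ker_cap_range b i" and vj: "v \<in> ker_cap_range b j" and ij: "i \<le> j" for i j u v
  proof -
    obtain x where x: "x \<in> C" "v = T b j x" using vj by (auto simp: ker_cap_range_def)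
    have u: "u \<in> C" "T b i u = 0\<^sub>v m" using ui by (auto simp: ker_cap_range_def)
    have "T b j u = T b (j - i) (T b i u)" unfolding T_T using ij by simp
    then have "h (T b j u) x = 0" using u(2) x by simp
    then show ?thesis using h_T[OF u(1) x(1), of b j] x(2) by simp
  qed
  show ?thesis
  proof (cases "i \<le> j")
    case False
    then have "h v u = 0" by (intro *[OF assms(2,1)]) simp
    then show ?thesis using assms by - (rule h_sym0[of v u], auto simp: ker_cap_range_def)
  qed (use assms * in blast)
qed

text \<open>Applying \<open>N b\<close> to \<open>u\<close> or \<open>N c\<close> to
  \<open>v\<close> lowers an exponent, so by induction both new pairs are orthogonal. Inside the
  form \<open>u\<close> and \<open>v\<close> thus behave like eigenvectors, and skewness of
  \<open>M\<close> gives i (c - b) h u v = 0.\<close>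

lemma h_T_distinct:
  assumes "b \<noteq> c" "u \<in> C" "v \<in> C" "T b i u = 0\<^sub>v m" "T c j v = 0\<^sub>v m"
  shows "h u v = 0"
  using assms(2-)
proof (induction "i + j" arbitrary: i j u v rule: less_induct)
  case less
  show ?case
  proof (cases "i = 0 \<or> j = 0")
    case True
    then show ?thesis using less.prems by auto
  next
    case False
    then obtain i' j' where ij: "i = Suc i'" "j = Suc j'" by (meson not0_implies_Suc)
    have "T b i' (N b *\<^sub>v u) = 0\<^sub>v m" "T c j' (N c *\<^sub>v v) = 0\<^sub>v m"
      using less.prems(3,4) unfolding ij T_1[symmetric] T_T by simp_all
    then have "h (N b *\<^sub>v u) v = 0" "h u (N c *\<^sub>v v) = 0"
      using less.hyps[of i' j "N b *\<^sub>v u" v] less.hyps[of i j' u "N c *\<^sub>v v"] less.prems ij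
        mult_mat_vec_carrier[OF N] by auto
    then have "h (M *\<^sub>v u) v = - (\<i> * of_real b) * h u v" "h u (M *\<^sub>v v) = (\<i> * of_real c) * h u v"
      using less.prems by (simp_all add: Nv h_minus_left h_minus_right h_smult_left h_smult_right eq_neg_iff_add_eq_0)
    then have "\<i> * (of_real c - of_real b) * h u v = 0"
      using h_M[OF less.prems(1,2)] by (simp add: algebra_simps)
    then show ?thesis using assms(1) by simp
  qed
qed

text \<open>A vector \<open>k\<close> with \<open>N\<^sup>d\<^sup>+\<^sup>1 k = 0\<close> is moved into \<open>ker N\<^sup>d\<close> by subtracting an element of
  \<open>ker N\<^sup>d\<^sup>+\<^sup>1 \<inter> im N\<^sup>d\<^sup>+\<^sup>1\<close>. To find it, \<open>N\<^sup>d k\<close> is pushed into the range of higher and higher powers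
  \<open>N\<^sup>d\<^sup>+\<^sup>i\<close>: past odd exponents by the absence of odd blocks, past \<open>2 r\<close> by \<open>k \<in> ker N\<^sup>r + im N\<^sup>r\<close>.\<close>

lemma in_span_of_ker_cap_range:
  assumes even: "\<And>e. odd e \<Longrightarrow> no_jordan_block m (N b) e"
    and Y: "lin_subspace m Y" "\<And>j. ker_cap_range b j \<subseteq> Y"
    and g: "g \<in> C" "T b d g = 0\<^sub>v m" "\<And>u j. u \<in> ker_cap_range b j \<Longrightarrow> h u g = 0"
  shows "g \<in> Y"
proof -
  note Y' = lin_subspaceD[OF Y(1)]
  \<comment> \<open>Orthogonality enters only through membership in every
    \<open>ker_plus_range\<close>, a property that passes to the differences formed in the
    induction.\<close>
  have reduce: "k \<in> Y" if k: "k \<in> C" "T b d k = 0\<^sub>v m" "\<And>j. k \<in> ker_plus_range b j" for k d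
    using k
  proof (induction d arbitrary: k)
    case 0
    then show ?case using Y'(2) by simp
  next
    case (Suc d)
    note k = Suc.prems
    have "\<exists>c\<in>C. T b d k = T b (d + i) c" if "i \<le> Suc d" for i
      using that
    proof (induction i)
      case 0
      then show ?case using k(1) by auto
    next
      case (Suc i)
      then obtain c where c: "c \<in> C" "T b d k = T b (d + i) c" by auto
      show ?case
      proof (cases "odd (Suc (d + i))")
        case True
        have "T b (Suc (d + i)) c = T b 1 (T b d k)" unfolding c(2) T_T by simp
        also have "\<dots> = 0\<^sub>v m" using k(2) unfolding T_T by simp
        finally have "\<exists>w\<in>C. T b (Suc (d + i) - 1) c = T b (Suc (d + i)) w"
          using even[OF True] c(1) unfolding no_jordan_block_def T_def by blast
        then show ?thesis using c(2) by simp
      next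
        case False
        then have "\<exists>r. Suc (d + i) = 2 * r" by presburger
        then obtain r where r: "Suc (d + i) = 2 * r" ..
        \<comment> \<open>At the even exponent 2 r the splitting of \<open>k\<close> takes over from
          the block condition. Its kernel part dies under N^d because r <= d, and N^d k = N^(d + r)
          x reaches exponent d + i + 1 because i < r.\<close>
        obtain a x where ax: "k = a + T b r x" "a \<in> C" "x \<in> C" "T b r a = 0\<^sub>v m"
          using k(3)[of r] unfolding ker_plus_range_def by blast
        have rd: "r \<le> d" using r Suc.prems by linarith
        have "T b d a = T b (d - r) (T b r a)" unfolding T_T using rd by simp
        then have *: "T b d k = T b (d + r) x" using ax by (simp add: T_add T_T)
        have "d + r = d + Suc i + (r - Suc i)" using r Suc.prems by linarith
        with * have "T b d k = T b (d + Suc i) (T b (r - Suc i) x)" by (simp only: T_T)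
        then show ?thesis using T_carrier[OF ax(3)] by blast
      qed
    qed
    \<comment> \<open>With exponent 2 d + 1, the vector N^(d + 1) c has the same image as
      \<open>k\<close> under N^d and is killed by N^(d + 1), since \<open>k\<close> is.\<close>
    from this[of "Suc d"] obtain c where c: "c \<in> C" "T b d k = T b (d + Suc d) c" by auto
    let ?w = "T b (Suc d) c"
    have w: "?w \<in> ker_cap_range b (Suc d)"
    proof -
      have "T b (Suc d) ?w = T b 1 (T b d k)" unfolding c(2) T_T by simp
      also have "\<dots> = 0\<^sub>v m" using Suc.prems(2) by (simp add: T_T)
      finally show ?thesis using c(1) by (auto simp: ker_cap_range_def)
    qed
    have "T b d (k - ?w) = 0\<^sub>v m"
      using Suc.prems(1) c(1) by (simp add: T_minus T_T c(2))
    moreover have "k - ?w \<in> ker_plus_range b j" for j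
      by (rule lin_subspaceD(5)[OF lin_subspace_ker_plus_range Suc.prems(3) ker_cap_range_subset[OF w]])
    ultimately have "k - ?w \<in> Y" using Suc.IH[of "k - ?w"] Suc.prems(1) c(1) by simp
    from Y'(3)[OF this] Y(2) w have "k - ?w + ?w \<in> Y" by blast
    moreover have "k - ?w + ?w = k" by (rule vec_diff_add[OF Suc.prems(1) T_carrier[OF c(1)]])
    ultimately show ?case by metis
  qed
  show ?thesis
    by (rule reduce[OF g(1,2)], rule ker_plus_range_if_orthogonal[OF g(1) g(3)])
qed

end

section \<open>Maximal invariant isotropic subspaces\<close>

lemma shifts_commute:
  assumes M: "M \<in> carrier_mat m m" and v: "v \<in> carrier_vec m"
  shows "shifts M ls (char_matrix M l *\<^sub>v v) = char_matrix M l *\<^sub>v shifts M ls v"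
  using v
proof (induction ls arbitrary: v)
  case (Cons a ls)
  have "char_matrix M a *\<^sub>v (char_matrix M l *\<^sub>v v) = char_matrix M l *\<^sub>v (char_matrix M a *\<^sub>v v)"
  proof -
    have eq: "char_matrix M a *\<^sub>v (char_matrix M b *\<^sub>v v) =
        (M *\<^sub>v (M *\<^sub>v v) - b \<cdot>\<^sub>v (M *\<^sub>v v)) - a \<cdot>\<^sub>v (M *\<^sub>v v - b \<cdot>\<^sub>v v)" for a b
    proof -
      have "M *\<^sub>v v \<in> carrier_vec m" using M Cons.prems by simp
      then show ?thesis using M Cons.prems
        by (simp add: char_matrix_mult_vec[OF M] mult_minus_distrib_mat_vec[OF M] mult_mat_vec[OF M])
    qed
    show ?thesis
      unfolding eq using M Cons.prems mult_mat_vec_carrier[OF M Cons.prems]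
        mult_mat_vec_carrier[OF M mult_mat_vec_carrier[OF M Cons.prems]]
      by (intro eq_vecI) (auto simp: algebra_simps)
  qed
  then show ?case
    using Cons.IH[OF mult_mat_vec_carrier[OF char_matrix_closed[OF M] Cons.prems]] by simp
qed simp

text \<open>All factors with root \<open>l\<close> are applied last. If the whole product kills
  \<open>v\<close>, the remaining factors therefore send \<open>v\<close> into the generalized
  eigenspace of \<open>l\<close>.\<close>

lemma shifts_filter:
  assumes M: "M \<in> carrier_mat m m" and v: "v \<in> carrier_vec m"
  shows "shifts M ls v = ((*\<^sub>v) (char_matrix M l) ^^ length (filter (\<lambda>x. x = l) ls))
     (shifts M (filter (\<lambda>x. x \<noteq> l) ls) v)"
  using v
proof (induction ls arbitrary: v)
  case (Cons a ls)
  have c: "char_matrix M a *\<^sub>v v \<in> carrier_vec m"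
    using mult_mat_vec_carrier[OF char_matrix_closed[OF M] Cons.prems] .
  show ?case
    using Cons.IH[OF c] shifts_commute[OF M Cons.prems, of "filter (\<lambda>x. x \<noteq> l) ls" l]
    by (simp add: funpow_swap1)
qed simp

context hermitian_hamiltonian
begin

text \<open>The eigenvalue 0 is left out: odd blocks may occur there, and the hypothesis of the
  theorem says nothing about them.\<close>

definition half_blocks :: "complex vec set" where "half_blocks = (\<Union>b\<in>-{0}. \<Union>j. ker_cap_range b j)"

text \<open>Stated for sets, so that unions of chains are immediate. Linearity is recovered from
  maximality, because the span of an admissible set is again admissible.\<close>

definition admissible :: "complex vec set \<Rightarrow> bool" where
  "admissible Y \<longleftrightarrow> Y \<subseteq> C \<and> half_blocks \<subseteq> Y \<and> (\<forall>u\<in>Y. \<forall>v\<in>Y. h u v = 0) \<and>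
     (\<forall>u\<in>Y. M *\<^sub>v u \<in> Y \<and> conjugate u \<in> Y)"

lemma Mv_eq: "v \<in> C \<Longrightarrow> M *\<^sub>v v = char_matrix M l *\<^sub>v v + l \<cdot>\<^sub>v v"
  unfolding char_matrix_mult_vec[OF M] by (rule vec_diff_add[symmetric, of _ m]) auto

lemma admissible_lspan:
  assumes S: "S \<subseteq> C" "half_blocks \<subseteq> S" "\<And>u v. u \<in> S \<Longrightarrow> v \<in> S \<Longrightarrow> h u v = 0"
    and inv: "\<And>u. u \<in> S \<Longrightarrow> M *\<^sub>v u \<in> lspan m S" "\<And>u. u \<in> S \<Longrightarrow> conjugate u \<in> lspan m S"
  shows "admissible (lspan m S)"
proof -
  note car = lspan_carrier[OF S(1)]
  have 1: "h s v = 0" if "v \<in> lspan m S" "s \<in> S" for s v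
    using that
  proof (induction rule: lspan.induct)
    case (add u v)
    then show ?case using S(1) car[OF add(1)] car[OF add(2)] by (auto simp: h_add_right)
  next
    case (smult u c)
    then show ?case using S(1) car[OF smult(1)] by (auto simp: h_smult_right)
  qed (use S in auto)
  have 2: "h u v = 0" if "u \<in> lspan m S" "v \<in> lspan m S" for u v
    using that
  proof (induction rule: lspan.induct)
    case (add u w)
    then show ?case using car[OF add(1)] car[OF add(2)] car[OF that(2)] by (auto simp: h_add_left)
  next
    case (smult u c)
    then show ?case using car[OF smult(1)] car[OF that(2)] by (auto simp: h_smult_left)
  qed (use 1 car in auto)
  have 3: "M *\<^sub>v u \<in> lspan m S" if "u \<in> lspan m S" for u
    using that
  proof (induction rule: lspan.induct)
    case zero
    have "M *\<^sub>v 0\<^sub>v m = 0\<^sub>v m" using funpow_mult_zero[OF M, of 1] by simp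
    then show ?case by (simp add: lspan.zero)
  next
    case (add u w)
    then show ?case
      using car[OF add(1)] car[OF add(2)] by (simp add: mult_add_distrib_mat_vec[OF M] lspan.add)
  next
    case (smult u c)
    then show ?case using car[OF smult(1)] by (simp add: mult_mat_vec[OF M] lspan.smult)
  qed (use inv in auto)
  have 4: "conjugate u \<in> lspan m S" if "u \<in> lspan m S" for u
    using that
  proof (induction rule: lspan.induct)
    case zero
    show ?case by (simp add: lspan.zero)
  next
    case (add u w)
    then show ?case
      using car[OF add(1)] car[OF add(2)] by (simp add: conjugate_add_vec[of _ m] lspan.add)
  next
    case (smult u c)
    then show ?case using car[OF smult(1)] by (simp add: conjugate_smult_vec lspan.smult)
  qed (use inv in auto)
  show ?thesis
    unfolding admissible_def using S(2) car 2 3 4 by (auto intro: lspan.base)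
qed

lemma conjugate_T: "u \<in> C \<Longrightarrow> conjugate (T b j u) = T (- b) j (conjugate u)"
proof (induction j)
  case (Suc j)
  have c: "M *\<^sub>v T b j u \<in> C" "(\<i> * complex_of_real b) \<cdot>\<^sub>v T b j u \<in> C" using Suc.prems by auto
  have "conjugate (N b *\<^sub>v T b j u) = N (- b) *\<^sub>v conjugate (T b j u)"
    using c Suc.prems M_conjugate[of "T b j u"]
    by (simp add: Nv vec_minus conjugate_add_vec[of _ m] conjugate_smult_vec)
  then show ?case using Suc by (simp add: T_Suc)
qed simp

lemma conjugate_ker_cap_range:
  assumes "u \<in> ker_cap_range b j"
  shows "conjugate u \<in> ker_cap_range (- b) j"
proof -
  obtain x where x: "x \<in> C" "u = T b j x" using assms by (auto simp: ker_cap_range_def)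
  have u: "u \<in> C" "T b j u = 0\<^sub>v m" using assms by (auto simp: ker_cap_range_def)
  have "T (- b) j (conjugate u) = 0\<^sub>v m" using conjugate_T[OF u(1), of b j] u(2) by simp
  moreover have "conjugate u = T (- b) j (conjugate x)" using conjugate_T[OF x(1), of b j] x(2) by simp
  ultimately show ?thesis using u x unfolding ker_cap_range_def by auto
qed

lemma N_ker_cap_range:
  assumes "u \<in> ker_cap_range b j"
  shows "N b *\<^sub>v u \<in> ker_cap_range b j"
proof -
  obtain x where x: "x \<in> C" "u = T b j x" using assms by (auto simp: ker_cap_range_def)
  have u: "u \<in> C" "T b j u = 0\<^sub>v m" using assms by (auto simp: ker_cap_range_def)
  have "T b j (T b 1 u) = T b 1 (T b j u)" unfolding T_T by (simp add: add.commute)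
  then have "T b j (T b 1 u) = 0\<^sub>v m" using u(2) by simp
  moreover have "T b 1 u = T b j (T b 1 x)" unfolding x(2) T_T by (simp add: add.commute)
  ultimately show ?thesis unfolding T_1[symmetric] ker_cap_range_def using u(1) x(1) by auto
qed

lemma admissible_lspan_half_blocks: "admissible (lspan m half_blocks)"
proof (rule admissible_lspan)
  show "half_blocks \<subseteq> C" by (auto simp: half_blocks_def ker_cap_range_def)
  show "h u v = 0" if "u \<in> half_blocks" "v \<in> half_blocks" for u v
  proof -
    obtain b i c j where uv: "u \<in> ker_cap_range b i" "v \<in> ker_cap_range c j"
      using \<open>u \<in> half_blocks\<close> \<open>v \<in> half_blocks\<close> by (auto simp: half_blocks_def)
    show ?thesis
    proof (cases "b = c")
      case True
      then show ?thesis using h_ker_cap_range uv by blast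
    next
      case False
      then show ?thesis using uv by (intro h_T_distinct[OF False]) (auto simp: ker_cap_range_def)
    qed
  qed
  show "M *\<^sub>v u \<in> lspan m half_blocks" if "u \<in> half_blocks" for u
  proof -
    obtain b j where b: "b \<noteq> 0" "u \<in> ker_cap_range b j" using \<open>u \<in> half_blocks\<close> by (auto simp: half_blocks_def)
    have "N b *\<^sub>v u \<in> half_blocks" using N_ker_cap_range[OF b(2)] b(1) by (auto simp: half_blocks_def)
    moreover have "M *\<^sub>v u = N b *\<^sub>v u + (\<i> * complex_of_real b) \<cdot>\<^sub>v u"
      unfolding N_def by (rule Mv_eq) (use b(2) in \<open>simp add: ker_cap_range_def\<close>)
    ultimately show ?thesis using that by (simp add: lspan.intros)
  qed
  show "conjugate u \<in> lspan m half_blocks" if "u \<in> half_blocks" for u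
  proof -
    obtain b j where b: "b \<noteq> 0" "u \<in> ker_cap_range b j" using \<open>u \<in> half_blocks\<close> by (auto simp: half_blocks_def)
    then have "conjugate u \<in> half_blocks" using conjugate_ker_cap_range[OF b(2)] unfolding half_blocks_def by fastforce
    then show ?thesis by (rule lspan.base)
  qed
qed simp

lemma maximal_admissible:
  obtains Y where "admissible Y" "\<And>Z. admissible Z \<Longrightarrow> Y \<subseteq> Z \<Longrightarrow> Z = Y"
proof -
  have "\<exists>Y\<in>Collect admissible. \<forall>Z\<in>Collect admissible. Y \<subseteq> Z \<longrightarrow> Z = Y"
  proof (rule subset_Zorn_nonempty)
    show "Collect admissible \<noteq> {}" using admissible_lspan_half_blocks by auto
    fix K assume K: "K \<noteq> {}" "subset.chain (Collect admissible) K"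
    then have K': "\<And>Y. Y \<in> K \<Longrightarrow> admissible Y" "\<And>X Y. X \<in> K \<Longrightarrow> Y \<in> K \<Longrightarrow> X \<subseteq> Y \<or> Y \<subseteq> X"
      by (auto simp: subset.chain_def)
    have "h u v = 0" if "u \<in> \<Union>K" "v \<in> \<Union>K" for u v
    proof -
      obtain X Y where "X \<in> K" "u \<in> X" "Y \<in> K" "v \<in> Y" using \<open>u \<in> \<Union>K\<close> \<open>v \<in> \<Union>K\<close> by blast
      with K'(2)[of X Y] obtain Z where "Z \<in> K" "u \<in> Z" "v \<in> Z" by blast
      then show ?thesis using K'(1)[of Z] by (auto simp: admissible_def)
    qed
    moreover have "half_blocks \<subseteq> \<Union>K" using K(1) K'(1) by (fastforce simp: admissible_def)
    moreover have "\<Union>K \<subseteq> C" using K'(1) unfolding admissible_def by blast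
    moreover have "M *\<^sub>v u \<in> \<Union>K \<and> conjugate u \<in> \<Union>K" if "u \<in> \<Union>K" for u
    proof -
      obtain X where "X \<in> K" "u \<in> X" using \<open>u \<in> \<Union>K\<close> by blast
      then show ?thesis using K'(1)[of X] unfolding admissible_def by blast
    qed
    ultimately show "\<Union>K \<in> Collect admissible" unfolding admissible_def mem_Collect_eq by blast
  qed
  then show thesis using that by blast
qed

text \<open>The orthogonal complement \<open>P\<close> of a maximal admissible \<open>Y\<close> is
  stable under every factor M - l, and some product of such factors annihilates it. Hence it
  suffices that v in \<open>P\<close> with (M - l) v in \<open>Y\<close> already lies in
  \<open>Y\<close>: otherwise \<open>Y\<close> could be enlarged by \<open>v\<close> and its
  conjugate, by real and imaginary parts when l = 0, while on the rest of the imaginary axis the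
  half blocks inside \<open>Y\<close> leave no room.\<close>

theorem invariant_lagrangian_exists:
  assumes even: "\<And>b e. b \<noteq> 0 \<Longrightarrow> odd e \<Longrightarrow> no_jordan_block m (N b) e"
  obtains Y where "lin_subspace m Y" "\<And>u v. u \<in> Y \<Longrightarrow> v \<in> Y \<Longrightarrow> h u v = 0"
    "\<And>u. u \<in> Y \<Longrightarrow> M *\<^sub>v u \<in> Y" "\<And>u. u \<in> Y \<Longrightarrow> conjugate u \<in> Y"
    "\<And>v. v \<in> C \<Longrightarrow> (\<And>u. u \<in> Y \<Longrightarrow> h u v = 0) \<Longrightarrow> v \<in> Y"
proof -
  obtain Y where Y: "admissible Y" and max: "\<And>Z. admissible Z \<Longrightarrow> Y \<subseteq> Z \<Longrightarrow> Z = Y"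
    using maximal_admissible by blast
  have YC: "Y \<subseteq> C" "half_blocks \<subseteq> Y" and iso: "\<And>u v. u \<in> Y \<Longrightarrow> v \<in> Y \<Longrightarrow> h u v = 0"
    and MY: "\<And>u. u \<in> Y \<Longrightarrow> M *\<^sub>v u \<in> Y" and conjY: "\<And>u. u \<in> Y \<Longrightarrow> conjugate u \<in> Y"
    using Y unfolding admissible_def by blast+
  \<comment> \<open>Maximality in usable form: closure has to be checked only for the vectors that
    are adjoined, and only up to the span.\<close>
  have extend: "S \<subseteq> Y" if S: "Y \<subseteq> S" "S \<subseteq> C" "\<And>u v. u \<in> S \<Longrightarrow> v \<in> S \<Longrightarrow> h u v = 0"
    "\<And>u. u \<in> S - Y \<Longrightarrow> M *\<^sub>v u \<in> lspan m S" "\<And>u. u \<in> S - Y \<Longrightarrow> conjugate u \<in> lspan m S" for S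
  proof -
    have "admissible (lspan m S)"
    proof (rule admissible_lspan)
      show "M *\<^sub>v u \<in> lspan m S" if "u \<in> S" for u
        using S(1,4) MY lspan.base that by blast
      show "conjugate u \<in> lspan m S" if "u \<in> S" for u
        using S(1,5) conjY lspan.base that by blast
    qed (use S YC in auto)
    then have "lspan m S = Y" by (rule max) (use S(1) in \<open>auto intro: lspan.base\<close>)
    then show ?thesis by (auto intro: lspan.base)
  qed
  have subspace: "lin_subspace m Y"
  proof -
    have "admissible (lspan m Y)"
      by (rule admissible_lspan) (use YC iso MY conjY in \<open>auto intro: lspan.base\<close>)
    then have "lspan m Y = Y" by (rule max) (auto intro: lspan.base)
    then show ?thesis using lin_subspace_lspan[OF YC(1)] by simp
  qed
  note sub = lin_subspaceD[OF subspace]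
  define P where "P = {v \<in> C. \<forall>u\<in>Y. h u v = 0}"
  have PC: "P \<subseteq> C" by (auto simp: P_def)
  have P0: "h u v = 0" "h v u = 0" if "v \<in> P" "u \<in> Y" for u v
    using that YC h_sym0[of u v] unfolding P_def by auto
  have shiftP: "char_matrix M l *\<^sub>v v \<in> P" if "v \<in> P" for v l
  proof -
    have v: "v \<in> C" using that PC by blast
    have "h u (M *\<^sub>v v) = 0" if "u \<in> Y" for u
      using h_M[of u v] P0(1)[OF \<open>v \<in> P\<close> MY[OF that]] v YC that by auto
    then show ?thesis using v P0(1)[OF \<open>v \<in> P\<close>] YC
      unfolding char_matrix_mult_vec[OF M v] P_def by (auto simp: h_minus_right h_smult_right subsetD)
  qed
  have shiftY: "char_matrix M l *\<^sub>v v \<in> Y" if "v \<in> Y" for v l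
    using sub(4,5) MY that YC char_matrix_mult_vec[OF M, of v l] by auto
  have conjP: "conjugate v \<in> P" if "v \<in> P" for v
  proof -
    have v: "v \<in> C" using that PC by blast
    have "h u (conjugate v) = 0" if "u \<in> Y" for u
      using h_conjugate[of "conjugate u" v] v YC that P0(1)[OF \<open>v \<in> P\<close> conjY[OF that]] by auto
    then show ?thesis using v unfolding P_def by auto
  qed
  \<comment> \<open>In the intended model this is omega(conj v, conj v) = 0. It permits
    \<open>v\<close> and \<open>conjugate v\<close> to be adjoined together.\<close>
  have h_conj0: "h v (conjugate v) = 0" if v: "v \<in> C" for v
  proof -
    have "h (conjugate v) v = cnj (h v (conjugate v))" using h_conjugate[of v "conjugate v"] v by simp
    moreover have "h (conjugate v) v = - cnj (h v (conjugate v))" using h_skew[of v "conjugate v"] v by simp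
    ultimately show ?thesis by simp
  qed
  have h_conj0': "h (conjugate v) v = 0" if v: "v \<in> C" for v
    using h_conj0[OF v] h_sym0[of v "conjugate v"] v by simp
  \<comment> \<open>A vector fixed by conjugation is orthogonal to itself, so it can be adjoined
    alone as soon as \<open>M\<close> sends it into \<open>Y\<close>.\<close>
  have nilpotent: "v + conjugate v \<in> Y" if v: "v \<in> P" and Mv: "M *\<^sub>v v \<in> Y" for v
  proof -
    have vC: "v \<in> C" "conjugate v \<in> C" using v PC by auto
    let ?x = "v + conjugate v"
    have xP: "h u ?x = 0" "h ?x u = 0" if "u \<in> Y" for u
      using P0[OF v that] P0[OF conjP[OF v] that] vC that YC by (auto simp: h_add_right h_add_left subsetD)
    have xx: "h ?x ?x = 0"
      using vC h_conj0[OF vC(1)] h_conj0'[OF vC(1)] h_conjugate[OF vC(1) vC(1)]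
        h_skew[OF vC(1) vC(1), unfolded eq_neg_iff_add_eq_0]
      by (simp add: h_add_left h_add_right)
    have Mx: "M *\<^sub>v ?x \<in> Y"
      using vC M_conjugate[OF vC(1)] conjY[OF Mv] Mv by (simp add: mult_add_distrib_mat_vec[OF M] sub(3))
    have cx: "conjugate ?x = ?x"
      using vC comm_add_vec[OF vC] by (simp add: conjugate_add_vec[of _ m])
    have "insert ?x Y \<subseteq> Y"
    proof (rule extend)
      show "h u w = 0" if "u \<in> insert ?x Y" "w \<in> insert ?x Y" for u w
        using that xP xx iso by auto
      show "M *\<^sub>v u \<in> lspan m (insert ?x Y)" if "u \<in> insert ?x Y - Y" for u
        using that Mx by (auto intro: lspan.base)
      show "conjugate u \<in> lspan m (insert ?x Y)" if "u \<in> insert ?x Y - Y" for u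
        using that cx by (auto intro: lspan.base)
    qed (use vC YC in auto)
    then show ?thesis by blast
  qed
  have eigen: "v \<in> Y" if v: "v \<in> P" and y: "char_matrix M l *\<^sub>v v \<in> Y" for v l
  proof (cases "Re l = 0")
    case False
    have vC: "v \<in> C" "conjugate v \<in> C" using v PC by auto
    let ?y = "char_matrix M l *\<^sub>v v"
    have Mv: "M *\<^sub>v v = ?y + l \<cdot>\<^sub>v v" using Mv_eq[OF vC(1)] .
    have yC: "?y \<in> C" using y YC by blast
    have "h (M *\<^sub>v v) v = cnj l * h v v" "h v (M *\<^sub>v v) = l * h v v"
      unfolding Mv using vC yC P0[OF v y] by (simp_all add: h_add_left h_add_right h_smult_left h_smult_right)
    \<comment> \<open>Skewness of \<open>M\<close> produces the factor 2 Re l, so off the imaginary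
      axis \<open>v\<close> is isotropic.\<close>
    then have "(l + cnj l) * h v v = 0"
      using h_M[OF vC(1) vC(1)] by (simp add: distrib_right neg_eq_iff_add_eq_0)
    then have vv: "h v v = 0" using False by (simp add: complex_add_cnj)
    then have vv': "h (conjugate v) (conjugate v) = 0" using h_conjugate[OF vC(1) vC(1)] by simp
    let ?S = "insert v (insert (conjugate v) Y)"
    have Mcv: "M *\<^sub>v conjugate v = conjugate ?y + cnj l \<cdot>\<^sub>v conjugate v"
      using M_conjugate[OF vC(1)] Mv yC vC by (simp add: conjugate_add_vec[of _ m] conjugate_smult_vec)
    have "?S \<subseteq> Y"
    proof (rule extend)
      show "h u w = 0" if "u \<in> ?S" "w \<in> ?S" for u w
        using that P0[OF v] P0[OF conjP[OF v]] vv vv' iso h_conj0[OF vC(1)] h_conj0'[OF vC(1)] by auto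
      show "M *\<^sub>v u \<in> lspan m ?S" if "u \<in> ?S - Y" for u
        using that Mv Mcv y conjY[OF y] by (auto intro!: lspan.add lspan.smult intro: lspan.base)
      show "conjugate u \<in> lspan m ?S" if "u \<in> ?S - Y" for u
        using that by (auto intro: lspan.base)
    qed (use vC YC in auto)
    then show ?thesis by blast
  next
    case Re: True
    show ?thesis
    proof (cases "l = 0")
      case True
      have vC: "v \<in> C" "conjugate v \<in> C" using v PC by auto
      have "0 \<cdot>\<^sub>v v = 0\<^sub>v m" using vC by (intro eq_vecI) auto
      then have Mv: "M *\<^sub>v v \<in> Y"
        using Mv_eq[OF vC(1), of 0] y True sub(2,3) by metis
      \<comment> \<open>\<open>nilpotent\<close> gives twice the real part of \<open>v\<close>, and
        applied to i v it gives minus twice the imaginary part. The combination with coefficient - i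
        / 2 below rebuilds \<open>v\<close> from the two.\<close>
      have iv: "\<i> \<cdot>\<^sub>v v \<in> P" using v vC P0(1)[OF v] YC unfolding P_def by (auto simp: h_smult_right subsetD)
      have "M *\<^sub>v (\<i> \<cdot>\<^sub>v v) \<in> Y" using Mv vC by (simp add: mult_mat_vec[OF M] sub(4))
      from nilpotent[OF iv this] sub(4)[OF nilpotent[OF v Mv], of \<i>]
      have "\<i> \<cdot>\<^sub>v (v + conjugate v) + (\<i> \<cdot>\<^sub>v v + conjugate (\<i> \<cdot>\<^sub>v v)) \<in> Y" by - (rule sub(3))
      then have "(- \<i> / 2) \<cdot>\<^sub>v (\<i> \<cdot>\<^sub>v (v + conjugate v) + (\<i> \<cdot>\<^sub>v v + conjugate (\<i> \<cdot>\<^sub>v v))) \<in> Y" by (rule sub(4))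
      moreover have "(- \<i> / 2) \<cdot>\<^sub>v (\<i> \<cdot>\<^sub>v (v + conjugate v) + (\<i> \<cdot>\<^sub>v v + conjugate (\<i> \<cdot>\<^sub>v v))) = v"
        using vC by (intro eq_vecI) (auto simp: conjugate_smult_vec algebra_simps)
      ultimately show ?thesis by simp
    next
      case False
      define b where "b = Im l"
      have l: "l = \<i> * complex_of_real b" using Re by (simp add: b_def complex_eq_iff)
      have b: "b \<noteq> 0" using l False by auto
      obtain ls where ls: "\<And>v. v \<in> C \<Longrightarrow> shifts M ls v = 0\<^sub>v m" using shifts_annihilating[OF M] by blast
      have stay: "shifts M ls' w \<in> P \<and> (shifts M ls' w \<in> Y \<longleftrightarrow> w \<in> Y)"
        if "l \<notin> set ls'" "w \<in> P" "char_matrix M l *\<^sub>v w \<in> Y" for ls' w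
        using that
      proof (induction ls' arbitrary: w)
        case (Cons a ls')
        have wC: "w \<in> C" using Cons.prems PC by blast
        let ?w = "char_matrix M a *\<^sub>v w"
        have "char_matrix M l *\<^sub>v ?w = char_matrix M a *\<^sub>v (char_matrix M l *\<^sub>v w)"
          using shifts_commute[OF M wC, of "[a]" l] by simp
        then have 1: "char_matrix M l *\<^sub>v ?w \<in> Y" using shiftY Cons.prems by simp
        \<comment> \<open>Since M - l sends \<open>w\<close> into \<open>Y\<close>, the factor M - a
          acts on \<open>w\<close> modulo \<open>Y\<close> as the nonzero scalar l - a.\<close>
        have 2: "(l - a) \<cdot>\<^sub>v w = ?w - char_matrix M l *\<^sub>v w"
          using wC Mv[OF wC] unfolding char_matrix_mult_vec[OF M wC] by (intro eq_vecI) (auto simp: algebra_simps)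
        have "w \<in> Y" if "?w \<in> Y"
        proof -
          have "(l - a) \<cdot>\<^sub>v w \<in> Y" unfolding 2 using sub(5) that Cons.prems by blast
          from sub(4)[OF this, of "inverse (l - a)"] show ?thesis
            using Cons.prems(1) by (simp add: smult_smult_assoc)
        qed
        then have 3: "?w \<in> Y \<longleftrightarrow> w \<in> Y" using shiftY by blast
        show ?case using Cons.IH[of ?w] Cons.prems 1 3 shiftP by auto
      qed simp
      \<comment> \<open>Modulo \<open>Y\<close> the remaining factors act on \<open>v\<close> by nonzero scalars, and they map \<open>v\<close> into the
          generalized eigenspace of \<open>l\<close>.\<close>
      let ?ls' = "filter (\<lambda>x. x \<noteq> l) ls"
      let ?g = "shifts M ?ls' v"
      have vC: "v \<in> C" using v PC by blast
      have g: "?g \<in> P" "?g \<in> Y \<longleftrightarrow> v \<in> Y" using stay[of ?ls' v] v y by auto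
      have "T b (length (filter (\<lambda>x. x = l) ls)) ?g = 0\<^sub>v m"
        using shifts_filter[OF M vC, of ls l] ls[OF vC] unfolding T_def N_def l by simp
      then have "?g \<in> Y"
      proof (rule in_span_of_ker_cap_range[rotated -2])
        show "?g \<in> C" using g PC by blast
        show "ker_cap_range b j \<subseteq> Y" for j using YC(2) b unfolding half_blocks_def by auto
        then show "h u ?g = 0" if "u \<in> ker_cap_range b j" for u j using P0(1)[OF g(1)] that by blast
      qed (use even[OF b] subspace in auto)
      then show ?thesis using g by simp
    qed
  qed
  have PY: "v \<in> Y" if "v \<in> P" for v
  proof -
    obtain ls where ls: "\<And>v. v \<in> C \<Longrightarrow> shifts M ls v = 0\<^sub>v m" using shifts_annihilating[OF M] by blast
    have "v \<in> Y" if "v \<in> P" "shifts M ls v \<in> Y" for ls v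
      using that by (induction ls arbitrary: v) (auto intro: eigen shiftP)
    moreover have "v \<in> C" using \<open>v \<in> P\<close> PC by blast
    then have "shifts M ls v \<in> Y" using ls sub(2) by simp
    ultimately show ?thesis using \<open>v \<in> P\<close> by blast
  qed
  show thesis
    using that[OF subspace iso MY conjY] PY unfolding P_def by blast
qed

end

subsection \<open>Controllability and the symplectic form\<close>

lemma vec_first_append [simp]: "p \<in> carrier_vec n \<Longrightarrow> vec_first (p @\<^sub>v x) n = p"
  by (intro eq_vecI) (auto simp: vec_first_def)

lemma vec_last_append [simp]: "x \<in> carrier_vec n \<Longrightarrow> vec_last (p @\<^sub>v x) n = x"
  by (intro eq_vecI) (auto simp: vec_last_def)

lemma carrier_vec_appendE:
  assumes "v \<in> carrier_vec (n + m)"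
  obtains p x where "v = p @\<^sub>v x" "p \<in> carrier_vec n" "x \<in> carrier_vec m"
  using that[of "vec_first v n" "vec_last v m"] vec_first_last_append[OF assms] by simp

lemma zero_vec_append: "0\<^sub>v (n + m) = (0\<^sub>v n @\<^sub>v 0\<^sub>v m :: 'a::zero vec)"
  by (rule eq_vecI) auto

lemma smult_append_vec: "c \<cdot>\<^sub>v (p @\<^sub>v x) = (c \<cdot>\<^sub>v p) @\<^sub>v (c \<cdot>\<^sub>v x)"
  by (rule eq_vecI) auto

lemma scalar_prod_self_eq_0:
  fixes v :: "real vec"
  shows "v \<in> carrier_vec n \<Longrightarrow> v \<bullet> v = 0 \<longleftrightarrow> v = 0\<^sub>v n"
  using conjugate_square_eq_0_vec[of v n] by simp

lemma symmetric_scalar_prod: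
  fixes M :: "'a::comm_ring_1 mat"
  assumes "M \<in> carrier_mat n n" "transpose_mat M = M" "u \<in> carrier_vec n" "v \<in> carrier_vec n"
  shows "(M *\<^sub>v u) \<bullet> v = u \<bullet> (M *\<^sub>v v)"
  using transpose_vec_mult_scalar[OF assms(1,4,3)] assms(2) by simp

lemma lin_subspace_eq_carrier_if_unit_vecs:
  fixes U :: "'a::field vec set"
  assumes U: "lin_subspace n U" and unit: "\<And>i. i < n \<Longrightarrow> unit_vec n i \<in> U"
  shows "U = carrier_vec n"
proof (rule ccontr)
  assume "U \<noteq> carrier_vec n"
  then obtain w where w: "w \<in> carrier_vec n" "w \<notin> U" using lin_subspaceD(1)[OF U] by blast
  from separating_functional[OF U w] obtain q
    where q: "q \<in> carrier_vec n" "\<forall>u\<in>U. q \<bullet> u = 0" "q \<bullet> w \<noteq> 0" by blast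
  have "q = 0\<^sub>v n"
  proof (rule eq_vecI)
    fix i assume "i < dim_vec (0\<^sub>v n :: 'a vec)"
    then have "i < n" by simp
    then show "q $ i = 0\<^sub>v n $ i" using q(1) q(2)[rule_format, OF unit[of i]] by simp
  qed (use q in simp)
  then show False using q(3) w(1) by simp
qed

text \<open>A maximal independent set of columns has n elements and is a basis; a vector orthogonal
  to a basis is orthogonal to itself.\<close>

lemma rank_full_orthogonal:
  fixes K :: "real mat"
  assumes K: "K \<in> carrier_mat n m" and rank: "vec_space.rank n K = n"
    and p: "p \<in> carrier_vec n" and orth: "\<And>j. j < m \<Longrightarrow> col K j \<bullet> p = 0"
  shows "p = 0\<^sub>v n"
proof -
  interpret vec_space "TYPE(real)" n .
  have cols: "set (cols K) \<subseteq> carrier_vec n" using K cols_dim by blast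
  have "{} \<subseteq> set (cols K) \<and> lin_indpt {}" by (simp add: lin_dep_def)
  then obtain S where S: "maximal S (\<lambda>T. T \<subseteq> set (cols K) \<and> lin_indpt T)"
    using maximal_exists_superset[of "set (cols K)" "\<lambda>T. T \<subseteq> set (cols K) \<and> lin_indpt T" "{}"] by auto
  then have S': "S \<subseteq> set (cols K)" "lin_indpt S" unfolding maximal_def by auto
  have "card S = n" using rank_card_indpt[OF K S] rank by simp
  moreover have "finite S" using S'(1) finite_subset by blast
  ultimately have "basis S"
    using dim_li_is_basis[OF fin_dim] S' cols dim_is_n by auto
  then have span: "span S = carrier_vec n" by (simp add: basis_def)
  have "p \<in> orthogonal_complement S"
  proof -
    have "p \<bullet> y = 0" if "y \<in> S" for y
    proof -
      have "y \<in> set (cols K)" using \<open>y \<in> S\<close> S'(1) by blast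
      then obtain j where "j < m" "y = col K j" using K by (auto simp: cols_def)
      then show ?thesis using orth[of j] K p by (metis col_dim comm_scalar_prod carrier_matD(1))
    qed
    then show ?thesis using p by (simp add: orthogonal_complement_def)
  qed
  then have "p \<in> orthogonal_complement (span S)"
    using in_orthogonal_complement_span S'(1) cols by auto
  then have "p \<bullet> p = 0" unfolding span orthogonal_complement_def using p by blast
  then show ?thesis using scalar_prod_self_eq_0[OF p] by simp
qed

lemma funpow_mult_mat_vec:
  assumes "M \<in> carrier_mat n n" "v \<in> carrier_vec n"
  shows "((*\<^sub>v) M ^^ j) v = (M ^\<^sub>m j) *\<^sub>v v"
  using assms
proof (induction j arbitrary: v)
  case (Suc j)
  have "((*\<^sub>v) M ^^ Suc j) v = ((*\<^sub>v) M ^^ j) (M *\<^sub>v v)" by (simp add: funpow_swap1)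
  then show ?case using Suc by (simp add: assoc_mult_mat_vec[of _ n n _ n])
qed simp

lemma transpose_pow_mat:
  fixes M :: "'a::comm_ring_1 mat"
  assumes "M \<in> carrier_mat n n"
  shows "transpose_mat (M ^\<^sub>m j) = transpose_mat M ^\<^sub>m j"
proof -
  let ?T = "transpose_mat M"
  have T: "?T \<in> carrier_mat n n" using assms by simp
  have comm: "?T * ?T ^\<^sub>m j = ?T ^\<^sub>m j * ?T" for j
  proof (induction j)
    case 0
    show ?case using T by simp
  next
    case (Suc j)
    have "?T * ?T ^\<^sub>m Suc j = (?T * ?T ^\<^sub>m j) * ?T"
      using assoc_mult_mat[OF T pow_carrier_mat[OF T] T, of j] by simp
    then show ?case unfolding Suc by simp
  qed
  show ?thesis
proof (induction j)
  case (Suc j)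
  have "transpose_mat (M ^\<^sub>m Suc j) = transpose_mat M * transpose_mat (M ^\<^sub>m j)"
    using assms by (simp add: transpose_mult[of _ n n _ n])
  also have "\<dots> = transpose_mat M ^\<^sub>m Suc j"
    unfolding Suc using comm[of j] by simp
  finally show ?case .
qed (use assms in simp)
qed

text \<open>The entries of B^T (A^T)^j p are the scalar products of \<open>p\<close> with the
  columns of A^j B, that is, with columns of the Kalman matrix.\<close>

lemma controllable_orthogonal:
  assumes A: "A \<in> carrier_mat n n" and B: "B \<in> carrier_mat n k" and "controllable n A B"
    and p: "p \<in> carrier_vec n"
    and orth: "\<And>j. transpose_mat B *\<^sub>v ((*\<^sub>v) (transpose_mat A) ^^ j) p = 0\<^sub>v k"
  shows "p = 0\<^sub>v n"
proof -
  obtain m where rank: "vec_space.rank n (kalman_mat A B m) = n"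
    using assms(3) by (auto simp: controllable_def)
  have K: "kalman_mat A B m \<in> carrier_mat n (m * k)" using A B by (simp add: kalman_mat_def)
  show ?thesis
  proof (rule rank_full_orthogonal[OF K rank p])
    fix c assume c: "c < m * k"
    then have k: "c mod k < k" by (metis mod_less_divisor mult_0_right not_less_zero gr0I)
    let ?M = "A ^\<^sub>m (c div k) * B"
    have M: "?M \<in> carrier_mat n k" by (rule mult_carrier_mat[OF pow_carrier_mat[OF A] B])
    have "col (kalman_mat A B m) c = col ?M (c mod k)"
      using A B c k by (intro eq_vecI) (auto simp: kalman_mat_def)
    also have "col ?M (c mod k) \<bullet> p = (transpose_mat ?M *\<^sub>v p) $ (c mod k)"
      using carrier_matD[OF M] k by auto
    also have "transpose_mat ?M *\<^sub>v p = transpose_mat B *\<^sub>v ((*\<^sub>v) (transpose_mat A) ^^ (c div k)) p"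
      using A B p
      by (simp add: transpose_mult[of _ n n _ k] transpose_pow_mat funpow_mult_mat_vec[of _ n]
          assoc_mult_mat_vec[of _ k n _ n])
    finally show "col (kalman_mat A B m) c \<bullet> p = 0" using orth k by simp
  qed
qed

text \<open>Bilinear over any commutative ring, because it is used over the reals, over the complex
  numbers (where \<open>hform\<close> adds the conjugation) and over formal power series.\<close>

definition symplectic_form :: "nat \<Rightarrow> 'a::comm_ring_1 vec \<Rightarrow> 'a vec \<Rightarrow> 'a" where
  "symplectic_form n u v = vec_first u n \<bullet> vec_last v n - vec_last u n \<bullet> vec_first v n"

lemma symplectic_form_append:
  assumes "p \<in> carrier_vec n" "x \<in> carrier_vec n" "p' \<in> carrier_vec n" "x' \<in> carrier_vec n"
  shows "symplectic_form n (p @\<^sub>v x) (p' @\<^sub>v x') = p \<bullet> x' - x \<bullet> p'"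
  using assms by (simp add: symplectic_form_def)

lemma symplectic_form_add_right:
  assumes "u \<in> carrier_vec (n + n)" "v \<in> carrier_vec (n + n)" "w \<in> carrier_vec (n + n)"
  shows "symplectic_form n u (v + w) = symplectic_form n u v + symplectic_form n u w"
  using assms
  by (elim carrier_vec_appendE)
    (simp add: symplectic_form_append append_vec_add[of _ n _ _ n] scalar_prod_add_distrib[of _ n] algebra_simps)

lemma symplectic_form_smult_right:
  assumes "u \<in> carrier_vec (n + n)" "v \<in> carrier_vec (n + n)"
  shows "symplectic_form n u (c \<cdot>\<^sub>v v) = c * symplectic_form n u v"
  using assms
  by (elim carrier_vec_appendE)
    (simp add: symplectic_form_append smult_append_vec scalar_prod_smult_distrib[of _ n] algebra_simps)

lemma symplectic_form_skew:
  assumes "u \<in> carrier_vec (n + n)" "v \<in> carrier_vec (n + n)"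
  shows "symplectic_form n v u = - symplectic_form n u v"
  using assms
  by (elim carrier_vec_appendE) (simp add: symplectic_form_append comm_scalar_prod[of _ n])

lemma symplectic_form_separating:
  fixes U :: "'a::field vec set"
  assumes "lin_subspace (n + n) U" "w \<in> carrier_vec (n + n)" "w \<notin> U"
  shows "\<exists>q \<in> carrier_vec (n + n). (\<forall>u\<in>U. symplectic_form n q u = 0) \<and> symplectic_form n q w \<noteq> 0"
proof -
  obtain q where q: "q \<in> carrier_vec (n + n)" "\<forall>u\<in>U. q \<bullet> u = 0" "q \<bullet> w \<noteq> 0"
    using separating_functional[OF assms] by blast
  obtain a b where ab: "q = a @\<^sub>v b" "a \<in> carrier_vec n" "b \<in> carrier_vec n"
    using q(1) by (rule carrier_vec_appendE)
  \<comment> \<open>The functional of (a, b) for the scalar product is the functional of (b, -a) for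
    the symplectic form.\<close>
  have eq: "symplectic_form n (b @\<^sub>v (- a)) u = q \<bullet> u" if "u \<in> carrier_vec (n + n)" for u
    using that
  proof (rule carrier_vec_appendE)
    fix p x assume u: "u = p @\<^sub>v x" "p \<in> carrier_vec n" "x \<in> carrier_vec n"
    have "(- a) \<bullet> p = - (a \<bullet> p)" using ab u by (simp add: scalar_prod_def sum_negf)
    then show ?thesis
      using u ab by (simp add: symplectic_form_append scalar_prod_append[of _ n _ n])
  qed
  show ?thesis
    using q ab eq assms(2) lin_subspaceD(1)[OF assms(1)]
    by (intro bexI[of _ "b @\<^sub>v (- a)"]) auto
qed

text \<open>\<open>hamiltonian_mat\<close> with D for B B^T and over any commutative ring: one
  computation then serves the real matrix, its complexification and its copy over power
  series.\<close>

definition ham :: "'a::comm_ring_1 mat \<Rightarrow> 'a mat \<Rightarrow> 'a mat \<Rightarrow> 'a mat" where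
  "ham A D Q = four_block_mat (- transpose_mat A) (- Q) D A"

lemma ham_carrier [simp]:
  "A \<in> carrier_mat n n \<Longrightarrow> ham A D Q \<in> carrier_mat (n + n) (n + n)"
  unfolding ham_def by (intro four_block_carrier_mat) auto

lemma uminus_mult_mat_vec:
  fixes M :: "'a::comm_ring_1 mat"
  assumes "M \<in> carrier_mat n m" "v \<in> carrier_vec m"
  shows "(- M) *\<^sub>v v = - (M *\<^sub>v v)"
  using assms by (intro eq_vecI) (auto simp: scalar_prod_def sum_negf)

lemma ham_mult_vec:
  assumes "A \<in> carrier_mat n n" "D \<in> carrier_mat n n" "Q \<in> carrier_mat n n"
    "p \<in> carrier_vec n" "x \<in> carrier_vec n"
  shows "ham A D Q *\<^sub>v (p @\<^sub>v x) = (- (transpose_mat A *\<^sub>v p) - Q *\<^sub>v x) @\<^sub>v (D *\<^sub>v p + A *\<^sub>v x)"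
proof -
  have "(- transpose_mat A) *\<^sub>v p + (- Q) *\<^sub>v x = - (transpose_mat A *\<^sub>v p) - Q *\<^sub>v x"
    using assms uminus_mult_mat_vec[of "transpose_mat A" n n p] uminus_mult_mat_vec[of Q n n x]
    by (simp add: minus_add_uminus_vec[of _ n])
  then show ?thesis unfolding ham_def using assms
    by (subst four_block_mat_mult_vec[of _ n n _ n _ n]) auto
qed

lemma symplectic_form_ham:
  assumes A: "A \<in> carrier_mat n n" and D: "D \<in> carrier_mat n n" "transpose_mat D = D"
    and Q: "Q \<in> carrier_mat n n" "transpose_mat Q = Q"
    and "u \<in> carrier_vec (n + n)" "v \<in> carrier_vec (n + n)"
  shows "symplectic_form n (ham A D Q *\<^sub>v u) v = - symplectic_form n u (ham A D Q *\<^sub>v v)"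
  using assms(6,7)
proof (elim carrier_vec_appendE)
  fix p x p' x' assume v: "u = p @\<^sub>v x" "v = p' @\<^sub>v x'"
    and c: "p \<in> carrier_vec n" "x \<in> carrier_vec n" "p' \<in> carrier_vec n" "x' \<in> carrier_vec n"
  have neg: "(- a) \<bullet> b = - (a \<bullet> b)" "b \<bullet> (- a) = - (b \<bullet> a)" if "a \<in> carrier_vec n" "b \<in> carrier_vec n" for a b :: "'a vec"
    using that by (simp_all add: scalar_prod_def sum_negf)
  have t1: "(transpose_mat A *\<^sub>v p) \<bullet> x' = p \<bullet> (A *\<^sub>v x')"
    using transpose_vec_mult_scalar[OF A c(4,1)] .
  have t2: "x \<bullet> (transpose_mat A *\<^sub>v p') = (A *\<^sub>v x) \<bullet> p'"
    using transpose_vec_mult_scalar[OF A c(2,3)] A c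
    by (simp add: comm_scalar_prod[of x n] comm_scalar_prod[of "A *\<^sub>v x" n])
  have t3: "(Q *\<^sub>v x) \<bullet> x' = x \<bullet> (Q *\<^sub>v x')" by (rule symmetric_scalar_prod[OF Q c(2,4)])
  have t4: "(D *\<^sub>v p) \<bullet> p' = p \<bullet> (D *\<^sub>v p')" by (rule symmetric_scalar_prod[OF D c(1,3)])
  have m: "transpose_mat A *\<^sub>v p \<in> carrier_vec n" "transpose_mat A *\<^sub>v p' \<in> carrier_vec n"
    "Q *\<^sub>v x \<in> carrier_vec n" "Q *\<^sub>v x' \<in> carrier_vec n" "D *\<^sub>v p \<in> carrier_vec n" "D *\<^sub>v p' \<in> carrier_vec n"
    "A *\<^sub>v x \<in> carrier_vec n" "A *\<^sub>v x' \<in> carrier_vec n"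
    using A D Q c by auto
  show ?thesis
    unfolding v ham_mult_vec[OF A D(1) Q(1) c(1,2)] ham_mult_vec[OF A D(1) Q(1) c(3,4)]
    using m c t1 t2 t3 t4
    by (simp add: symplectic_form_append minus_scalar_prod_distrib[of _ n] scalar_prod_minus_distrib[of _ n]
        add_scalar_prod_distrib[of _ n] scalar_prod_add_distrib[of _ n] neg)
qed

subsection \<open>The Riccati equation\<close>

lemma eq_mat_if_eq_mult_vec:
  fixes M N :: "'a::comm_ring_1 mat"
  assumes "M \<in> carrier_mat n m" "N \<in> carrier_mat n m"
    and "\<And>x. x \<in> carrier_vec m \<Longrightarrow> M *\<^sub>v x = N *\<^sub>v x"
  shows "M = N"
proof (rule eq_matI)
  fix i j assume ij: "i < dim_row N" "j < dim_col N"
  then have ij': "i < n" "j < m" using assms(2) by auto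
  have "(M *\<^sub>v unit_vec m j) $ i = (N *\<^sub>v unit_vec m j) $ i" using assms(3)[of "unit_vec m j"] by simp
  then show "M $$ (i, j) = N $$ (i, j)"
    using ij' assms(1,2) by (auto simp: scalar_prod_right_unit)
qed (use assms in auto)

text \<open>With y = p - S x the coordinate transverse to the graph of S, the Riccati equation
  cancels every term in x, so y evolves on its own. Used for the real flow and, over the complex
  numbers, for \<open>N b\<close>.\<close>

lemma ham_graph_coordinate:
  fixes A D Q S :: "'a::comm_ring_1 mat"
  assumes c: "A \<in> carrier_mat n n" "D \<in> carrier_mat n n" "Q \<in> carrier_mat n n" "S \<in> carrier_mat n n"
    "x \<in> carrier_vec n" "y \<in> carrier_vec n"
    and eq: "S * (D * S + A) = - (transpose_mat A * S) - Q"
  shows "(- (transpose_mat A *\<^sub>v (y + S *\<^sub>v x)) - Q *\<^sub>v x) - S *\<^sub>v (D *\<^sub>v (y + S *\<^sub>v x) + A *\<^sub>v x)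
    = - (transpose_mat A *\<^sub>v y) - S *\<^sub>v (D *\<^sub>v y)"
proof -
  have alg: "(- (a + b) - q) - (c + (- b - q)) = - a - c"
    if "a \<in> carrier_vec n" "b \<in> carrier_vec n" "c \<in> carrier_vec n" "q \<in> carrier_vec n" for a b c q :: "'a vec"
    using that by (intro eq_vecI) auto
  have [simp]: "S *\<^sub>v x \<in> carrier_vec n" "A *\<^sub>v x \<in> carrier_vec n" "D *\<^sub>v y \<in> carrier_vec n"
    "D *\<^sub>v (S *\<^sub>v x) \<in> carrier_vec n" "transpose_mat A \<in> carrier_mat n n"
    "transpose_mat A *\<^sub>v (S *\<^sub>v x) \<in> carrier_vec n" "transpose_mat A *\<^sub>v y \<in> carrier_vec n"
    "S *\<^sub>v (D *\<^sub>v y) \<in> carrier_vec n" "Q *\<^sub>v x \<in> carrier_vec n"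
    using c by auto
  have "S *\<^sub>v (D *\<^sub>v (S *\<^sub>v x) + A *\<^sub>v x) = (S * (D * S + A)) *\<^sub>v x"
    using c by (simp add: assoc_mult_mat_vec[of _ n n _ n] add_mult_distrib_mat_vec[of _ n n])
  also have "\<dots> = - (transpose_mat A *\<^sub>v (S *\<^sub>v x)) - Q *\<^sub>v x"
    unfolding eq using c
    by (simp add: minus_mult_distrib_mat_vec[of _ n n] uminus_mult_mat_vec[of _ n n] assoc_mult_mat_vec[of _ n n _ n])
  finally have 1: "S *\<^sub>v (D *\<^sub>v (S *\<^sub>v x) + A *\<^sub>v x) = - (transpose_mat A *\<^sub>v (S *\<^sub>v x)) - Q *\<^sub>v x" .
  have "S *\<^sub>v (D *\<^sub>v (y + S *\<^sub>v x) + A *\<^sub>v x) = S *\<^sub>v (D *\<^sub>v y) + S *\<^sub>v (D *\<^sub>v (S *\<^sub>v x) + A *\<^sub>v x)"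
    using c by (simp add: mult_add_distrib_mat_vec[of _ n n] assoc_add_vec[of _ n])
  then show ?thesis unfolding 1 using c by (simp add: mult_add_distrib_mat_vec[of _ n n] alg)
qed

text \<open>The shear from (p, x) to (p - S x, x) is symplectic because S is symmetric.\<close>

lemma symplectic_form_graph_coordinate:
  fixes S :: "'a::comm_ring_1 mat"
  assumes S: "S \<in> carrier_mat n n" "transpose_mat S = S"
    and c: "x \<in> carrier_vec n" "y \<in> carrier_vec n" "x' \<in> carrier_vec n" "y' \<in> carrier_vec n"
  shows "symplectic_form n ((y + S *\<^sub>v x) @\<^sub>v x) ((y' + S *\<^sub>v x') @\<^sub>v x') = y \<bullet> x' - x \<bullet> y'"
  using S c symmetric_scalar_prod[OF S c(1,3)]
  by (simp add: symplectic_form_append add_scalar_prod_distrib[of _ n] scalar_prod_add_distrib[of _ n])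

lemma mult_mat_zero_vec:
  fixes M :: "'a::comm_ring_1 mat"
  assumes "M \<in> carrier_mat n m"
  shows "M *\<^sub>v 0\<^sub>v m = 0\<^sub>v n"
  using assms by (intro eq_vecI) auto

lemma append_vec_minus:
  fixes p x :: "'a::group_add vec"
  assumes "p \<in> carrier_vec n" "q \<in> carrier_vec n" "x \<in> carrier_vec m" "y \<in> carrier_vec m"
  shows "(p @\<^sub>v x) - (q @\<^sub>v y) = (p - q) @\<^sub>v (x - y)"
  using assms[THEN carrier_vecD] by (intro eq_vecI) auto

section \<open>The control problem and its invariant Lagrangian graphs\<close>

locale lq =
  fixes n k :: nat and A B Q :: "real mat"
  assumes A [simp]: "A \<in> carrier_mat n n" and B [simp]: "B \<in> carrier_mat n k"
    and Q [simp]: "Q \<in> carrier_mat n n" and Q_sym: "transpose_mat Q = Q"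
    and controllable: "controllable n A B"
begin

definition D :: "real mat" where "D = B * transpose_mat B"
definition H :: "real mat" where "H = ham A D Q"

lemma D [simp]: "D \<in> carrier_mat n n" by (simp add: D_def mult_carrier_mat[OF B])
lemma D_sym: "transpose_mat D = D" by (simp add: D_def transpose_mult[of _ n k _ n])
lemma H [simp]: "H \<in> carrier_mat (n + n) (n + n)" by (simp add: H_def)

lemma mult_vec_carrier [simp]:
  assumes "p \<in> carrier_vec n"
  shows "A *\<^sub>v p \<in> carrier_vec n" "D *\<^sub>v p \<in> carrier_vec n" "Q *\<^sub>v p \<in> carrier_vec n"
    "transpose_mat A *\<^sub>v p \<in> carrier_vec n" "transpose_mat B *\<^sub>v p \<in> carrier_vec k"
  using assms by (auto intro: mult_mat_vec_carrier[of _ _ n])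

lemma D_mult_vec: "p \<in> carrier_vec n \<Longrightarrow> D *\<^sub>v p = B *\<^sub>v (transpose_mat B *\<^sub>v p)"
  by (simp add: D_def assoc_mult_mat_vec[of _ n k _ n])

lemma D_scalar_prod:
  "p \<in> carrier_vec n \<Longrightarrow> p \<bullet> (D *\<^sub>v p) = (transpose_mat B *\<^sub>v p) \<bullet> (transpose_mat B *\<^sub>v p)"
  unfolding D_mult_vec by (rule transpose_vec_mult_scalar[OF B, symmetric]) auto

lemma uncontrollable_trivial:
  assumes "W \<subseteq> carrier_vec n" "\<And>p. p \<in> W \<Longrightarrow> transpose_mat B *\<^sub>v p = 0\<^sub>v k"
    "\<And>p. p \<in> W \<Longrightarrow> transpose_mat A *\<^sub>v p \<in> W" "p \<in> W"
  shows "p = 0\<^sub>v n"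
proof (rule controllable_orthogonal[OF A B controllable])
  fix j
  have "((*\<^sub>v) (transpose_mat A) ^^ j) p \<in> W" by (induction j) (use assms(3,4) in auto)
  then show "transpose_mat B *\<^sub>v ((*\<^sub>v) (transpose_mat A) ^^ j) p = 0\<^sub>v k" by (rule assms(2))
qed (use assms in auto)

text \<open>Grouped so as to read as invariance of the graph: \<open>H\<close> sends (S x, x) to (-
  A^T S x - Q x, (D S + A) x), and the first component must be S applied to the second.\<close>

definition riccati :: "real mat \<Rightarrow> bool" where
  "riccati S \<longleftrightarrow> S \<in> carrier_mat n n \<and> transpose_mat S = S \<and> S * (D * S + A) = - (transpose_mat A * S) - Q"

lemma H_append:
  "p \<in> carrier_vec n \<Longrightarrow> x \<in> carrier_vec n \<Longrightarrow>
    H *\<^sub>v (p @\<^sub>v x) = (- (transpose_mat A *\<^sub>v p) - Q *\<^sub>v x) @\<^sub>v (D *\<^sub>v p + A *\<^sub>v x)"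
  unfolding H_def by (rule ham_mult_vec) auto

text \<open>Once \<open>L\<close> contains no nonzero vertical vector, its projection to x is onto:
  if q is orthogonal to the projection, then (q, 0) is orthogonal to \<open>L\<close>, hence in
  \<open>L\<close>, hence 0. So \<open>L\<close> is a graph; isotropy makes its matrix symmetric and
  invariance is the Riccati equation.\<close>

theorem riccati_if_lagrangian:
  assumes L: "lin_subspace (n + n) L"
    and iso: "\<And>u v. u \<in> L \<Longrightarrow> v \<in> L \<Longrightarrow> symplectic_form n u v = 0"
    and HL: "\<And>u. u \<in> L \<Longrightarrow> H *\<^sub>v u \<in> L"
    and max: "\<And>v. v \<in> carrier_vec (n + n) \<Longrightarrow> (\<And>u. u \<in> L \<Longrightarrow> symplectic_form n u v = 0) \<Longrightarrow> v \<in> L"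
  obtains S where "riccati S"
proof -
  note sub = lin_subspaceD[OF L]
  have LE: "\<exists>p x. u = p @\<^sub>v x \<and> p \<in> carrier_vec n \<and> x \<in> carrier_vec n" if "u \<in> L" for u
    using subsetD[OF sub(1) that] by (rule carrier_vec_appendE) blast
  have vertical: "p = 0\<^sub>v n" if "p \<in> carrier_vec n" "p @\<^sub>v 0\<^sub>v n \<in> L" for p
  proof (rule uncontrollable_trivial)
    let ?W = "{p \<in> carrier_vec n. p @\<^sub>v 0\<^sub>v n \<in> L}"
    show "p \<in> ?W" using that by simp
    show "?W \<subseteq> carrier_vec n" by auto
    fix p assume p: "p \<in> ?W"
    then have pc: "p \<in> carrier_vec n" by simp
    let ?q = "transpose_mat A *\<^sub>v p"
    have q: "?q \<in> carrier_vec n" using pc by (intro mult_mat_vec_carrier[of _ n n]) auto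
    have "A *\<^sub>v 0\<^sub>v n = 0\<^sub>v n" "Q *\<^sub>v 0\<^sub>v n = 0\<^sub>v n"
      using funpow_mult_zero[OF A, of 1] funpow_mult_zero[OF Q, of 1] by simp_all
    then have Hp: "H *\<^sub>v (p @\<^sub>v 0\<^sub>v n) = (- ?q) @\<^sub>v (D *\<^sub>v p)"
      using pc q mult_mat_vec_carrier[OF D pc] by (simp add: H_append)
    then have HpL: "(- ?q) @\<^sub>v (D *\<^sub>v p) \<in> L" using HL[of "p @\<^sub>v 0\<^sub>v n"] p by simp
    from iso[OF _ this, of "p @\<^sub>v 0\<^sub>v n"] p have "p \<bullet> (D *\<^sub>v p) = 0"
      using q mult_mat_vec_carrier[OF D pc] by (simp add: symplectic_form_append)
    then show Bp: "transpose_mat B *\<^sub>v p = 0\<^sub>v k"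
      using D_scalar_prod[OF pc] scalar_prod_self_eq_0[of "transpose_mat B *\<^sub>v p" k] pc by simp
    then have "D *\<^sub>v p = 0\<^sub>v n"
      unfolding D_mult_vec[OF pc] using mult_mat_zero_vec[OF B] by simp
    then have "(- 1) \<cdot>\<^sub>v ((- ?q) @\<^sub>v 0\<^sub>v n) \<in> L" using HpL sub(4) by simp
    moreover have "(- 1) \<cdot>\<^sub>v ((- ?q) @\<^sub>v 0\<^sub>v n) = ?q @\<^sub>v 0\<^sub>v n"
      using q by (intro eq_vecI) auto
    ultimately show "?q \<in> ?W" using q by simp
  qed
  have graph: "\<exists>p\<in>carrier_vec n. p @\<^sub>v x \<in> L" if x: "x \<in> carrier_vec n" for x
  proof (rule ccontr)
    assume neg: "\<not> ?thesis"
    let ?U = "{x \<in> carrier_vec n. \<exists>p\<in>carrier_vec n. p @\<^sub>v x \<in> L}"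
    have "lin_subspace n ?U"
      unfolding lin_subspace_def
    proof (intro conjI ballI allI)
      show "0\<^sub>v n \<in> ?U" using sub(2) unfolding zero_vec_append by auto
    next
      fix u v assume "u \<in> ?U" "v \<in> ?U"
      then obtain p q where *: "u \<in> carrier_vec n" "v \<in> carrier_vec n" "p \<in> carrier_vec n" "q \<in> carrier_vec n"
        "p @\<^sub>v u \<in> L" "q @\<^sub>v v \<in> L" by blast
      then have "(p + q) @\<^sub>v (u + v) \<in> L" using sub(3)[OF *(5,6)] by (simp add: append_vec_add[of _ n _ _ n])
      then show "u + v \<in> ?U" using * by (intro CollectI conjI bexI[of _ "p + q"]) auto
    next
      fix c u assume "u \<in> ?U"
      then obtain p where *: "u \<in> carrier_vec n" "p \<in> carrier_vec n" "p @\<^sub>v u \<in> L" by blast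
      then have "(c \<cdot>\<^sub>v p) @\<^sub>v (c \<cdot>\<^sub>v u) \<in> L" using sub(4)[OF *(3), of c] by (simp add: smult_append_vec)
      then show "c \<cdot>\<^sub>v u \<in> ?U" using * by (intro CollectI conjI bexI[of _ "c \<cdot>\<^sub>v p"]) auto
    qed auto
    moreover have "x \<notin> ?U" using neg by blast
    ultimately obtain q where q: "q \<in> carrier_vec n" "\<forall>u\<in>?U. q \<bullet> u = 0" "q \<bullet> x \<noteq> 0"
      using separating_functional x by blast
    have "symplectic_form n u (q @\<^sub>v 0\<^sub>v n) = 0" if "u \<in> L" for u
    proof -
      obtain p x where u: "u = p @\<^sub>v x" "p \<in> carrier_vec n" "x \<in> carrier_vec n"
        using LE[OF \<open>u \<in> L\<close>] by blast
      then have "q \<bullet> x = 0" using q(2) that by blast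
      then show ?thesis using u q(1) by (simp add: symplectic_form_append comm_scalar_prod[of x n])
    qed
    then have "q @\<^sub>v 0\<^sub>v n \<in> L" using max[of "q @\<^sub>v 0\<^sub>v n"] q(1) by simp
    then have "q = 0\<^sub>v n" using vertical q(1) by blast
    then show False using q(3) x by simp
  qed
  define f where "f x = (SOME p. p \<in> carrier_vec n \<and> p @\<^sub>v x \<in> L)" for x
  have f: "f x \<in> carrier_vec n" "f x @\<^sub>v x \<in> L" if "x \<in> carrier_vec n" for x
    using someI_ex[of "\<lambda>p. p \<in> carrier_vec n \<and> p @\<^sub>v x \<in> L"] graph[OF that] unfolding f_def by auto
  define S where "S = mat n n (\<lambda>(i, j). f (unit_vec n j) $ i)"
  have S: "S \<in> carrier_mat n n" by (simp add: S_def)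
  have "{x \<in> carrier_vec n. (S *\<^sub>v x) @\<^sub>v x \<in> L} = carrier_vec n"
  proof (rule lin_subspace_eq_carrier_if_unit_vecs)
    show "lin_subspace n {x \<in> carrier_vec n. (S *\<^sub>v x) @\<^sub>v x \<in> L}"
      unfolding lin_subspace_def
    proof (intro conjI ballI allI)
      have "S *\<^sub>v 0\<^sub>v n = 0\<^sub>v n" using funpow_mult_zero[OF S, of 1] by simp
      then show "0\<^sub>v n \<in> {x \<in> carrier_vec n. (S *\<^sub>v x) @\<^sub>v x \<in> L}" using sub(2) unfolding zero_vec_append by auto
    next
      fix u v assume "u \<in> {x \<in> carrier_vec n. (S *\<^sub>v x) @\<^sub>v x \<in> L}" "v \<in> {x \<in> carrier_vec n. (S *\<^sub>v x) @\<^sub>v x \<in> L}"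
      then have *: "u \<in> carrier_vec n" "v \<in> carrier_vec n" "(S *\<^sub>v u) @\<^sub>v u \<in> L" "(S *\<^sub>v v) @\<^sub>v v \<in> L" by auto
      have "(S *\<^sub>v (u + v)) @\<^sub>v (u + v) = ((S *\<^sub>v u) @\<^sub>v u) + ((S *\<^sub>v v) @\<^sub>v v)"
        using * S by (simp add: append_vec_add[of _ n _ _ n] mult_add_distrib_mat_vec[of _ n n])
      then show "u + v \<in> {x \<in> carrier_vec n. (S *\<^sub>v x) @\<^sub>v x \<in> L}" using * sub(3)[OF *(3,4)] by simp
    next
      fix c u assume "u \<in> {x \<in> carrier_vec n. (S *\<^sub>v x) @\<^sub>v x \<in> L}"
      then have *: "u \<in> carrier_vec n" "(S *\<^sub>v u) @\<^sub>v u \<in> L" by auto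
      have "(S *\<^sub>v (c \<cdot>\<^sub>v u)) @\<^sub>v (c \<cdot>\<^sub>v u) = c \<cdot>\<^sub>v ((S *\<^sub>v u) @\<^sub>v u)"
        using * S by (simp add: smult_append_vec mult_mat_vec[of _ n n])
      then show "c \<cdot>\<^sub>v u \<in> {x \<in> carrier_vec n. (S *\<^sub>v x) @\<^sub>v x \<in> L}" using * sub(4)[OF *(2), of c] by simp
    qed auto
    fix j assume j: "j < n"
    have "S *\<^sub>v unit_vec n j = f (unit_vec n j)"
      using j f(1)[of "unit_vec n j"]
      by (intro eq_vecI) (auto simp: S_def scalar_prod_right_unit)
    then show "unit_vec n j \<in> {x \<in> carrier_vec n. (S *\<^sub>v x) @\<^sub>v x \<in> L}" using f(2)[of "unit_vec n j"] by simp
  qed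
  then have SL: "(S *\<^sub>v x) @\<^sub>v x \<in> L" if "x \<in> carrier_vec n" for x using that by blast
  have Sx: "S *\<^sub>v x \<in> carrier_vec n" if "x \<in> carrier_vec n" for x using that S by simp
  have uniq: "p = S *\<^sub>v x" if "p @\<^sub>v x \<in> L" "p \<in> carrier_vec n" "x \<in> carrier_vec n" for p x
  proof -
    have "(p @\<^sub>v x) - ((S *\<^sub>v x) @\<^sub>v x) = (p - S *\<^sub>v x) @\<^sub>v 0\<^sub>v n"
      using append_vec_minus[OF that(2) Sx[OF that(3)] that(3) that(3)] that(3) by simp
    then have "(p - S *\<^sub>v x) @\<^sub>v 0\<^sub>v n \<in> L" using sub(5)[OF that(1) SL[OF that(3)]] by simp
    then have 0: "p - S *\<^sub>v x = 0\<^sub>v n" using vertical that Sx[OF that(3)] by simp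
    have "p = (p - S *\<^sub>v x) + S *\<^sub>v x" using vec_diff_add[OF that(2) Sx[OF that(3)]] by simp
    then show ?thesis unfolding 0 using Sx[OF that(3)] by simp
  qed
  have sym: "transpose_mat S = S"
  proof (rule eq_mat_if_eq_mult_vec[of _ n n])
    fix x :: "real vec" assume x: "x \<in> carrier_vec n"
    show "transpose_mat S *\<^sub>v x = S *\<^sub>v x"
    proof (rule eq_vecI)
      fix i assume "i < dim_vec (S *\<^sub>v x)"
      then have i: "i < n" using S by simp
      have T: "transpose_mat S *\<^sub>v x \<in> carrier_vec n" using S x by (intro mult_mat_vec_carrier[of _ n n]) auto
      have "symplectic_form n ((S *\<^sub>v x) @\<^sub>v x) ((S *\<^sub>v unit_vec n i) @\<^sub>v unit_vec n i) = 0"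
        using SL x by (intro iso) auto
      then have "(S *\<^sub>v x) \<bullet> unit_vec n i = x \<bullet> (S *\<^sub>v unit_vec n i)"
        using x Sx by (simp add: symplectic_form_append)
      also have "\<dots> = (transpose_mat S *\<^sub>v x) \<bullet> unit_vec n i"
        using transpose_vec_mult_scalar[OF S _ x, of "unit_vec n i"] by simp
      finally show "(transpose_mat S *\<^sub>v x) $ i = (S *\<^sub>v x) $ i"
        using scalar_prod_right_unit[OF i, of "S *\<^sub>v x"] scalar_prod_right_unit[OF i, of "transpose_mat S *\<^sub>v x"] by simp
    qed (use S in simp)
  qed (use S in auto)
  have "S * (D * S + A) = - (transpose_mat A * S) - Q"
  proof (rule eq_mat_if_eq_mult_vec[of _ n n])
    fix x :: "real vec" assume x: "x \<in> carrier_vec n"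
    have c: "transpose_mat A *\<^sub>v (S *\<^sub>v x) \<in> carrier_vec n" "Q *\<^sub>v x \<in> carrier_vec n"
      "D *\<^sub>v (S *\<^sub>v x) \<in> carrier_vec n" "A *\<^sub>v x \<in> carrier_vec n"
      using x Sx by (auto intro: mult_mat_vec_carrier[of _ n n])
    have "- (transpose_mat A *\<^sub>v (S *\<^sub>v x)) - Q *\<^sub>v x = S *\<^sub>v (D *\<^sub>v (S *\<^sub>v x) + A *\<^sub>v x)"
    proof (rule uniq)
      show "(- (transpose_mat A *\<^sub>v (S *\<^sub>v x)) - Q *\<^sub>v x) @\<^sub>v (D *\<^sub>v (S *\<^sub>v x) + A *\<^sub>v x) \<in> L"
        using HL[OF SL[OF x]] unfolding H_append[OF Sx[OF x] x] .
    qed (use c in auto)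
    then show "(S * (D * S + A)) *\<^sub>v x = (- (transpose_mat A * S) - Q) *\<^sub>v x"
      using x S mult_carrier_mat[OF D S] mult_carrier_mat[OF transpose_carrier_mat[THEN iffD2, OF A] S]
      by (simp add: assoc_mult_mat_vec[of _ n n _ n] add_mult_distrib_mat_vec[of _ n n]
          minus_mult_distrib_mat_vec[of _ n n] uminus_mult_mat_vec[of _ n n])
  next
    show "S * (D * S + A) \<in> carrier_mat n n"
      using mult_carrier_mat[OF S, of "D * S + A" n] by simp
    show "- (transpose_mat A * S) - Q \<in> carrier_mat n n"
      by (rule minus_carrier_mat) simp
  qed
  then show thesis using that S sym unfolding riccati_def by blast
qed

end

subsection \<open>Solvability of the Riccati equation and odd Jordan blocks\<close>

lemma conjugate_append_vec:
  "conjugate (p @\<^sub>v x) = conjugate p @\<^sub>v conjugate (x :: complex vec)"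
  by (rule eq_vecI) auto

lemma conjugate_real_mat_mult_vec:
  assumes "M \<in> carrier_mat n m" "v \<in> carrier_vec m"
  shows "conjugate (map_mat complex_of_real M *\<^sub>v v) = map_mat complex_of_real M *\<^sub>v conjugate v"
  using assms by (intro eq_vecI) (auto simp: scalar_prod_def cnj_sum)

lemma Re_Im_real_mat_mult_vec:
  assumes "M \<in> carrier_mat n m" "v \<in> carrier_vec m"
  shows "map_vec Re (map_mat complex_of_real M *\<^sub>v v) = M *\<^sub>v map_vec Re v"
    and "map_vec Im (map_mat complex_of_real M *\<^sub>v v) = M *\<^sub>v map_vec Im v"
  using assms by (auto simp: scalar_prod_def intro!: eq_vecI)

lemma map_mat_of_real_transpose:
  "transpose_mat (map_mat complex_of_real M) = map_mat complex_of_real (transpose_mat M)"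
  by (rule eq_matI) auto

lemma map_mat_of_real_arith:
  assumes "M \<in> carrier_mat n m"
  shows "N \<in> carrier_mat n m \<Longrightarrow>
      map_mat complex_of_real (M + N) = map_mat complex_of_real M + map_mat complex_of_real N"
    and "N \<in> carrier_mat n m \<Longrightarrow>
      map_mat complex_of_real (M - N) = map_mat complex_of_real M - map_mat complex_of_real N"
    and "map_mat complex_of_real (- M) = - map_mat complex_of_real M"
  using assms by (auto intro!: eq_matI)

lemma vec_add_diff:
  fixes u v :: "'a::group_add vec"
  assumes "u \<in> carrier_vec n" "v \<in> carrier_vec n"
  shows "u + v - v = u"
  using assms by (intro eq_vecI) auto

lemma conjugate_arith:
  fixes a r y :: "complex vec"
  assumes "a \<in> carrier_vec n" "r \<in> carrier_vec n" "y \<in> carrier_vec n" "cnj c = - c"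
  shows "conjugate (- a - r - c \<cdot>\<^sub>v y) = - conjugate a - conjugate r + c \<cdot>\<^sub>v conjugate y"
  using assms by (intro eq_vecI) auto

lemma eq_smult_if_arith:
  fixes a y :: "complex vec"
  assumes "a \<in> carrier_vec n" "y \<in> carrier_vec n" "- a - 0\<^sub>v n - c \<cdot>\<^sub>v y = 0\<^sub>v n"
  shows "a = (- c) \<cdot>\<^sub>v y"
proof (rule eq_vecI)
  fix i assume "i < dim_vec ((- c) \<cdot>\<^sub>v y)"
  then have i: "i < n" using assms by simp
  have "(- a - 0\<^sub>v n - c \<cdot>\<^sub>v y) $ i = 0" unfolding assms(3) using i by simp
  then show "a $ i = ((- c) \<cdot>\<^sub>v y) $ i" using i assms(1,2) by (simp add: neg_eq_iff_add_eq_0 eq_neg_iff_add_eq_0 add.commute)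
qed (use assms in simp)

lemma symplectic_form_conjugate:
  fixes u v :: "complex vec"
  assumes "u \<in> carrier_vec (n + n)" "v \<in> carrier_vec (n + n)"
  shows "symplectic_form n (conjugate u) (conjugate v) = cnj (symplectic_form n u v)"
  using assms
proof (elim carrier_vec_appendE)
  fix p x p' x' :: "complex vec" assume v: "u = p @\<^sub>v x" "v = p' @\<^sub>v x'"
    and c: "p \<in> carrier_vec n" "x \<in> carrier_vec n" "p' \<in> carrier_vec n" "x' \<in> carrier_vec n"
  have "conjugate a \<bullet> conjugate b = cnj (a \<bullet> b)" if "a \<in> carrier_vec n" "b \<in> carrier_vec n" for a b :: "complex vec"
    using that by (simp add: scalar_prod_def cnj_sum)
  then show ?thesis using c by (simp add: v conjugate_append_vec symplectic_form_append)
qed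

lemma conjugate_scalar_prod_self_eq_0:
  fixes v :: "complex vec"
  assumes "v \<in> carrier_vec n" "conjugate v \<bullet> v = 0"
  shows "v = 0\<^sub>v n"
proof -
  have "v \<bullet> conjugate v = 0" using assms comm_scalar_prod[of v n "conjugate v"] by simp
  then show ?thesis using conjugate_square_eq_0_vec[OF assms(1)] by simp
qed

context lq
begin

abbreviation cA :: "complex mat" where "cA \<equiv> map_mat complex_of_real A"
abbreviation cB :: "complex mat" where "cB \<equiv> map_mat complex_of_real B"
abbreviation cD :: "complex mat" where "cD \<equiv> map_mat complex_of_real D"
abbreviation cQ :: "complex mat" where "cQ \<equiv> map_mat complex_of_real Q"
abbreviation cH :: "complex mat" where "cH \<equiv> map_mat complex_of_real H"

lemma cH_eq: "cH = ham cA cD cQ"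
  unfolding H_def ham_def using carrier_matD[OF A] carrier_matD[OF D] carrier_matD[OF Q]
  by (intro eq_matI) auto

definition hform :: "complex vec \<Rightarrow> complex vec \<Rightarrow> complex" where
  "hform u v = symplectic_form n (conjugate u) v"

lemma symplectic_form_cH:
  "u \<in> carrier_vec (n + n) \<Longrightarrow> v \<in> carrier_vec (n + n) \<Longrightarrow>
    symplectic_form n (cH *\<^sub>v u) v = - symplectic_form n u (cH *\<^sub>v v)"
  unfolding cH_eq by (rule symplectic_form_ham) (auto simp: map_mat_of_real_transpose D_sym Q_sym)

sublocale cx: hermitian_hamiltonian "n + n" cH hform
proof
  show "cH \<in> carrier_mat (n + n) (n + n)" by simp
  fix u v w :: "complex vec" and c
  assume u: "u \<in> carrier_vec (n + n)" and v: "v \<in> carrier_vec (n + n)"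
  show "hform u (c \<cdot>\<^sub>v v) = c * hform u v"
    unfolding hform_def using u v by (simp add: symplectic_form_smult_right)
  show "hform v u = - cnj (hform u v)"
  proof -
    have "symplectic_form n u (conjugate v) = cnj (symplectic_form n (conjugate u) v)"
      using symplectic_form_conjugate[OF carrier_vec_conjugate[OF u] v] by (simp only: conjugate_id)
    then show ?thesis
      using symplectic_form_skew[OF u carrier_vec_conjugate[OF v]] by (simp add: hform_def)
  qed
  show conj: "cH *\<^sub>v conjugate u = conjugate (cH *\<^sub>v u)" if "u \<in> carrier_vec (n + n)" for u
    using conjugate_real_mat_mult_vec[OF H that] by simp
  show "hform (cH *\<^sub>v u) v = - hform u (cH *\<^sub>v v)"
    unfolding hform_def conj[OF u, symmetric] using u v by (simp add: symplectic_form_cH)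
  show "hform (conjugate u) (conjugate v) = cnj (hform u v)"
    unfolding hform_def by (rule symplectic_form_conjugate[OF carrier_vec_conjugate[OF u] v])
  assume w: "w \<in> carrier_vec (n + n)"
  show "hform u (v + w) = hform u v + hform u w"
    unfolding hform_def using u v w by (simp add: symplectic_form_add_right)
next
  fix U and w :: "complex vec"
  assume "lin_subspace (n + n) U" "w \<in> carrier_vec (n + n)" "w \<notin> U"
  from symplectic_form_separating[OF this] obtain q where
    "q \<in> carrier_vec (n + n)" "\<forall>u\<in>U. symplectic_form n q u = 0" "symplectic_form n q w \<noteq> 0" by blast
  then show "\<exists>q\<in>carrier_vec (n + n). (\<forall>u\<in>U. hform q u = 0) \<and> hform q w \<noteq> 0"
    unfolding hform_def by (intro bexI[of _ "conjugate q"]) auto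
qed

text \<open>Real matrices commute with taking real and imaginary parts, so the real statement
  applies to both images of \<open>W\<close>.\<close>

lemma complex_uncontrollable_trivial:
  assumes W: "W \<subseteq> carrier_vec n" "\<And>p. p \<in> W \<Longrightarrow> transpose_mat cB *\<^sub>v p = 0\<^sub>v k"
    "\<And>p. p \<in> W \<Longrightarrow> transpose_mat cA *\<^sub>v p \<in> W" and p: "p \<in> W"
  shows "p = 0\<^sub>v n"
proof -
  have tB: "transpose_mat B \<in> carrier_mat k n" and tA: "transpose_mat A \<in> carrier_mat n n" by auto
  have zero: "map_vec f p = 0\<^sub>v n"
    if f: "\<And>M m v. M \<in> carrier_mat m n \<Longrightarrow> v \<in> carrier_vec n \<Longrightarrow>
        map_vec f (map_mat complex_of_real M *\<^sub>v v) = M *\<^sub>v map_vec f v" "f 0 = 0" for f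
  proof (rule uncontrollable_trivial)
    show "map_vec f ` W \<subseteq> carrier_vec n" using W(1) by auto
    show "map_vec f p \<in> map_vec f ` W" using p by simp
    fix q assume "q \<in> map_vec f ` W"
    then obtain r where r: "r \<in> W" "q = map_vec f r" by blast
    have rc: "r \<in> carrier_vec n" using r W(1) by blast
    have "transpose_mat B *\<^sub>v q = map_vec f (0\<^sub>v k)"
      using f(1)[OF tB rc] W(2)[OF r(1)] r(2) by (simp add: map_mat_of_real_transpose)
    then show "transpose_mat B *\<^sub>v q = 0\<^sub>v k" using f(2) by (auto intro!: eq_vecI)
    show "transpose_mat A *\<^sub>v q \<in> map_vec f ` W"
      using f(1)[OF tA rc] imageI[OF W(3)[OF r(1)], of "map_vec f"] r(2)
      by (simp add: map_mat_of_real_transpose)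
  qed
  have "map_vec Re p = 0\<^sub>v n" "map_vec Im p = 0\<^sub>v n"
    by (rule zero, rule Re_Im_real_mat_mult_vec, assumption+, simp)+
  moreover have "p \<in> carrier_vec n" using p W(1) by blast
  ultimately show ?thesis
  proof (intro eq_vecI)
    fix i assume *: "map_vec Re p = 0\<^sub>v n" "map_vec Im p = 0\<^sub>v n" "p \<in> carrier_vec n" "i < dim_vec (0\<^sub>v n :: complex vec)"
    then have i: "i < n" "i < dim_vec p" by simp_all
    have "Re (p $ i) = 0" "Im (p $ i) = 0"
      unfolding index_map_vec(1)[OF i(2), symmetric] *(1,2) using i by simp_all
    then show "p $ i = 0\<^sub>v n $ i" using i by (simp add: complex_eq_iff)
  qed auto
qed

theorem riccati_no_odd_block:
  assumes S: "riccati S" and odd: "odd e"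
  shows "no_jordan_block (n + n) (cx.N b) e"
proof -
  have Sc: "S \<in> carrier_mat n n" and Ssym: "transpose_mat S = S"
    and ric: "S * (D * S + A) = - (transpose_mat A * S) - Q" using S by (auto simp: riccati_def)
  define R where "R = map_mat complex_of_real S"
  have R [simp]: "R \<in> carrier_mat n n" using Sc by (simp add: R_def)
  have Rsym: "transpose_mat R = R" using Ssym by (simp add: R_def map_mat_of_real_transpose)
  have cric: "R * (cD * R + cA) = - (transpose_mat cA * R) - cQ"
  proof -
    have DS: "D * S \<in> carrier_mat n n" "transpose_mat A * S \<in> carrier_mat n n" "D * S + A \<in> carrier_mat n n"
      using mult_carrier_mat[OF D Sc] mult_carrier_mat[of "transpose_mat A" n n S n] Sc by auto
    have "map_mat complex_of_real (S * (D * S + A)) = R * (cD * R + cA)"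
      unfolding R_def of_real_hom.mat_hom_mult[OF Sc DS(3)] of_real_hom.mat_hom_mult[OF D Sc, symmetric]
      using map_mat_of_real_arith(1)[OF DS(1) A] by simp
    moreover have "map_mat complex_of_real (- (transpose_mat A * S) - Q) = - (transpose_mat cA * R) - cQ"
      unfolding R_def map_mat_of_real_transpose of_real_hom.mat_hom_mult[OF transpose_carrier_mat[THEN iffD2, OF A] Sc, symmetric]
      using map_mat_of_real_arith(2)[OF uminus_carrier_mat[OF DS(2)] Q] map_mat_of_real_arith(3)[OF DS(2)] by simp
    ultimately show ?thesis using ric by simp
  qed
  have [simp]: "M *\<^sub>v v \<in> carrier_vec n" if "M \<in> carrier_mat n n" "v \<in> carrier_vec n" for M :: "complex mat" and v
    using that by simp
  define c where "c = \<i> * complex_of_real b"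
  have cnjc: "cnj c = - c" by (simp add: c_def)
  \<comment> \<open>The action of \<open>N b\<close> on the transverse coordinate y = p - S x; the
    Riccati equation keeps x out of it.\<close>
  define F where "F y = (- (transpose_mat cA *\<^sub>v y) - R *\<^sub>v (cD *\<^sub>v y)) - c \<cdot>\<^sub>v y" for y
  define yc where "yc v = vec_first v n - R *\<^sub>v vec_last v n" for v
  have yc: "yc ((y + R *\<^sub>v x) @\<^sub>v x) = y" if "x \<in> carrier_vec n" "y \<in> carrier_vec n" for x y
  proof -
    have "y + R *\<^sub>v x - R *\<^sub>v x = y" using that R by (intro vec_add_diff[of _ n]) auto
    then show ?thesis using that R by (simp add: yc_def)
  qed
  have coord: "v = (yc v + R *\<^sub>v vec_last v n) @\<^sub>v vec_last v n" "yc v \<in> carrier_vec n" "vec_last v n \<in> carrier_vec n"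
    if "v \<in> carrier_vec (n + n)" for v
    using vec_first_last_append[OF that] vec_diff_add[of "vec_first v n" n "R *\<^sub>v vec_last v n"] R
    unfolding yc_def by auto
  have N: "cx.N b *\<^sub>v ((y + R *\<^sub>v x) @\<^sub>v x) =
      (F y + R *\<^sub>v (cD *\<^sub>v (y + R *\<^sub>v x) + cA *\<^sub>v x - c \<cdot>\<^sub>v x)) @\<^sub>v (cD *\<^sub>v (y + R *\<^sub>v x) + cA *\<^sub>v x - c \<cdot>\<^sub>v x)"
    if xy: "x \<in> carrier_vec n" "y \<in> carrier_vec n" for x y
  proof -
    let ?p = "y + R *\<^sub>v x"
    let ?P = "- (transpose_mat cA *\<^sub>v ?p) - cQ *\<^sub>v x" and ?X = "cD *\<^sub>v ?p + cA *\<^sub>v x"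
    have car: "?p \<in> carrier_vec n" "?P \<in> carrier_vec n" "?X \<in> carrier_vec n" "?X - c \<cdot>\<^sub>v x \<in> carrier_vec n"
      "R *\<^sub>v x \<in> carrier_vec n" "R *\<^sub>v ?X \<in> carrier_vec n" "R *\<^sub>v (cD *\<^sub>v y) \<in> carrier_vec n" "transpose_mat cA *\<^sub>v y \<in> carrier_vec n"
      using xy by auto
    have "cx.N b *\<^sub>v (?p @\<^sub>v x) = (cH *\<^sub>v (?p @\<^sub>v x)) - c \<cdot>\<^sub>v (?p @\<^sub>v x)"
      unfolding c_def by (rule cx.Nv) (use xy car in simp)
    also have "cH *\<^sub>v (?p @\<^sub>v x) = ?P @\<^sub>v ?X"
      unfolding cH_eq by (rule ham_mult_vec) (use xy car in simp_all)
    also have "(?P @\<^sub>v ?X) - c \<cdot>\<^sub>v (?p @\<^sub>v x) = (?P - c \<cdot>\<^sub>v ?p) @\<^sub>v (?X - c \<cdot>\<^sub>v x)"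
      unfolding smult_append_vec by (rule append_vec_minus[of _ n _ _ n]) (use xy car in simp_all)
    also have "?P - c \<cdot>\<^sub>v ?p = F y + R *\<^sub>v (?X - c \<cdot>\<^sub>v x)"
    proof -
      have g: "?P - R *\<^sub>v ?X = - (transpose_mat cA *\<^sub>v y) - R *\<^sub>v (cD *\<^sub>v y)"
        by (rule ham_graph_coordinate) (use xy cric in simp_all)
      have RX: "R *\<^sub>v (?X - c \<cdot>\<^sub>v x) = R *\<^sub>v ?X - c \<cdot>\<^sub>v (R *\<^sub>v x)"
        using xy car by (simp add: mult_minus_distrib_mat_vec[of _ n n] mult_mat_vec[of _ n n])
      have alg: "P - c \<cdot>\<^sub>v (y + r) = (P - X - c \<cdot>\<^sub>v y) + (X - c \<cdot>\<^sub>v r)"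
        if "P \<in> carrier_vec n" "X \<in> carrier_vec n" "y \<in> carrier_vec n" "r \<in> carrier_vec n" for P X y r :: "complex vec"
        using that by (intro eq_vecI) (auto simp: algebra_simps)
      show ?thesis unfolding F_def g[symmetric] RX
        by (rule alg) (use xy car in simp_all)
    qed
    finally show ?thesis .
  qed
  have hform_coord: "hform ((y + R *\<^sub>v x) @\<^sub>v x) ((y' + R *\<^sub>v x') @\<^sub>v x') = conjugate y \<bullet> x' - conjugate x \<bullet> y'"
    if "x \<in> carrier_vec n" "y \<in> carrier_vec n" "x' \<in> carrier_vec n" "y' \<in> carrier_vec n" for x y x' y'
  proof -
    have "conjugate (R *\<^sub>v x) = R *\<^sub>v conjugate x"
      unfolding R_def using conjugate_real_mat_mult_vec[OF Sc that(1)] .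
    then have "conjugate ((y + R *\<^sub>v x) @\<^sub>v x) = (conjugate y + R *\<^sub>v conjugate x) @\<^sub>v conjugate x"
      using that by (simp add: conjugate_append_vec conjugate_add_vec[of _ n])
    then show ?thesis
      unfolding hform_def using symplectic_form_graph_coordinate[OF R Rsym, of "conjugate x" "conjugate y" x' y'] that
      by simp
  qed
  \<comment> \<open>Here \<open>yc\<close> of the image being 0 means F y = 0. Then h w (N w)
    reduces to |B^T y|^2, so B^T y = 0, and F y = 0 becomes A^T y = - c y. The line through y
    contradicts controllability unless y = 0.\<close>
  have key: "yc w = 0\<^sub>v n"
    if w: "w \<in> carrier_vec (n + n)" and Nw: "yc (cx.N b *\<^sub>v w) = 0\<^sub>v n" and h0: "hform w (cx.N b *\<^sub>v w) = 0" for w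
  proof -
    obtain x y where xy: "x \<in> carrier_vec n" "y \<in> carrier_vec n" and weq: "w = (y + R *\<^sub>v x) @\<^sub>v x"
      using coord[OF w] by blast
    let ?x' = "cD *\<^sub>v (y + R *\<^sub>v x) + cA *\<^sub>v x - c \<cdot>\<^sub>v x"
    have Fc: "F y \<in> carrier_vec n" using xy by (simp add: F_def)
    have x'c: "?x' \<in> carrier_vec n" using xy by simp
    have F0: "F y = 0\<^sub>v n" using Nw unfolding weq N[OF xy] yc[OF x'c Fc] .
    have cc: "conjugate (transpose_mat cA *\<^sub>v y) = transpose_mat cA *\<^sub>v conjugate y"
      "conjugate (R *\<^sub>v (cD *\<^sub>v y)) = R *\<^sub>v (cD *\<^sub>v conjugate y)"
      unfolding R_def map_mat_of_real_transpose
      using conjugate_real_mat_mult_vec[of "transpose_mat A" n n y] conjugate_real_mat_mult_vec[OF D xy(2)]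
        conjugate_real_mat_mult_vec[OF Sc, of "cD *\<^sub>v y"] xy by auto
    have neg: "(- a) \<bullet> b = - (a \<bullet> b)" if "a \<in> carrier_vec n" "b \<in> carrier_vec n" for a b :: "complex vec"
      using that by (simp add: scalar_prod_def sum_negf)
    have "conjugate (F y) = - (transpose_mat cA *\<^sub>v conjugate y) - R *\<^sub>v (cD *\<^sub>v conjugate y) + c \<cdot>\<^sub>v conjugate y"
      unfolding cc[symmetric] F_def by (rule conjugate_arith[OF _ _ xy(2) cnjc]) (use xy in auto)
    from this[symmetric]
    have "(- (transpose_mat cA *\<^sub>v conjugate y) - R *\<^sub>v (cD *\<^sub>v conjugate y) + c \<cdot>\<^sub>v conjugate y) \<bullet> x = 0"
      unfolding F0 using xy by simp
    then have e1: "- ((transpose_mat cA *\<^sub>v conjugate y) \<bullet> x) - (R *\<^sub>v (cD *\<^sub>v conjugate y)) \<bullet> x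
        + c * (conjugate y \<bullet> x) = 0"
      using xy by (simp add: add_scalar_prod_distrib[of _ n] minus_scalar_prod_distrib[of _ n] neg)
    have e2: "(transpose_mat cA *\<^sub>v conjugate y) \<bullet> x = conjugate y \<bullet> (cA *\<^sub>v x)"
      by (rule transpose_vec_mult_scalar[of _ n n]) (use xy in auto)
    have cDsym: "transpose_mat cD = cD" by (simp add: map_mat_of_real_transpose D_sym)
    have e3: "(R *\<^sub>v (cD *\<^sub>v conjugate y)) \<bullet> x = conjugate y \<bullet> (cD *\<^sub>v (R *\<^sub>v x))"
      using symmetric_scalar_prod[OF R Rsym, of "cD *\<^sub>v conjugate y" x]
        symmetric_scalar_prod[OF _ cDsym, of n "conjugate y" "R *\<^sub>v x"] xy by simp
    have "conjugate y \<bullet> ?x' = 0"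
      using h0 hform_coord[OF xy x'c zero_carrier_vec] xy unfolding weq N[OF xy] F0 by simp
    then have "conjugate y \<bullet> (cD *\<^sub>v y) + conjugate y \<bullet> (cD *\<^sub>v (R *\<^sub>v x)) + conjugate y \<bullet> (cA *\<^sub>v x) - c * (conjugate y \<bullet> x) = 0"
      using xy by (simp add: scalar_prod_add_distrib[of _ n] scalar_prod_minus_distrib[of _ n]
          mult_add_distrib_mat_vec[of _ n n])
    then have "conjugate y \<bullet> (cD *\<^sub>v y) = 0" using e1 unfolding e2 e3 by (simp add: algebra_simps)
    moreover have Dy: "cD *\<^sub>v y = cB *\<^sub>v (transpose_mat cB *\<^sub>v y)"
    proof -
      have "cD = cB * transpose_mat cB"
        unfolding D_def map_mat_of_real_transpose by (rule of_real_hom.mat_hom_mult[OF B transpose_carrier_mat[THEN iffD2, OF B]])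
      then show ?thesis using xy by (simp add: assoc_mult_mat_vec[of _ n k _ n])
    qed
    moreover have "conjugate (transpose_mat cB *\<^sub>v y) = transpose_mat cB *\<^sub>v conjugate y"
      unfolding map_mat_of_real_transpose by (rule conjugate_real_mat_mult_vec[of _ k n]) (use xy in auto)
    moreover have By: "transpose_mat cB *\<^sub>v y \<in> carrier_vec k"
      using xy by (intro mult_mat_vec_carrier[of _ k n]) auto
    ultimately have "conjugate (transpose_mat cB *\<^sub>v y) \<bullet> (transpose_mat cB *\<^sub>v y) = 0"
      using transpose_vec_mult_scalar[of cB n k "transpose_mat cB *\<^sub>v y" "conjugate y"] xy by simp
    then have B0: "transpose_mat cB *\<^sub>v y = 0\<^sub>v k" using conjugate_scalar_prod_self_eq_0 By by blast
    then have D0: "R *\<^sub>v (cD *\<^sub>v y) = 0\<^sub>v n"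
      unfolding Dy using mult_mat_zero_vec[of cB n k] mult_mat_zero_vec[OF R] by simp
    have A0: "transpose_mat cA *\<^sub>v y = (- c) \<cdot>\<^sub>v y"
      by (rule eq_smult_if_arith[of _ n]) (use xy F0 D0 in \<open>simp_all add: F_def\<close>)
    have "y = 0\<^sub>v n"
    proof (rule complex_uncontrollable_trivial[of "range (\<lambda>a. a \<cdot>\<^sub>v y)"])
      show "y \<in> range (\<lambda>a. a \<cdot>\<^sub>v y)" by (rule image_eqI[of _ _ 1]) auto
      fix p assume "p \<in> range (\<lambda>a. a \<cdot>\<^sub>v y)"
      then obtain a where p: "p = a \<cdot>\<^sub>v y" by blast
      show "transpose_mat cB *\<^sub>v p = 0\<^sub>v k"
        unfolding p using xy B0 mult_mat_vec[of "transpose_mat cB" k n y a] by simp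
      show "transpose_mat cA *\<^sub>v p \<in> range (\<lambda>a. a \<cdot>\<^sub>v y)"
        unfolding p using xy A0 mult_mat_vec[of "transpose_mat cA" n n y a] by (auto simp: smult_smult_assoc)
    qed (use xy in auto)
    then show ?thesis using yc[OF xy] weq by simp
  qed
  \<comment> \<open>\<open>yc\<close> vanishes exactly on the graph of \<open>S\<close>.\<close>
  have half: "yc (cx.T b (j div 2) v) = 0\<^sub>v n" if "v \<in> carrier_vec (n + n)" "cx.T b j v = 0\<^sub>v (n + n)" for j v
    using that
  proof (induction j arbitrary: v)
    case 0
    have "0\<^sub>v n + R *\<^sub>v 0\<^sub>v n = 0\<^sub>v n" using mult_mat_zero_vec[OF R] by simp
    then show ?case using 0 yc[of "0\<^sub>v n" "0\<^sub>v n"] by (simp add: zero_vec_append)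
  next
    case (Suc j)
    have "cx.T b j (cx.T b 1 v) = 0\<^sub>v (n + n)" using Suc.prems by (simp add: cx.T_T)
    then have IH: "yc (cx.T b (Suc (j div 2)) v) = 0\<^sub>v n"
      using Suc.IH[of "cx.T b 1 v"] Suc.prems by (simp add: cx.T_T)
    show ?case
    proof (cases "even (Suc j)")
      case True
      then have "Suc j div 2 = Suc (j div 2)" by presburger
      then show ?thesis using IH by simp
    next
      case False
      then have j: "Suc j div 2 = j div 2" "j div 2 + Suc (j div 2) = Suc j" by presburger+
      let ?w = "cx.T b (j div 2) v"
      \<comment> \<open>The exponents j div 2 and j div 2 + 1 add up to the odd number j + 1, so
        moving the powers to one side leaves N^(j + 1) v = 0. This is the isotropy that
        \<open>key\<close> asks for.\<close>
      have "hform ?w (cx.N b *\<^sub>v ?w) = (- 1) ^ (j div 2) * hform v (cx.T b (Suc j) v)"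
        using cx.h_T[of v "cx.T b (Suc (j div 2)) v" b "j div 2"] Suc.prems j(2)
        by (simp add: cx.T_T flip: cx.T_Suc)
      then have "hform ?w (cx.N b *\<^sub>v ?w) = 0" using Suc.prems by simp
      then show ?thesis unfolding j(1)
        by - (rule key, insert Suc.prems IH, simp_all flip: cx.T_Suc)
    qed
  qed
  obtain r where e: "e = 2 * r + 1" using odd by (elim oddE)
  show ?thesis
    unfolding no_jordan_block_def cx.T_def[symmetric]
  proof (intro ballI impI)
    fix v assume v: "v \<in> carrier_vec (n + n)" "cx.T b e v = 0\<^sub>v (n + n)"
    have "hform u (cx.T b (e - 1) v) = 0" if u: "u \<in> carrier_vec (n + n)" "cx.T b e u = 0\<^sub>v (n + n)" for u
    proof -
      let ?u = "cx.T b r u" and ?v = "cx.T b r v"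
      have 0: "yc ?u = 0\<^sub>v n" "yc ?v = 0\<^sub>v n" using half[OF u] half[OF v] e by simp_all
      have c: "?u \<in> carrier_vec (n + n)" "?v \<in> carrier_vec (n + n)" using u v by simp_all
      have "hform ((0\<^sub>v n + R *\<^sub>v vec_last ?u n) @\<^sub>v vec_last ?u n) ((0\<^sub>v n + R *\<^sub>v vec_last ?v n) @\<^sub>v vec_last ?v n) = 0"
        by (subst hform_coord) auto
      then have "hform ?u ?v = 0" using coord(1)[OF c(1)] coord(1)[OF c(2)] unfolding 0 by metis
      then have "(- 1) ^ r * hform u (cx.T b (r + r) v) = 0"
        using cx.h_T[OF u(1), of ?v b r] v by (simp add: cx.T_T)
      then show ?thesis unfolding e by (simp add: mult_2)
    qed
    from cx.range_if_orthogonal_kernel[OF _ this]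
    show "\<exists>w\<in>carrier_vec (n + n). cx.T b (e - 1) v = cx.T b e w" using v by auto
  qed
qed

text \<open>The real points of a complex Lagrangian subspace that is closed under conjugation form a
  real Lagrangian subspace: real and imaginary parts of its elements are combinations of u and
  \<open>conjugate u\<close>, so they stay in it, and orthogonality to the real points implies
  orthogonality to everything.\<close>

theorem riccati_if_no_odd_block:
  assumes "\<And>b e. b \<noteq> 0 \<Longrightarrow> odd e \<Longrightarrow> no_jordan_block (n + n) (cx.N b) e"
  obtains S where "riccati S"
proof -
  obtain Y where Y: "lin_subspace (n + n) Y" "\<And>u v. u \<in> Y \<Longrightarrow> v \<in> Y \<Longrightarrow> hform u v = 0"
    "\<And>u. u \<in> Y \<Longrightarrow> cH *\<^sub>v u \<in> Y" "\<And>u. u \<in> Y \<Longrightarrow> conjugate u \<in> Y"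
    "\<And>v. v \<in> carrier_vec (n + n) \<Longrightarrow> (\<And>u. u \<in> Y \<Longrightarrow> hform u v = 0) \<Longrightarrow> v \<in> Y"
    using cx.invariant_lagrangian_exists[OF assms] by blast
  note sub = lin_subspaceD[OF Y(1)]
  let ?c = "map_vec complex_of_real"
  define L where "L = {v \<in> carrier_vec (n + n). ?c v \<in> Y}"
  have form: "hform (?c u) (?c v) = complex_of_real (symplectic_form n u v)"
    if "u \<in> carrier_vec (n + n)" "v \<in> carrier_vec (n + n)" for u v
    using that
  proof (elim carrier_vec_appendE)
    fix p x p' x' assume v: "u = p @\<^sub>v x" "v = p' @\<^sub>v x'"
      and c: "p \<in> carrier_vec n" "x \<in> carrier_vec n" "p' \<in> carrier_vec n" "x' \<in> carrier_vec n"
    have "conjugate (?c u) = ?c u" by (rule eq_vecI) auto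
    moreover have "?c (a @\<^sub>v b) = ?c a @\<^sub>v ?c b" for a b by (rule eq_vecI) auto
    moreover have "?c a \<bullet> ?c b = complex_of_real (a \<bullet> b)" if "a \<in> carrier_vec n" "b \<in> carrier_vec n" for a b
      using that by (simp add: scalar_prod_def)
    ultimately show ?thesis using c unfolding hform_def v by (simp add: symplectic_form_append)
  qed
  show thesis
  proof (rule riccati_if_lagrangian[of L])
    show "lin_subspace (n + n) L"
      unfolding lin_subspace_def
    proof (intro conjI ballI allI)
      show "0\<^sub>v (n + n) \<in> L" using sub(2) by (simp add: L_def of_real_hom.vec_hom_zero)
      show "u + v \<in> L" if "u \<in> L" "v \<in> L" for u v
      proof -
        have "?c (u + v) = ?c u + ?c v" using that by (intro eq_vecI) (auto simp: L_def)
        then show ?thesis using that sub(3) by (simp add: L_def)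
      qed
      show "a \<cdot>\<^sub>v u \<in> L" if "u \<in> L" for a u
      proof -
        have "?c (a \<cdot>\<^sub>v u) = complex_of_real a \<cdot>\<^sub>v ?c u" by (intro eq_vecI) auto
        then show ?thesis using that sub(4) by (simp add: L_def)
      qed
    qed (auto simp: L_def)
    show "symplectic_form n u v = 0" if "u \<in> L" "v \<in> L" for u v
      using form[of u v] Y(2)[of "?c u" "?c v"] that by (simp add: L_def)
    show "H *\<^sub>v u \<in> L" if "u \<in> L" for u
    proof -
      have u: "u \<in> carrier_vec (n + n)" "?c u \<in> Y" using that by (simp_all add: L_def)
      have "?c (H *\<^sub>v u) = cH *\<^sub>v ?c u" by (rule of_real_hom.mult_mat_vec_hom[OF H u(1)])
      then show ?thesis using Y(3)[OF u(2)] mult_mat_vec_carrier[OF H u(1)] by (simp add: L_def)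
    qed
    show "v \<in> L" if v: "v \<in> carrier_vec (n + n)" and orth: "\<And>u. u \<in> L \<Longrightarrow> symplectic_form n u v = 0" for v
    proof -
      have vc: "?c v \<in> carrier_vec (n + n)" using v by simp
      have "hform u (?c v) = 0" if u: "u \<in> Y" for u
      proof -
        have uc: "u \<in> carrier_vec (n + n)" using u sub(1) by blast
        have re: "?c (map_vec Re u) = (1/2) \<cdot>\<^sub>v (u + conjugate u)"
          using uc by (intro eq_vecI) (auto simp: complex_eq_iff)
        have im: "?c (map_vec Im u) = (- \<i> / 2) \<cdot>\<^sub>v (u - conjugate u)"
          using uc by (intro eq_vecI) (auto simp: complex_eq_iff)
        have "map_vec Re u \<in> L" "map_vec Im u \<in> L"
          using uc sub(3,4,5) u Y(4) unfolding L_def mem_Collect_eq re im by auto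
        then have "hform (?c (map_vec Re u)) (?c v) = 0" "hform (?c (map_vec Im u)) (?c v) = 0"
          using orth form v by (simp_all add: L_def)
        moreover have "u = ?c (map_vec Re u) + \<i> \<cdot>\<^sub>v ?c (map_vec Im u)"
          using uc by (intro eq_vecI) (auto simp: complex_eq_iff)
        then have "hform u (?c v) = hform (?c (map_vec Re u)) (?c v) + cnj \<i> * hform (?c (map_vec Im u)) (?c v)"
          using cx.h_add_left[of "?c (map_vec Re u)" "\<i> \<cdot>\<^sub>v ?c (map_vec Im u)" "?c v"]
            cx.h_smult_left[of "?c (map_vec Im u)" "?c v" \<i>] uc vc by simp
        ultimately show ?thesis by simp
      qed
      then have "?c v \<in> Y" using Y(5) vc by blast
      then show ?thesis using v by (simp add: L_def)
    qed
  qed (rule that)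
qed

end

subsection \<open>The matrix exponential as a matrix of power series\<close>

lemma mult_mat_index:
  assumes "M \<in> carrier_mat n m" "N \<in> carrier_mat m k" "i < n" "j < k"
  shows "(M * N) $$ (i, j) = (\<Sum>l = 0..<m. M $$ (i, l) * N $$ (l, j))"
  using assms by (auto simp: scalar_prod_def)

lemma sum_entire_fps:
  fixes f :: "'b \<Rightarrow> 'a::{banach,real_normed_field} fps"
  assumes "\<And>x. x \<in> S \<Longrightarrow> fps_conv_radius (f x) = \<infinity>"
  shows "fps_conv_radius (\<Sum>x\<in>S. f x) = \<infinity> \<and> eval_fps (\<Sum>x\<in>S. f x) z = (\<Sum>x\<in>S. eval_fps (f x) z)"
  using assms
proof (induction S rule: infinite_finite_induct)
  case (insert a S)
  then have IH: "fps_conv_radius (\<Sum>x\<in>S. f x) = \<infinity>" "eval_fps (\<Sum>x\<in>S. f x) z = (\<Sum>x\<in>S. eval_fps (f x) z)"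
    and fa: "fps_conv_radius (f a) = \<infinity>" by simp_all
  have "fps_conv_radius (f a + (\<Sum>x\<in>S. f x)) = \<infinity>"
    using fps_conv_radius_add[of "f a" "\<Sum>x\<in>S. f x"] IH(1) fa by simp
  moreover have "eval_fps (f a + (\<Sum>x\<in>S. f x)) z = eval_fps (f a) z + eval_fps (\<Sum>x\<in>S. f x) z"
    by (rule eval_fps_add) (use IH fa in auto)
  ultimately show ?case using insert.hyps IH(2) by simp
qed auto

lemma prod_entire_fps:
  fixes f :: "'b \<Rightarrow> 'a::{banach,real_normed_field} fps"
  assumes "\<And>x. x \<in> S \<Longrightarrow> fps_conv_radius (f x) = \<infinity>"
  shows "fps_conv_radius (\<Prod>x\<in>S. f x) = \<infinity> \<and> eval_fps (\<Prod>x\<in>S. f x) z = (\<Prod>x\<in>S. eval_fps (f x) z)"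
  using assms
proof (induction S rule: infinite_finite_induct)
  case (insert a S)
  then have IH: "fps_conv_radius (\<Prod>x\<in>S. f x) = \<infinity>" "eval_fps (\<Prod>x\<in>S. f x) z = (\<Prod>x\<in>S. eval_fps (f x) z)"
    and fa: "fps_conv_radius (f a) = \<infinity>" by simp_all
  have "fps_conv_radius (f a * (\<Prod>x\<in>S. f x)) = \<infinity>"
    using fps_conv_radius_mult[of "f a" "\<Prod>x\<in>S. f x"] IH(1) fa by simp
  moreover have "eval_fps (f a * (\<Prod>x\<in>S. f x)) z = eval_fps (f a) z * eval_fps (\<Prod>x\<in>S. f x) z"
    by (rule eval_fps_mult) (use IH fa in auto)
  ultimately show ?case using insert.hyps IH(2) by simp
qed auto

lemma mult_entire_fps:
  fixes f g :: "'a::{banach,real_normed_field} fps"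
  assumes "fps_conv_radius f = \<infinity>" "fps_conv_radius g = \<infinity>"
  shows "fps_conv_radius (f * g) = \<infinity>" "eval_fps (f * g) z = eval_fps f z * eval_fps g z"
  using fps_conv_radius_mult[of f g] eval_fps_mult[of z f g] assms by auto

abbreviation eval_mat :: "real fps mat \<Rightarrow> real \<Rightarrow> real mat" where
  "eval_mat M t \<equiv> map_mat (\<lambda>f. eval_fps f t) M"

text \<open>With infinite radius of convergence, evaluation at t is a ring homomorphism without side
  conditions, so it commutes with matrix products and determinants.\<close>

definition entire_mat :: "real fps mat \<Rightarrow> bool" where
  "entire_mat M \<longleftrightarrow> (\<forall>i<dim_row M. \<forall>j<dim_col M. fps_conv_radius (M $$ (i, j)) = \<infinity>)"

lemma entire_mat_mult:
  assumes "M \<in> carrier_mat n m" "N \<in> carrier_mat m k" "entire_mat M" "entire_mat N"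
  shows "entire_mat (M * N)" "eval_mat (M * N) t = eval_mat M t * eval_mat N t"
proof -
  have *: "fps_conv_radius ((M * N) $$ (i, j)) = \<infinity> \<and>
      eval_fps ((M * N) $$ (i, j)) t = (\<Sum>l = 0..<m. eval_fps (M $$ (i, l)) t * eval_fps (N $$ (l, j)) t)"
    if ij: "i < n" "j < k" for i j
  proof -
    have "(M * N) $$ (i, j) = (\<Sum>l = 0..<m. M $$ (i, l) * N $$ (l, j))"
      using assms(1,2) ij by (auto simp: scalar_prod_def)
    moreover have "fps_conv_radius (M $$ (i, l) * N $$ (l, j)) = \<infinity>"
      "eval_fps (M $$ (i, l) * N $$ (l, j)) t = eval_fps (M $$ (i, l)) t * eval_fps (N $$ (l, j)) t" if "l < m" for l
      using mult_entire_fps[of "M $$ (i, l)" "N $$ (l, j)"] assms ij that by (auto simp: entire_mat_def)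
    ultimately show ?thesis
      using sum_entire_fps[of "{0..<m}" "\<lambda>l. M $$ (i, l) * N $$ (l, j)" t] by simp
  qed
  show "entire_mat (M * N)" using * assms(1,2) by (auto simp: entire_mat_def)
  show "eval_mat (M * N) t = eval_mat M t * eval_mat N t"
    using * assms(1,2) by (intro eq_matI) (auto simp: scalar_prod_def)
qed

lemma entire_det:
  assumes M: "M \<in> carrier_mat n n" "entire_mat M"
  shows "fps_conv_radius (det M) = \<infinity>" "eval_fps (det M) t = det (eval_mat M t)"
proof -
  let ?P = "{p. p permutes {0..<n}}"
  have p: "fps_conv_radius (signof p * (\<Prod>i = 0..<n. M $$ (i, p i))) = \<infinity> \<and>
      eval_fps (signof p * (\<Prod>i = 0..<n. M $$ (i, p i))) t = signof p * (\<Prod>i = 0..<n. eval_fps (M $$ (i, p i)) t)"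
    if "p \<in> ?P" for p
  proof -
    have "fps_conv_radius (M $$ (i, p i)) = \<infinity>" if "i \<in> {0..<n}" for i
    proof -
      have "p i < n" using permutes_in_image[of p "{0..<n}" i] that \<open>p \<in> ?P\<close> by simp
      then show ?thesis using M that by (auto simp: entire_mat_def)
    qed
    note pr = prod_entire_fps[of "{0..<n}" "\<lambda>i. M $$ (i, p i)" t, OF this]
    have "fps_conv_radius (signof p :: real fps) = \<infinity>" "eval_fps (signof p :: real fps) t = signof p"
      by (simp_all add: sign_def eval_fps_minus)
    then show ?thesis
      using mult_entire_fps[of "signof p :: real fps" "\<Prod>i = 0..<n. M $$ (i, p i)"] pr by auto
  qed
  note s = sum_entire_fps[of ?P "\<lambda>p. signof p * (\<Prod>i = 0..<n. M $$ (i, p i))" t]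
  have M': "eval_mat M t \<in> carrier_mat n n" using M by simp
  show "fps_conv_radius (det M) = \<infinity>" unfolding det_def'[OF M(1)] using s p by blast
  have "eval_fps (det M) t = (\<Sum>p\<in>?P. signof p * (\<Prod>i = 0..<n. eval_fps (M $$ (i, p i)) t))"
    unfolding det_def'[OF M(1)] using s p by simp
  also have "\<dots> = det (eval_mat M t)"
    unfolding det_def'[OF M']
  proof (intro sum.cong refl arg_cong[of _ _ "\<lambda>x. _ * x"] prod.cong)
    fix p i assume "p \<in> ?P" "i \<in> {0..<n}"
    then have "p i < n" "i < n" using permutes_in_image[of p "{0..<n}" i] by auto
    then show "eval_fps (M $$ (i, p i)) t = eval_mat M t $$ (i, p i)" using M by simp
  qed
  finally show "eval_fps (det M) t = det (eval_mat M t)" .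
qed

text \<open>The series is complexified and zeros of a nonconstant holomorphic function on a compact
  set are finite in number. A constant function has no zeros here, since by uniqueness of
  coefficients the constant 0 would force f = 0.\<close>

lemma finite_zeros_entire_fps:
  fixes f :: "real fps"
  assumes "fps_conv_radius f = \<infinity>" "f \<noteq> 0"
  shows "finite {t \<in> {a..b}. eval_fps f t = 0}"
proof -
  define g :: "complex fps" where "g = Abs_fps (\<lambda>l. complex_of_real (fps_nth f l))"
  have rad: "fps_conv_radius g = \<infinity>"
    using assms(1) unfolding fps_conv_radius_def g_def conv_radius_def by simp
  have eval: "eval_fps g (complex_of_real t) = complex_of_real (eval_fps f t)" for t
  proof -
    have "summable (\<lambda>l. fps_nth f l * t ^ l)" by (rule summable_fps) (simp add: assms(1))
    from suminf_of_real[OF this, where 'a = complex] show ?thesis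
      by (simp add: eval_fps_def g_def)
  qed
  show ?thesis
  proof (cases "eval_fps g constant_on UNIV")
    case True
    then obtain c where c: "\<And>z. eval_fps g z = c" by (auto simp: constant_on_def)
    have "eval_fps f t \<noteq> 0" for t
    proof
      assume "eval_fps f t = 0"
      then have "c = 0" using eval[of t] c by simp
      then have "g = 0" using rad c by (intro eval_fps_eqD) auto
      then have "fps_nth g l = 0" for l by simp
      then have "f = 0" unfolding g_def by (simp add: fps_eq_iff)
      then show False using assms(2) by simp
    qed
    then show ?thesis by simp
  next
    case False
    have "finite {z \<in> complex_of_real ` {a..b}. eval_fps g z = 0}"
    proof (rule holomorphic_compact_finite_zeros[of _ UNIV])
      show "eval_fps g holomorphic_on UNIV" by (rule holomorphic_on_eval_fps) (simp add: rad)
      show "compact (complex_of_real ` {a..b})"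
        by (intro compact_continuous_image continuous_intros) auto
    qed (use False in auto)
    moreover have "complex_of_real ` {t \<in> {a..b}. eval_fps f t = 0} = {z \<in> complex_of_real ` {a..b}. eval_fps g z = 0}"
      using eval by auto
    ultimately show ?thesis
      using finite_imageD[of complex_of_real "{t \<in> {a..b}. eval_fps f t = 0}"] by (simp add: inj_on_def)
  qed
qed

text \<open>exp(t H) as a matrix over the ring of power series in t. Its differential equation and
  its symplecticity are formal identities, evaluated only afterwards.\<close>

definition exp_fps :: "real mat \<Rightarrow> real fps mat" where
  "exp_fps H = mat (dim_row H) (dim_row H) (\<lambda>(i, j). Abs_fps (\<lambda>l. (H ^\<^sub>m l) $$ (i, j) / fact l))"

definition flow :: "real mat \<Rightarrow> real \<Rightarrow> real mat" where
  "flow H t = eval_mat (exp_fps H) t"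

locale matrix_flow =
  fixes N :: nat and H :: "real mat"
  assumes H [simp]: "H \<in> carrier_mat N N"
begin

lemma exp_fps_carrier [simp]: "exp_fps H \<in> carrier_mat N N"
  by (simp add: exp_fps_def carrier_matD[OF H])

lemma flow_carrier [simp]: "flow H t \<in> carrier_mat N N"
  by (simp add: flow_def)

lemma H_pow [simp]: "H ^\<^sub>m l \<in> carrier_mat N N" by (rule pow_carrier_mat[OF H])

lemma exp_fps_nth: "i < N \<Longrightarrow> j < N \<Longrightarrow> fps_nth (exp_fps H $$ (i, j)) l = (H ^\<^sub>m l) $$ (i, j) / fact l"
  using carrier_matD[OF H] by (simp add: exp_fps_def)

lemma H_pow_comm: "H * H ^\<^sub>m l = H ^\<^sub>m l * H"
proof (induction l)
  case (Suc l)
  have "H * H ^\<^sub>m Suc l = (H * H ^\<^sub>m l) * H" using assoc_mult_mat[OF H H_pow[of l] H] by simp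
  then show ?case unfolding Suc by simp
qed (simp add: left_mult_one_mat[OF H] right_mult_one_mat[OF H] carrier_matD[OF H])

lemma H_pow_Suc_index:
  assumes "i < N" "j < N"
  shows "(H ^\<^sub>m Suc l) $$ (i, j) = (\<Sum>k = 0..<N. H $$ (i, k) * (H ^\<^sub>m l) $$ (k, j))"
    "(H ^\<^sub>m Suc l) $$ (i, j) = (\<Sum>k = 0..<N. (H ^\<^sub>m l) $$ (i, k) * H $$ (k, j))"
proof -
  have "H ^\<^sub>m Suc l = H * H ^\<^sub>m l" unfolding H_pow_comm by simp
  then show "(H ^\<^sub>m Suc l) $$ (i, j) = (\<Sum>k = 0..<N. H $$ (i, k) * (H ^\<^sub>m l) $$ (k, j))"
    using assms carrier_matD[OF H] carrier_matD[OF H_pow[of l]] by (simp add: scalar_prod_def)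
  show "(H ^\<^sub>m Suc l) $$ (i, j) = (\<Sum>k = 0..<N. (H ^\<^sub>m l) $$ (i, k) * H $$ (k, j))"
    using assms carrier_matD[OF H] carrier_matD[OF H_pow[of l]] by (simp add: scalar_prod_def)
qed

lemma H_pow_bound:
  obtains K where "K \<ge> 0" "\<And>l i j. i < N \<Longrightarrow> j < N \<Longrightarrow> \<bar>(H ^\<^sub>m l) $$ (i, j)\<bar> \<le> K ^ l"
proof -
  \<comment> \<open>The sum of all absolute values bounds every row sum, which is what the induction
    on the power uses.\<close>
  define K where "K = (\<Sum>i = 0..<N. \<Sum>k = 0..<N. \<bar>H $$ (i, k)\<bar>)"
  have K0: "K \<ge> 0" unfolding K_def by (intro sum_nonneg) auto
  have row: "(\<Sum>k = 0..<N. \<bar>H $$ (i, k)\<bar>) \<le> K" if "i < N" for i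
    unfolding K_def using that
    by (intro member_le_sum[of i "{0..<N}" "\<lambda>i. \<Sum>k = 0..<N. \<bar>H $$ (i, k)\<bar>"]) (auto intro: sum_nonneg)
  have bound: "\<bar>(H ^\<^sub>m l) $$ (i, j)\<bar> \<le> K ^ l" if "i < N" "j < N" for l i j
    using that
  proof (induction l arbitrary: i j)
    case 0
    then show ?case using carrier_matD[OF H] by simp
  next
    case (Suc l)
    have "\<bar>(H ^\<^sub>m Suc l) $$ (i, j)\<bar> \<le> (\<Sum>k = 0..<N. \<bar>H $$ (i, k)\<bar> * \<bar>(H ^\<^sub>m l) $$ (k, j)\<bar>)"
      unfolding H_pow_Suc_index(1)[OF Suc.prems] abs_mult[symmetric] by (rule sum_abs)
    also have "\<dots> \<le> (\<Sum>k = 0..<N. \<bar>H $$ (i, k)\<bar> * K ^ l)"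
      using Suc by (intro sum_mono mult_left_mono) auto
    also have "\<dots> = (\<Sum>k = 0..<N. \<bar>H $$ (i, k)\<bar>) * K ^ l" by (simp add: sum_distrib_right)
    also have "\<dots> \<le> K * K ^ l" using row[OF Suc.prems(1)] K0 by (intro mult_right_mono) auto
    finally show ?case by simp
  qed
  show thesis by (rule that[OF K0 bound])
qed

lemma entire_exp_fps: "entire_mat (exp_fps H)"
proof -
  obtain K where K: "K \<ge> 0" "\<And>l i j. i < N \<Longrightarrow> j < N \<Longrightarrow> \<bar>(H ^\<^sub>m l) $$ (i, j)\<bar> \<le> K ^ l"
    using H_pow_bound by metis
  have "fps_conv_radius (exp_fps H $$ (i, j)) = \<infinity>" if ij: "i < N" "j < N" for i j
    unfolding fps_conv_radius_def
  proof (rule conv_radius_inftyI'')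
    fix z :: real
    have "summable (\<lambda>l. (K * \<bar>z\<bar>) ^ l / fact l)"
      using summable_exp[of "K * \<bar>z\<bar>"] by (simp add: field_simps)
    then show "summable (\<lambda>l. fps_nth (exp_fps H $$ (i, j)) l * z ^ l)"
    proof (rule summable_comparison_test'[where N = 0])
      fix l
      have "norm (fps_nth (exp_fps H $$ (i, j)) l * z ^ l) = \<bar>(H ^\<^sub>m l) $$ (i, j)\<bar> * \<bar>z\<bar> ^ l / fact l"
        by (simp add: exp_fps_nth[OF ij] abs_mult power_abs)
      also have "\<dots> \<le> K ^ l * \<bar>z\<bar> ^ l / fact l"
        using K(2)[OF ij] by (intro divide_right_mono mult_right_mono) auto
      finally show "norm (fps_nth (exp_fps H $$ (i, j)) l * z ^ l) \<le> (K * \<bar>z\<bar>) ^ l / fact l"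
        by (simp add: power_mult_distrib)
    qed
  qed
  then show ?thesis using carrier_matD[OF exp_fps_carrier] by (simp add: entire_mat_def)
qed

abbreviation Hf :: "real fps mat" where "Hf \<equiv> map_mat fps_const H"

lemma exp_fps_deriv:
  "map_mat fps_deriv (exp_fps H) = Hf * exp_fps H" "map_mat fps_deriv (exp_fps H) = exp_fps H * Hf"
proof -
  have d: "fps_nth (fps_deriv (exp_fps H $$ (i, j))) l = (H ^\<^sub>m Suc l) $$ (i, j) / fact l"
    if "i < N" "j < N" for i j l
    using that by (simp add: exp_fps_nth fact_Suc del: pow_mat.simps of_nat_Suc)
  show "map_mat fps_deriv (exp_fps H) = Hf * exp_fps H"
  proof (rule eq_matI)
    fix i j assume "i < dim_row (Hf * exp_fps H)" "j < dim_col (Hf * exp_fps H)"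
    then have ij: "i < N" "j < N" using carrier_matD[OF H] carrier_matD[OF exp_fps_carrier] by simp_all
    have "(Hf * exp_fps H) $$ (i, j) = (\<Sum>k = 0..<N. fps_const (H $$ (i, k)) * exp_fps H $$ (k, j))"
      using ij carrier_matD[OF H] carrier_matD[OF exp_fps_carrier] by (simp add: scalar_prod_def)
    then have "fps_nth ((Hf * exp_fps H) $$ (i, j)) l = (H ^\<^sub>m Suc l) $$ (i, j) / fact l" for l
      unfolding H_pow_Suc_index(1)[OF ij]
      using ij by (simp add: fps_sum_nth exp_fps_nth sum_divide_distrib)
    then have "fps_deriv (exp_fps H $$ (i, j)) = (Hf * exp_fps H) $$ (i, j)"
      using d[OF ij] by (simp add: fps_eq_iff)
    then show "map_mat fps_deriv (exp_fps H) $$ (i, j) = (Hf * exp_fps H) $$ (i, j)"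
      using ij carrier_matD[OF exp_fps_carrier] by simp
  qed (use carrier_matD[OF H] carrier_matD[OF exp_fps_carrier] in simp_all)
  show "map_mat fps_deriv (exp_fps H) = exp_fps H * Hf"
  proof (rule eq_matI)
    fix i j assume "i < dim_row (exp_fps H * Hf)" "j < dim_col (exp_fps H * Hf)"
    then have ij: "i < N" "j < N" using carrier_matD[OF H] carrier_matD[OF exp_fps_carrier] by simp_all
    have "(exp_fps H * Hf) $$ (i, j) = (\<Sum>k = 0..<N. exp_fps H $$ (i, k) * fps_const (H $$ (k, j)))"
      using ij carrier_matD[OF H] carrier_matD[OF exp_fps_carrier] by (simp add: scalar_prod_def)
    then have "fps_nth ((exp_fps H * Hf) $$ (i, j)) l = (H ^\<^sub>m Suc l) $$ (i, j) / fact l" for l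
      unfolding H_pow_Suc_index(2)[OF ij]
      using ij by (simp add: fps_sum_nth exp_fps_nth sum_divide_distrib)
    then have "fps_deriv (exp_fps H $$ (i, j)) = (exp_fps H * Hf) $$ (i, j)"
      using d[OF ij] by (simp add: fps_eq_iff)
    then show "map_mat fps_deriv (exp_fps H) $$ (i, j) = (exp_fps H * Hf) $$ (i, j)"
      using ij carrier_matD[OF exp_fps_carrier] by simp
  qed (use carrier_matD[OF H] carrier_matD[OF exp_fps_carrier] in simp_all)
qed

lemma mat_exp_flow: "mat_exp (t \<cdot>\<^sub>m H) = flow H t"
proof (rule eq_matI)
  have pow: "(t \<cdot>\<^sub>m H) ^\<^sub>m l = t ^ l \<cdot>\<^sub>m (H ^\<^sub>m l)" for l
  proof (induction l)
    case 0
    then show ?case using H by (intro eq_matI) auto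
  next
    case (Suc l)
    have "(t ^ l \<cdot>\<^sub>m (H ^\<^sub>m l)) * (t \<cdot>\<^sub>m H) = t ^ Suc l \<cdot>\<^sub>m (H ^\<^sub>m l * H)"
      using carrier_matD[OF H] carrier_matD[OF H_pow[of l]]
      by (intro eq_matI) (auto simp: scalar_prod_def sum_distrib_left mult_ac)
    then show ?case using Suc by simp
  qed
  fix i j assume "i < dim_row (flow H t)" "j < dim_col (flow H t)"
  then have ij: "i < N" "j < N" using carrier_matD[OF flow_carrier] by simp_all
  then show "mat_exp (t \<cdot>\<^sub>m H) $$ (i, j) = flow H t $$ (i, j)"
    using carrier_matD[OF H] carrier_matD[OF exp_fps_carrier] carrier_matD[OF H_pow]
    by (simp add: mat_exp_def flow_def eval_fps_def exp_fps_nth pow mult.commute)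
qed (use carrier_matD[OF H] carrier_matD[OF flow_carrier] in \<open>simp_all add: mat_exp_def\<close>)

lemma flow_0: "flow H 0 = 1\<^sub>m N"
  using carrier_matD[OF exp_fps_carrier] carrier_matD[OF H]
  by (intro eq_matI) (auto simp: flow_def eval_fps_at_0 exp_fps_nth)

lemma flow_has_derivative:
  assumes "i < N" "j < N"
  shows "((\<lambda>t. flow H t $$ (i, j)) has_real_derivative (H * flow H t) $$ (i, j)) (at t)"
    and "(H * flow H t) $$ (i, j) = (flow H t * H) $$ (i, j)"
proof -
  have Hf: "Hf \<in> carrier_mat N N" "entire_mat Hf" using H by (auto simp: entire_mat_def)
  have evHf: "eval_mat Hf t = H" by (intro eq_matI) auto
  have ev: "eval_fps (fps_deriv (exp_fps H $$ (i, j))) t = eval_mat (map_mat fps_deriv (exp_fps H)) t $$ (i, j)"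
    using assms carrier_matD[OF exp_fps_carrier] by simp
  have 1: "eval_mat (map_mat fps_deriv (exp_fps H)) t = H * flow H t"
    unfolding exp_fps_deriv(1) using entire_mat_mult(2)[OF Hf(1) exp_fps_carrier Hf(2) entire_exp_fps] evHf
    by (simp add: flow_def)
  have 2: "eval_mat (map_mat fps_deriv (exp_fps H)) t = flow H t * H"
    unfolding exp_fps_deriv(2) using entire_mat_mult(2)[OF exp_fps_carrier Hf(1) entire_exp_fps Hf(2)] evHf
    by (simp add: flow_def)
  have "(eval_fps (exp_fps H $$ (i, j)) has_field_derivative eval_fps (fps_deriv (exp_fps H $$ (i, j))) t) (at t)"
    by (rule has_field_derivative_eval_fps)
      (use entire_exp_fps assms carrier_matD[OF exp_fps_carrier] in \<open>simp add: entire_mat_def\<close>)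
  then show "((\<lambda>t. flow H t $$ (i, j)) has_real_derivative (H * flow H t) $$ (i, j)) (at t)"
    unfolding ev 1 using assms carrier_matD[OF exp_fps_carrier] by (simp add: flow_def)
  show "(H * flow H t) $$ (i, j) = (flow H t * H) $$ (i, j)" using 1 2 by simp
qed

lemma flow_comm: "H * flow H t = flow H t * H"
  by (rule eq_matI) (use flow_has_derivative(2) carrier_matD[OF H] carrier_matD[OF flow_carrier] in auto)

text \<open>For fixed a the product of the flows at r and at a - r has derivative 0 in r, because
  \<open>H\<close> commutes with the flow; compare r = s with r = 0.\<close>

lemma flow_add: "flow H (s + t) = flow H s * flow H t"
proof -
  define a where "a = s + t"
  have "flow H s * flow H (a - s) = flow H 0 * flow H (a - 0)"
  proof (rule eq_matI)
    fix i j assume "i < dim_row (flow H 0 * flow H (a - 0))" "j < dim_col (flow H 0 * flow H (a - 0))"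
    then have ij: "i < N" "j < N" using carrier_matD[OF flow_carrier] by simp_all
    let ?g = "\<lambda>r. (flow H r * flow H (a - r)) $$ (i, j)"
    have g: "?g r = (\<Sum>k = 0..<N. flow H r $$ (i, k) * flow H (a - r) $$ (k, j))" for r
      using ij carrier_matD[OF flow_carrier] by (simp add: scalar_prod_def)
    have "(?g has_real_derivative 0) (at r)" for r
    proof -
      have d2: "((\<lambda>r. flow H (a - r) $$ (k, j)) has_real_derivative - (H * flow H (a - r)) $$ (k, j)) (at r)" if "k < N" for k
      proof -
        have "((\<lambda>r. a - r) has_real_derivative - 1) (at r)" by (auto intro!: derivative_eq_intros)
        from DERIV_chain2[OF flow_has_derivative(1)[OF that ij(2)] this] show ?thesis by simp
      qed
      have "(?g has_real_derivative (\<Sum>k = 0..<N. (H * flow H r) $$ (i, k) * flow H (a - r) $$ (k, j)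
          + - (H * flow H (a - r)) $$ (k, j) * flow H r $$ (i, k))) (at r)"
        unfolding g by (intro DERIV_sum DERIV_mult flow_has_derivative(1) d2) (use ij in auto)
      moreover have "(\<Sum>k = 0..<N. (H * flow H r) $$ (i, k) * flow H (a - r) $$ (k, j)
          + - (H * flow H (a - r)) $$ (k, j) * flow H r $$ (i, k)) =
          ((H * flow H r) * flow H (a - r)) $$ (i, j) - (flow H r * (H * flow H (a - r))) $$ (i, j)"
        unfolding mult_mat_index[OF mult_carrier_mat[OF H flow_carrier] flow_carrier ij]
          mult_mat_index[OF flow_carrier mult_carrier_mat[OF H flow_carrier] ij]
        by (simp add: sum_subtractf mult.commute)
      moreover have "(H * flow H r) * flow H (a - r) = flow H r * (H * flow H (a - r))"
        by (subst flow_comm[of r]) (rule assoc_mult_mat[of _ N N _ N _ N]; simp)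
      ultimately show ?thesis by simp
    qed
    then have "?g s = ?g 0" by (intro DERIV_isconst_all) auto
    then show "(flow H s * flow H (a - s)) $$ (i, j) = (flow H 0 * flow H (a - 0)) $$ (i, j)" .
  qed (use carrier_matD[OF flow_carrier] in simp_all)
  then show ?thesis by (simp add: a_def flow_0 left_mult_one_mat[of _ N N])
qed

end

subsection \<open>The Hamiltonian flow\<close>

text \<open>The Gram matrix of \<open>symplectic_form\<close>. It turns invariance of the form into
  a single matrix identity, which can be differentiated formally.\<close>

definition symplectic_mat :: "nat \<Rightarrow> 'a::comm_ring_1 mat" where
  "symplectic_mat n = four_block_mat (0\<^sub>m n n) (1\<^sub>m n) (- 1\<^sub>m n) (0\<^sub>m n n)"

lemma symplectic_mat_carrier [simp]: "symplectic_mat n \<in> carrier_mat (n + n) (n + n)"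
  unfolding symplectic_mat_def by (rule four_block_carrier_mat) auto

lemma symplectic_form_eq_mat:
  assumes "u \<in> carrier_vec (n + n)" "v \<in> carrier_vec (n + n)"
  shows "symplectic_form n u v = u \<bullet> (symplectic_mat n *\<^sub>v v)"
  using assms
proof (elim carrier_vec_appendE)
  fix p x p' x' :: "'a vec" assume v: "u = p @\<^sub>v x" "v = p' @\<^sub>v x'"
    and c: "p \<in> carrier_vec n" "x \<in> carrier_vec n" "p' \<in> carrier_vec n" "x' \<in> carrier_vec n"
  have z: "0\<^sub>m n n *\<^sub>v a = 0\<^sub>v n" if "a \<in> carrier_vec n" for a :: "'a vec"
    using that by (intro eq_vecI) auto
  have "symplectic_mat n *\<^sub>v v = x' @\<^sub>v (- p')"
    unfolding symplectic_mat_def v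
    using c uminus_mult_mat_vec[of "1\<^sub>m n" n n p']
    by (subst four_block_mat_mult_vec[of _ n n _ n _ n]) (auto simp: z)
  moreover have "x \<bullet> (- p') = - (x \<bullet> p')" using c by (simp add: scalar_prod_def sum_negf)
  ultimately show ?thesis
    using c by (simp add: v symplectic_form_append scalar_prod_append[of _ n _ n])
qed

lemma scalar_prod_eq_imp_eq:
  fixes v w :: "'a::comm_ring_1 vec"
  assumes "v \<in> carrier_vec n" "w \<in> carrier_vec n"
    and "\<And>u. u \<in> carrier_vec n \<Longrightarrow> u \<bullet> v = u \<bullet> w"
  shows "v = w"
proof (rule eq_vecI)
  fix i assume "i < dim_vec w"
  then have "i < n" using assms by simp
  then show "v $ i = w $ i" using assms(3)[of "unit_vec n i"] assms(1,2) by simp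
qed (use assms in simp)

lemma ham_symplectic_mat:
  assumes "A \<in> carrier_mat n n" "D \<in> carrier_mat n n" "transpose_mat D = D"
    "Q \<in> carrier_mat n n" "transpose_mat Q = Q"
  shows "transpose_mat (ham A D Q) * symplectic_mat n + symplectic_mat n * ham A D Q = 0\<^sub>m (n + n) (n + n)"
proof (rule eq_mat_if_eq_mult_vec[of _ "n + n" "n + n"])
  let ?H = "ham A D Q" and ?J = "symplectic_mat n :: 'a mat"
  have H: "?H \<in> carrier_mat (n + n) (n + n)" using assms by simp
  have HT: "transpose_mat ?H \<in> carrier_mat (n + n) (n + n)" using H by simp
  note J = symplectic_mat_carrier[where n = n and ?'a = 'a]
  have HTJ: "transpose_mat ?H * ?J \<in> carrier_mat (n + n) (n + n)" "?J * ?H \<in> carrier_mat (n + n) (n + n)"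
    using mult_carrier_mat[OF HT J] mult_carrier_mat[OF J H] .
  fix v :: "'a vec" assume v: "v \<in> carrier_vec (n + n)"
  have c: "?J *\<^sub>v v \<in> carrier_vec (n + n)" "?H *\<^sub>v v \<in> carrier_vec (n + n)"
    "transpose_mat ?H *\<^sub>v (?J *\<^sub>v v) \<in> carrier_vec (n + n)" "?J *\<^sub>v (?H *\<^sub>v v) \<in> carrier_vec (n + n)"
    by (rule mult_mat_vec_carrier[OF J v] mult_mat_vec_carrier[OF H v]
        mult_mat_vec_carrier[OF HT mult_mat_vec_carrier[OF J v]] mult_mat_vec_carrier[OF J mult_mat_vec_carrier[OF H v]])+
  have "(transpose_mat ?H * ?J + ?J * ?H) *\<^sub>v v = transpose_mat ?H *\<^sub>v (?J *\<^sub>v v) + ?J *\<^sub>v (?H *\<^sub>v v)"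
    using add_mult_distrib_mat_vec[OF HTJ v] assoc_mult_mat_vec[OF HT J v] assoc_mult_mat_vec[OF J H v] by simp
  also have "\<dots> = 0\<^sub>v (n + n)"
  proof (rule scalar_prod_eq_imp_eq[of _ "n + n"])
    fix u :: "'a vec" assume u: "u \<in> carrier_vec (n + n)"
    have Hu: "?H *\<^sub>v u \<in> carrier_vec (n + n)" using H u by simp
    have "u \<bullet> (transpose_mat ?H *\<^sub>v (?J *\<^sub>v v)) = (?H *\<^sub>v u) \<bullet> (?J *\<^sub>v v)"
      using transpose_vec_mult_scalar[OF H u c(1)] comm_scalar_prod[OF u c(3)] comm_scalar_prod[OF Hu c(1)] by simp
    moreover have "(?H *\<^sub>v u) \<bullet> (?J *\<^sub>v v) = - (u \<bullet> (?J *\<^sub>v (?H *\<^sub>v v)))"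
      using symplectic_form_ham[OF assms u v] symplectic_form_eq_mat[OF Hu v] symplectic_form_eq_mat[OF u c(2)] by simp
    ultimately show "u \<bullet> (transpose_mat ?H *\<^sub>v (?J *\<^sub>v v) + ?J *\<^sub>v (?H *\<^sub>v v)) = u \<bullet> 0\<^sub>v (n + n)"
      using u c by (simp add: scalar_prod_add_distrib[of _ "n + n"])
  qed (use c in auto)
  also have "\<dots> = 0\<^sub>m (n + n) (n + n) *\<^sub>v v" using v by (intro eq_vecI) auto
  finally show "(transpose_mat ?H * ?J + ?J * ?H) *\<^sub>v v = 0\<^sub>m (n + n) (n + n) *\<^sub>v v" .
next
  show "transpose_mat (ham A D Q) * symplectic_mat n + symplectic_mat n * ham A D Q \<in> carrier_mat (n + n) (n + n)"
    by (rule add_carrier_mat, rule mult_carrier_mat[OF symplectic_mat_carrier]) (use assms in simp)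
qed simp

lemma fps_deriv_mat_mult:
  fixes M N :: "'a::comm_ring_1 fps mat"
  assumes M: "M \<in> carrier_mat n m" and N: "N \<in> carrier_mat m k"
  shows "map_mat fps_deriv (M * N) = map_mat fps_deriv M * N + M * map_mat fps_deriv N"
proof (rule eq_matI)
  fix i j assume "i < dim_row (map_mat fps_deriv M * N + M * map_mat fps_deriv N)"
    "j < dim_col (map_mat fps_deriv M * N + M * map_mat fps_deriv N)"
  then have ij: "i < n" "j < k" using assms by auto
  have dM: "map_mat fps_deriv M \<in> carrier_mat n m" "map_mat fps_deriv N \<in> carrier_mat m k" using assms by auto
  have "map_mat fps_deriv (M * N) $$ (i, j) = fps_deriv (\<Sum>l = 0..<m. M $$ (i, l) * N $$ (l, j))"
    unfolding mult_mat_index[OF M N ij, symmetric] using ij M N by simp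
  also have "\<dots> = (\<Sum>l = 0..<m. fps_deriv (M $$ (i, l)) * N $$ (l, j)) + (\<Sum>l = 0..<m. M $$ (i, l) * fps_deriv (N $$ (l, j)))"
    by (simp add: fps_deriv_sum sum.distrib add.commute)
  also have "\<dots> = (map_mat fps_deriv M * N) $$ (i, j) + (M * map_mat fps_deriv N) $$ (i, j)"
    unfolding mult_mat_index[OF dM(1) N ij] mult_mat_index[OF M dM(2) ij] using ij M N by simp
  finally show "map_mat fps_deriv (M * N) $$ (i, j) = (map_mat fps_deriv M * N + M * map_mat fps_deriv N) $$ (i, j)"
    using ij M N by simp
qed (use assms in auto)

lemma fps_deriv_mat_mult_vec:
  fixes M :: "'a::comm_ring_1 fps mat"
  assumes M: "M \<in> carrier_mat n m" and v: "v \<in> carrier_vec m"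
  shows "map_vec fps_deriv (M *\<^sub>v v) = map_mat fps_deriv M *\<^sub>v v + M *\<^sub>v map_vec fps_deriv v"
proof (rule eq_vecI)
  fix i assume "i < dim_vec (map_mat fps_deriv M *\<^sub>v v + M *\<^sub>v map_vec fps_deriv v)"
  then have i: "i < n" using assms by simp
  have idx: "(L *\<^sub>v w) $ i = (\<Sum>l = 0..<m. L $$ (i, l) * w $ l)"
    if "L \<in> carrier_mat n m" "w \<in> carrier_vec m" for L :: "'a fps mat" and w
    using that i by (auto simp: scalar_prod_def)
  have c: "map_mat fps_deriv M \<in> carrier_mat n m" "map_vec fps_deriv v \<in> carrier_vec m" using assms by auto
  have "map_vec fps_deriv (M *\<^sub>v v) $ i = fps_deriv (\<Sum>l = 0..<m. M $$ (i, l) * v $ l)"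
    unfolding idx[OF assms, symmetric] using i M by simp
  also have "\<dots> = (\<Sum>l = 0..<m. fps_deriv (M $$ (i, l)) * v $ l) + (\<Sum>l = 0..<m. M $$ (i, l) * fps_deriv (v $ l))"
    by (simp add: fps_deriv_sum sum.distrib add.commute)
  also have "\<dots> = (map_mat fps_deriv M *\<^sub>v v) $ i + (M *\<^sub>v map_vec fps_deriv v) $ i"
    unfolding idx[OF c(1) v] idx[OF M c(2)] using i M v by simp
  finally show "map_vec fps_deriv (M *\<^sub>v v) $ i = (map_mat fps_deriv M *\<^sub>v v + M *\<^sub>v map_vec fps_deriv v) $ i"
    using i M by simp
qed (use assms in simp)

lemma fps_nth_0_mat_mult:
  fixes M N :: "'a::comm_ring_1 fps mat"
  assumes M: "M \<in> carrier_mat n m" and N: "N \<in> carrier_mat m k"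
  shows "map_mat (\<lambda>f. fps_nth f 0) (M * N) = map_mat (\<lambda>f. fps_nth f 0) M * map_mat (\<lambda>f. fps_nth f 0) N"
  using assms by (intro eq_matI) (auto simp: scalar_prod_def fps_sum_nth)

text \<open>Real power series are formally real: if all coefficients below l vanish, coefficient 2 l
  of a square is the square of coefficient l, and real squares cannot cancel.\<close>

lemma fps_sum_squares_eq_0:
  fixes f :: "'b \<Rightarrow> real fps"
  assumes "finite S" "(\<Sum>x\<in>S. f x * f x) = 0" "x \<in> S"
  shows "f x = 0"
proof -
  have "\<forall>x\<in>S. fps_nth (f x) l = 0" for l
  proof (induction l rule: less_induct)
    case (less l)
    have "fps_nth (f x * f x) (l + l) = (fps_nth (f x) l)\<^sup>2" if x: "x \<in> S" for x
    proof -
      have "fps_nth (f x * f x) (l + l) = (\<Sum>i = 0..l + l. fps_nth (f x) i * fps_nth (f x) (l + l - i))"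
        by (simp add: fps_mult_nth)
      also have "\<dots> = (\<Sum>i\<in>{l}. fps_nth (f x) i * fps_nth (f x) (l + l - i))"
      proof (rule sum.mono_neutral_right)
        show "\<forall>i\<in>{0..l + l} - {l}. fps_nth (f x) i * fps_nth (f x) (l + l - i) = 0"
        proof
          fix i assume "i \<in> {0..l + l} - {l}"
          then consider "i < l" | "l + l - i < l" by fastforce
          then show "fps_nth (f x) i * fps_nth (f x) (l + l - i) = 0"
            using less.IH x by cases auto
        qed
      qed auto
      finally show ?thesis by (simp add: power2_eq_square)
    qed
    then have "(\<Sum>x\<in>S. (fps_nth (f x) l)\<^sup>2) = fps_nth (\<Sum>x\<in>S. f x * f x) (l + l)"
      by (simp add: fps_sum_nth)
    then have "(\<Sum>x\<in>S. (fps_nth (f x) l)\<^sup>2) = 0" using assms(2) by simp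
    then show ?case using assms(1) by (simp add: sum_nonneg_eq_0_iff)
  qed
  then show ?thesis using assms(3) by (simp add: fps_eq_iff)
qed

lemma fps_scalar_prod_self_eq_0:
  fixes v :: "real fps vec"
  assumes "v \<in> carrier_vec n" "v \<bullet> v = 0"
  shows "v = 0\<^sub>v n"
proof (rule eq_vecI)
  have "(\<Sum>i = 0..<n. v $ i * v $ i) = 0" using assms by (auto simp: scalar_prod_def)
  then show "v $ i = 0\<^sub>v n $ i" if "i < dim_vec (0\<^sub>v n :: real fps vec)" for i
    using fps_sum_squares_eq_0[of "{0..<n}" "\<lambda>i. v $ i" i] that by simp
qed (use assms in simp)

lemma eq_add_if_eq_uminus_add:
  fixes a r d :: "'a::comm_ring_1 vec"
  assumes "r \<in> carrier_vec n" "a \<in> carrier_vec n" "d = - r + a"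
  shows "a = d + r"
  unfolding assms(3) using assms(1,2) by (intro eq_vecI) auto

lemma eq_uminus_if_add_eq_zero:
  fixes s b :: "'a::comm_ring_1 vec"
  assumes "s \<in> carrier_vec n" "b \<in> carrier_vec n" "0\<^sub>v n = s + b"
  shows "b = - s"
proof (rule eq_vecI)
  fix i assume "i < dim_vec (- s)"
  then have i: "i < n" using assms by simp
  then have "(s + b) $ i = 0" using assms(3)[symmetric] by simp
  then show "b $ i = (- s) $ i" using i assms(1,2) by (simp add: eq_neg_iff_add_eq_0 add.commute)
qed (use assms in simp)

lemma scalar_prod_uminus_right:
  fixes q s :: "'a::comm_ring_1 vec"
  assumes "q \<in> carrier_vec n" "s \<in> carrier_vec n"
  shows "q \<bullet> (- s) = - (q \<bullet> s)"
  using assms by (simp add: scalar_prod_def sum_negf)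

definition upper_left :: "nat \<Rightarrow> 'a mat \<Rightarrow> 'a mat" where
  "upper_left n M = mat n n (\<lambda>(i, j). M $$ (i, j))"

definition lower_left :: "nat \<Rightarrow> 'a mat \<Rightarrow> 'a mat" where
  "lower_left n M = mat n n (\<lambda>(i, j). M $$ (n + i, j))"

lemma block_carrier [simp]:
  "upper_left n M \<in> carrier_mat n n" "lower_left n M \<in> carrier_mat n n"
  by (simp_all add: upper_left_def lower_left_def)

lemma mult_vertical_vec:
  fixes M :: "'a::comm_ring_1 mat"
  assumes M: "M \<in> carrier_mat (n + n) (n + n)" and c: "c \<in> carrier_vec n"
  shows "M *\<^sub>v (c @\<^sub>v 0\<^sub>v n) = (upper_left n M *\<^sub>v c) @\<^sub>v (lower_left n M *\<^sub>v c)"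
proof (rule eq_vecI)
  fix i assume "i < dim_vec ((upper_left n M *\<^sub>v c) @\<^sub>v (lower_left n M *\<^sub>v c))"
  then have i: "i < n + n" by (simp add: upper_left_def lower_left_def)
  have "(M *\<^sub>v (c @\<^sub>v 0\<^sub>v n)) $ i = (\<Sum>j = 0..<n + n. M $$ (i, j) * (c @\<^sub>v 0\<^sub>v n) $ j)"
    using M c i by (simp add: scalar_prod_def)
  also have "\<dots> = (\<Sum>j = 0..<n. M $$ (i, j) * (c @\<^sub>v 0\<^sub>v n) $ j)"
    by (rule sum.mono_neutral_right) (use c in auto)
  also have "\<dots> = (\<Sum>j = 0..<n. M $$ (i, j) * c $ j)"
    by (rule sum.cong) (use c in auto)
  finally show "(M *\<^sub>v (c @\<^sub>v 0\<^sub>v n)) $ i = ((upper_left n M *\<^sub>v c) @\<^sub>v (lower_left n M *\<^sub>v c)) $ i"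
    using i c by (auto simp: upper_left_def lower_left_def scalar_prod_def)
qed (use M in \<open>simp add: upper_left_def lower_left_def\<close>)

lemma hamiltonian_mat_eq_ham: "hamiltonian_mat A B Q = ham A (B * transpose_mat B) Q"
  by (simp add: hamiltonian_mat_def ham_def)

section \<open>Symplecticity of the flow and the determinant of its lower left block\<close>

context lq
begin

sublocale fl: matrix_flow "n + n" H by unfold_locales simp

abbreviation Ef :: "real fps mat" where "Ef \<equiv> exp_fps H"

lemma Hf_eq: "fl.Hf = ham (map_mat fps_const A) (map_mat fps_const D) (map_mat fps_const Q)"
  unfolding H_def ham_def using carrier_matD[OF A] carrier_matD[OF D] carrier_matD[OF Q]
  by (intro eq_matI) auto

text \<open>The derivative of E^T J E is E^T (H^T J + J H) E = 0, and its constant term is J because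
  E starts with the identity.\<close>

lemma Ef_symplectic_mat: "transpose_mat Ef * (symplectic_mat n * Ef) = symplectic_mat n"
proof -
  let ?J = "symplectic_mat n :: real fps mat" and ?d = "map_mat (fps_deriv :: real fps \<Rightarrow> real fps)"
  let ?G = "transpose_mat Ef * (?J * Ef)"
  note E = fl.exp_fps_carrier
  note J = symplectic_mat_carrier[where n = n and ?'a = "real fps"]
  have ET: "transpose_mat Ef \<in> carrier_mat (n + n) (n + n)" using E by simp
  have Hf: "fl.Hf \<in> carrier_mat (n + n) (n + n)" by simp
  have HfT: "transpose_mat fl.Hf \<in> carrier_mat (n + n) (n + n)" by simp
  have JE: "?J * Ef \<in> carrier_mat (n + n) (n + n)" by (rule mult_carrier_mat[OF J E])
  have HE: "fl.Hf * Ef \<in> carrier_mat (n + n) (n + n)" by (rule mult_carrier_mat[OF Hf E])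
  have G: "?G \<in> carrier_mat (n + n) (n + n)" by (rule mult_carrier_mat[OF ET JE])
  have dJ: "?d ?J = 0\<^sub>m (n + n) (n + n)" by (rule eq_matI) (auto simp: symplectic_mat_def)
  have dET: "?d (transpose_mat Ef) = transpose_mat Ef * transpose_mat fl.Hf"
    unfolding map_mat_transpose[symmetric] fl.exp_fps_deriv(1) by (rule transpose_mult[OF Hf E])
  have dJE: "?d (?J * Ef) = ?J * (fl.Hf * Ef)"
    unfolding fps_deriv_mat_mult[OF J E] dJ fl.exp_fps_deriv(1)
    using left_mult_zero_mat[OF E, of "n + n"] left_add_zero_mat[OF mult_carrier_mat[OF J HE]] by simp
  have "?d ?G = (transpose_mat Ef * transpose_mat fl.Hf) * (?J * Ef) + transpose_mat Ef * (?J * (fl.Hf * Ef))"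
    unfolding fps_deriv_mat_mult[OF ET JE] dET dJE ..
  also have "(transpose_mat Ef * transpose_mat fl.Hf) * (?J * Ef) = transpose_mat Ef * ((transpose_mat fl.Hf * ?J) * Ef)"
    using assoc_mult_mat[OF ET HfT JE] assoc_mult_mat[OF HfT J E] by simp
  also have "transpose_mat Ef * (?J * (fl.Hf * Ef)) = transpose_mat Ef * ((?J * fl.Hf) * Ef)"
    using assoc_mult_mat[OF J Hf E] by simp
  also have "transpose_mat Ef * ((transpose_mat fl.Hf * ?J) * Ef) + transpose_mat Ef * ((?J * fl.Hf) * Ef) =
      transpose_mat Ef * ((transpose_mat fl.Hf * ?J + ?J * fl.Hf) * Ef)"
  proof -
    have a: "transpose_mat fl.Hf * ?J \<in> carrier_mat (n + n) (n + n)" "?J * fl.Hf \<in> carrier_mat (n + n) (n + n)"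
      by (rule mult_carrier_mat[OF HfT J], rule mult_carrier_mat[OF J Hf])
    show ?thesis
      unfolding add_mult_distrib_mat[OF a E]
      by (rule mult_add_distrib_mat[OF ET mult_carrier_mat[OF a(1) E] mult_carrier_mat[OF a(2) E], symmetric])
  qed
  also have "transpose_mat fl.Hf * ?J + ?J * fl.Hf = 0\<^sub>m (n + n) (n + n)"
    unfolding Hf_eq
    by (rule ham_symplectic_mat) (auto simp: map_mat_transpose D_sym Q_sym)
  finally have dG: "?d ?G = 0\<^sub>m (n + n) (n + n)"
    using left_mult_zero_mat[OF E, of "n + n"] right_mult_zero_mat[OF ET, of "n + n"] by simp
  let ?z = "map_mat (\<lambda>f. fps_nth f 0) :: real fps mat \<Rightarrow> real mat"
  have zE: "?z Ef = 1\<^sub>m (n + n)"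
    using carrier_matD[OF E] carrier_matD[OF H] by (intro eq_matI) (auto simp: fl.exp_fps_nth)
  have zET: "?z (transpose_mat Ef) = 1\<^sub>m (n + n)"
    using zE by (metis map_mat_transpose transpose_one)
  have "?z ?G = ?z ?J"
    unfolding fps_nth_0_mat_mult[OF ET JE] fps_nth_0_mat_mult[OF J E] zE zET
    using J by (simp add: left_mult_one_mat[of _ "n + n" "n + n"] right_mult_one_mat[of _ "n + n" "n + n"])
  show ?thesis
  proof (rule eq_matI)
    fix i j assume "i < dim_row ?J" "j < dim_col ?J"
    then have ij: "i < n + n" "j < n + n" using carrier_matD[OF J] by auto
    have "?d ?G $$ (i, j) = 0" unfolding dG using ij by simp
    then have "fps_deriv (?G $$ (i, j)) = 0" using ij carrier_matD[OF G] by simp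
    then have "?G $$ (i, j) = fps_const (fps_nth (?G $$ (i, j)) 0)" by (simp add: fps_deriv_eq_0_iff)
    also have "fps_nth (?G $$ (i, j)) 0 = ?z ?G $$ (i, j)" using ij carrier_matD[OF G] by simp
    also have "\<dots> = fps_nth (?J $$ (i, j)) 0" unfolding \<open>?z ?G = ?z ?J\<close> using ij carrier_matD[OF J] by simp
    also have "fps_const (fps_nth (?J $$ (i, j)) 0) = ?J $$ (i, j)"
      using ij by (auto simp: symplectic_mat_def)
    finally show "?G $$ (i, j) = ?J $$ (i, j)" .
  qed (use carrier_matD[OF G] carrier_matD[OF J] in simp_all)
qed

lemma symplectic_form_if_symplectic_mat:
  fixes M :: "'a::comm_ring_1 mat"
  assumes M: "M \<in> carrier_mat (n + n) (n + n)" and eq: "transpose_mat M * (symplectic_mat n * M) = symplectic_mat n"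
    and u: "u \<in> carrier_vec (n + n)" and v: "v \<in> carrier_vec (n + n)"
  shows "symplectic_form n (M *\<^sub>v u) (M *\<^sub>v v) = symplectic_form n u v"
proof -
  note J = symplectic_mat_carrier[where n = n and ?'a = 'a]
  have MT: "transpose_mat M \<in> carrier_mat (n + n) (n + n)" using M by simp
  have c: "M *\<^sub>v u \<in> carrier_vec (n + n)" "M *\<^sub>v v \<in> carrier_vec (n + n)" "symplectic_mat n *\<^sub>v (M *\<^sub>v v) \<in> carrier_vec (n + n)"
    "transpose_mat M *\<^sub>v (symplectic_mat n *\<^sub>v (M *\<^sub>v v)) \<in> carrier_vec (n + n)"
    by (rule mult_mat_vec_carrier[OF M u] mult_mat_vec_carrier[OF M v]
        mult_mat_vec_carrier[OF J mult_mat_vec_carrier[OF M v]]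
        mult_mat_vec_carrier[OF MT mult_mat_vec_carrier[OF J mult_mat_vec_carrier[OF M v]]])+
  have "symplectic_form n (M *\<^sub>v u) (M *\<^sub>v v) = (M *\<^sub>v u) \<bullet> (symplectic_mat n *\<^sub>v (M *\<^sub>v v))"
    by (rule symplectic_form_eq_mat[OF c(1,2)])
  also have "\<dots> = u \<bullet> (transpose_mat M *\<^sub>v (symplectic_mat n *\<^sub>v (M *\<^sub>v v)))"
    using transpose_vec_mult_scalar[OF M u c(3)] comm_scalar_prod[OF c(1,3)] comm_scalar_prod[OF u c(4)] by simp
  also have "transpose_mat M *\<^sub>v (symplectic_mat n *\<^sub>v (M *\<^sub>v v)) = (transpose_mat M * (symplectic_mat n * M)) *\<^sub>v v"
    using assoc_mult_mat_vec[OF MT mult_carrier_mat[OF J M] v] assoc_mult_mat_vec[OF J M v] by simp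
  also have "u \<bullet> \<dots> = symplectic_form n u v"
    unfolding eq by (rule symplectic_form_eq_mat[OF u v, symmetric])
  finally show ?thesis .
qed

lemma symplectic_form_flow:
  assumes "u \<in> carrier_vec (n + n)" "v \<in> carrier_vec (n + n)"
  shows "symplectic_form n (flow H t *\<^sub>v u) (flow H t *\<^sub>v v) = symplectic_form n u v"
proof (rule symplectic_form_if_symplectic_mat[OF fl.flow_carrier _ assms])
  note E = fl.exp_fps_carrier
  note J = symplectic_mat_carrier[where n = n and ?'a = "real fps"]
  have ET: "transpose_mat Ef \<in> carrier_mat (n + n) (n + n)" using E by simp
  have eE: "entire_mat Ef" "entire_mat (transpose_mat Ef)"
    using fl.entire_exp_fps by (auto simp: entire_mat_def)
  have eJ: "entire_mat (symplectic_mat n)"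
    by (auto simp: entire_mat_def symplectic_mat_def)
  have evJ: "eval_mat (symplectic_mat n) t = symplectic_mat n"
    by (rule eq_matI) (auto simp: symplectic_mat_def eval_fps_minus)
  have "eval_mat (transpose_mat Ef * (symplectic_mat n * Ef)) t =
      transpose_mat (flow H t) * (symplectic_mat n * flow H t)"
    using entire_mat_mult(1)[OF J E eJ eE(1)] entire_mat_mult(2)[OF J E eJ eE(1), of t] entire_mat_mult(2)[OF ET mult_carrier_mat[OF J E] eE(2), of t] evJ
    by (simp add: flow_def map_mat_transpose)
  then show "transpose_mat (flow H t) * (symplectic_mat n * flow H t) = symplectic_mat n"
    unfolding Ef_symplectic_mat evJ by simp
qed

lemma symplectic_form_Ef:
  assumes "u \<in> carrier_vec (n + n)" "v \<in> carrier_vec (n + n)"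
  shows "symplectic_form n (Ef *\<^sub>v u) (Ef *\<^sub>v v) = symplectic_form n u v"
  by (rule symplectic_form_if_symplectic_mat[OF fl.exp_fps_carrier Ef_symplectic_mat assms])

text \<open>If the determinant vanished, the formal curve \<open>exp(t H)\<close> would send some \<open>(c(t), 0)\<close> to a vertical
  \<open>(q(t), 0)\<close> with \<open>q \<noteq> 0\<close>. Differentiating such a relation shows \<open>q \<bullet> D q = 0\<close> and gives another one with
  \<open>q' + A\<^sup>T q\<close> in place of \<open>q\<close>, against controllability.\<close>

theorem det_lower_left_Ef: "det (lower_left n Ef) \<noteq> 0"
proof
  assume "det (lower_left n Ef) = 0"
  \<comment> \<open>Power series form an integral domain, so a vanishing determinant still yields a
    nonzero kernel vector, whose entries are themselves power series.\<close>
  then obtain c where c: "c \<in> carrier_vec n" "c \<noteq> 0\<^sub>v n" "lower_left n Ef *\<^sub>v c = 0\<^sub>v n"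
    using det_0_iff_vec_prod_zero[of "lower_left n Ef" n] by auto
  let ?d = "map_vec (fps_deriv :: real fps \<Rightarrow> real fps)"
  let ?k = "map_mat (fps_const :: real \<Rightarrow> real fps)"
  let ?A = "?k A" and ?D = "?k D" and ?Q = "?k Q" and ?BT = "?k (transpose_mat B)" and ?AT = "?k (transpose_mat A)"
  have car: "?A \<in> carrier_mat n n" "?D \<in> carrier_mat n n" "?Q \<in> carrier_mat n n" "?BT \<in> carrier_mat k n"
    "?AT \<in> carrier_mat n n" by auto
  note E = fl.exp_fps_carrier
  define K where "K = {q \<in> carrier_vec n. \<exists>c\<in>carrier_vec n. Ef *\<^sub>v (c @\<^sub>v 0\<^sub>v n) = q @\<^sub>v 0\<^sub>v n}"
  have K: "?BT *\<^sub>v q = 0\<^sub>v k \<and> ?d q + ?AT *\<^sub>v q \<in> K" if "q \<in> K" for q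
  proof -
    obtain c where c: "c \<in> carrier_vec n" and Ec: "Ef *\<^sub>v (c @\<^sub>v 0\<^sub>v n) = q @\<^sub>v 0\<^sub>v n" and q: "q \<in> carrier_vec n"
      using \<open>q \<in> K\<close> by (auto simp: K_def)
    have d_append: "?d (a @\<^sub>v b) = ?d a @\<^sub>v ?d b" for a b by (rule eq_vecI) auto
    have d0: "?d (0\<^sub>v n) = 0\<^sub>v n" by (rule eq_vecI) auto
    have cc: "c @\<^sub>v 0\<^sub>v n \<in> carrier_vec (n + n)" "?d c @\<^sub>v 0\<^sub>v n \<in> carrier_vec (n + n)" "q @\<^sub>v 0\<^sub>v n \<in> carrier_vec (n + n)"
      using c q by auto
    have ATq: "?AT *\<^sub>v q \<in> carrier_vec n" "?D *\<^sub>v q \<in> carrier_vec n" "?d q \<in> carrier_vec n"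
      using mult_mat_vec_carrier[OF car(5) q] mult_mat_vec_carrier[OF car(2) q] q by auto
    let ?w = "Ef *\<^sub>v (?d c @\<^sub>v 0\<^sub>v n)"
    have wc: "?w \<in> carrier_vec (n + n)" using E cc(2) by (rule mult_mat_vec_carrier)
    have Hq: "fl.Hf *\<^sub>v (q @\<^sub>v 0\<^sub>v n) = (- (?AT *\<^sub>v q)) @\<^sub>v (?D *\<^sub>v q)"
    proof -
      have "?Q *\<^sub>v 0\<^sub>v n = 0\<^sub>v n" "?A *\<^sub>v 0\<^sub>v n = 0\<^sub>v n"
        by (rule mult_mat_zero_vec[OF car(3)], rule mult_mat_zero_vec[OF car(1)])
      then show ?thesis
        unfolding Hf_eq ham_mult_vec[OF car(1-3) q zero_carrier_vec] using ATq by (simp add: map_mat_transpose)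
    qed
    have "?d q @\<^sub>v 0\<^sub>v n = ?d (Ef *\<^sub>v (c @\<^sub>v 0\<^sub>v n))" unfolding Ec d_append d0 ..
    also have "\<dots> = fl.Hf *\<^sub>v (Ef *\<^sub>v (c @\<^sub>v 0\<^sub>v n)) + ?w"
      unfolding fps_deriv_mat_mult_vec[OF E cc(1)] fl.exp_fps_deriv(1) d_append d0
      by (subst assoc_mult_mat_vec[OF _ E cc(1), of _ "n + n"]) auto
    finally have eq: "?d q @\<^sub>v 0\<^sub>v n = ((- (?AT *\<^sub>v q)) @\<^sub>v (?D *\<^sub>v q)) + ?w" unfolding Ec Hq .
    obtain a b where ab: "?w = a @\<^sub>v b" "a \<in> carrier_vec n" "b \<in> carrier_vec n"
      using wc by (rule carrier_vec_appendE)
    have "?d q @\<^sub>v 0\<^sub>v n = (- (?AT *\<^sub>v q) + a) @\<^sub>v (?D *\<^sub>v q + b)"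
      using eq ab ATq by (simp add: append_vec_add[of _ n _ _ n])
    then have ab': "?d q = - (?AT *\<^sub>v q) + a" "0\<^sub>v n = ?D *\<^sub>v q + b"
      using append_vec_eq[OF ATq(3), of "- (?AT *\<^sub>v q) + a" "0\<^sub>v n" "?D *\<^sub>v q + b"] ATq ab by auto
    have a: "a = ?d q + ?AT *\<^sub>v q" by (rule eq_add_if_eq_uminus_add[OF ATq(1) ab(2) ab'(1)])
    have b: "b = - (?D *\<^sub>v q)" by (rule eq_uminus_if_add_eq_zero[OF ATq(2) ab(3) ab'(2)])
    have "symplectic_form n (q @\<^sub>v 0\<^sub>v n) ?w = 0"
      using symplectic_form_Ef[OF cc(1,2)] unfolding Ec using c by (simp add: symplectic_form_append)
    then have "q \<bullet> b = 0" unfolding ab(1) using q ab by (simp add: symplectic_form_append)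
    moreover have "q \<bullet> b = - (q \<bullet> (?D *\<^sub>v q))" unfolding b by (rule scalar_prod_uminus_right[OF q ATq(2)])
    ultimately have qDq: "q \<bullet> (?D *\<^sub>v q) = 0" by simp
    have kB: "?k B \<in> carrier_mat n k" by auto
    have Dk: "?D *\<^sub>v v = ?k B *\<^sub>v (?BT *\<^sub>v v)" if "v \<in> carrier_vec n" for v
    proof -
      have "?D = ?k B * ?BT"
        unfolding D_def using carrier_matD[OF B]
        by (intro eq_matI) (auto simp: scalar_prod_def fps_eq_iff fps_sum_nth)
      then show ?thesis using assoc_mult_mat_vec[OF kB car(4) that] by simp
    qed
    have Bq: "?BT *\<^sub>v q \<in> carrier_vec k" by (rule mult_mat_vec_carrier[OF car(4) q])
    have "(?BT *\<^sub>v q) \<bullet> (?BT *\<^sub>v q) = 0"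
      using qDq transpose_vec_mult_scalar[OF kB Bq q] unfolding Dk[OF q] by (simp add: map_mat_transpose)
    then have B0: "?BT *\<^sub>v q = 0\<^sub>v k" by (rule fps_scalar_prod_self_eq_0[OF Bq])
    then have "?D *\<^sub>v q = 0\<^sub>v n" unfolding Dk[OF q] using mult_mat_zero_vec[OF kB] by simp
    then have "b = 0\<^sub>v n" unfolding b by auto
    then have "?w = (?d q + ?AT *\<^sub>v q) @\<^sub>v 0\<^sub>v n" using ab a by simp
    then have "?d q + ?AT *\<^sub>v q \<in> K" unfolding K_def using ATq c by (intro CollectI conjI bexI[of _ "?d c"]) auto
    then show ?thesis using B0 by blast
  qed
  have Kc: "q \<in> carrier_vec n" if "q \<in> K" for q using that by (simp add: K_def)
  \<comment> \<open>B^T (A^T)^j applied to q' + A^T q vanishes by induction. Its first part is the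
    derivative of B^T (A^T)^j q = 0, so the part with power j + 1 vanishes too.\<close>
  have K2: "\<forall>q\<in>K. ?BT *\<^sub>v ((*\<^sub>v) ?AT ^^ j) q = 0\<^sub>v k" for j
  proof (induction j)
    case 0
    then show ?case using K by simp
  next
    case (Suc j)
    show ?case
    proof
      fix q assume q: "q \<in> K"
      have qc: "q \<in> carrier_vec n" using Kc[OF q] .
      have dk: "?d (?k M *\<^sub>v v) = ?k M *\<^sub>v ?d v" if "M \<in> carrier_mat m n" "v \<in> carrier_vec n" for M m v
        using that by (intro eq_vecI) (auto simp: scalar_prod_def fps_deriv_sum intro!: sum.cong)
      have dkj: "?d (((*\<^sub>v) ?AT ^^ j) q) = ((*\<^sub>v) ?AT ^^ j) (?d q)"
      proof (induction j)
        case (Suc j)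
        have "?d (?AT *\<^sub>v ((*\<^sub>v) ?AT ^^ j) q) = ?AT *\<^sub>v ?d (((*\<^sub>v) ?AT ^^ j) q)"
          by (rule dk[of _ n]) (use funpow_mult_carrier[OF car(5) qc] in auto)
        then show ?case using Suc by simp
      qed simp
      have dqc: "?d q \<in> carrier_vec n" "?AT *\<^sub>v q \<in> carrier_vec n"
        using qc mult_mat_vec_carrier[OF car(5) qc] by auto
      have "0\<^sub>v k = ?BT *\<^sub>v ((*\<^sub>v) ?AT ^^ j) (?d q + ?AT *\<^sub>v q)" using Suc K[OF q] by simp
      also have "\<dots> = ?BT *\<^sub>v ((*\<^sub>v) ?AT ^^ j) (?d q) + ?BT *\<^sub>v ((*\<^sub>v) ?AT ^^ Suc j) q"
        unfolding funpow_mult_add[OF car(5) dqc]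
        using mult_add_distrib_mat_vec[OF car(4) funpow_mult_carrier[OF car(5) dqc(1)] funpow_mult_carrier[OF car(5) dqc(2)]]
        by (simp add: funpow_swap1)
      also have "?BT *\<^sub>v ((*\<^sub>v) ?AT ^^ j) (?d q) = ?d (?BT *\<^sub>v ((*\<^sub>v) ?AT ^^ j) q)"
        unfolding dkj[symmetric] by (rule dk[symmetric, of _ k]) (use funpow_mult_carrier[OF car(5) qc] in auto)
      also have "\<dots> = 0\<^sub>v k" using Suc q by (auto intro!: eq_vecI)
      finally show "?BT *\<^sub>v ((*\<^sub>v) ?AT ^^ Suc j) q = 0\<^sub>v k"
        using mult_mat_vec_carrier[OF car(4) funpow_mult_carrier[OF car(5) qc], of "Suc j"] by simp
    qed
  qed
  have K3: "q = 0\<^sub>v n" if q: "q \<in> K" for q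
  proof -
    have qc: "q \<in> carrier_vec n" using Kc[OF q] .
    have coeff: "map_vec (\<lambda>f. fps_nth f l) (?k M *\<^sub>v v) = M *\<^sub>v map_vec (\<lambda>f. fps_nth f l) v"
      if "M \<in> carrier_mat m n" "v \<in> carrier_vec n" for l M m v
      using that by (intro eq_vecI) (auto simp: scalar_prod_def fps_sum_nth intro!: sum.cong)
    have z: "map_vec (\<lambda>f. fps_nth f l) (0\<^sub>v k) = (0\<^sub>v k :: real vec)" for l
      by (rule eq_vecI) auto
    \<comment> \<open>Controllability is a statement over the reals and is applied to each
      coefficient vector of \<open>q\<close>.\<close>
    have "map_vec (\<lambda>f. fps_nth f l) q = 0\<^sub>v n" for l
    proof (rule controllable_orthogonal[OF A B controllable])
      fix j
      have "map_vec (\<lambda>f. fps_nth f l) (((*\<^sub>v) ?AT ^^ j) q) = ((*\<^sub>v) (transpose_mat A) ^^ j) (map_vec (\<lambda>f. fps_nth f l) q)"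
      proof (induction j)
        case (Suc j)
        have "map_vec (\<lambda>f. fps_nth f l) (?AT *\<^sub>v ((*\<^sub>v) ?AT ^^ j) q) = transpose_mat A *\<^sub>v map_vec (\<lambda>f. fps_nth f l) (((*\<^sub>v) ?AT ^^ j) q)"
          by (rule coeff[of _ n]) (use funpow_mult_carrier[OF car(5) qc] in auto)
        then show ?case using Suc by simp
      qed simp
      moreover have "map_vec (\<lambda>f. fps_nth f l) (?BT *\<^sub>v ((*\<^sub>v) ?AT ^^ j) q) = transpose_mat B *\<^sub>v map_vec (\<lambda>f. fps_nth f l) (((*\<^sub>v) ?AT ^^ j) q)"
        by (rule coeff[of _ k]) (use funpow_mult_carrier[OF car(5) qc] in auto)
      ultimately show "transpose_mat B *\<^sub>v ((*\<^sub>v) (transpose_mat A) ^^ j) (map_vec (\<lambda>f. fps_nth f l) q) = 0\<^sub>v k"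
        using K2 q z by simp
    qed (use qc in simp)
    then have "map_vec (\<lambda>f. fps_nth f l) q $ i = 0" if "i < n" for l i using that by simp
    then have "fps_nth (q $ i) l = 0" if "i < n" for l i
      unfolding atomize_all using that qc by (metis carrier_vecD index_map_vec(1))
    then show ?thesis using qc by (intro eq_vecI) (auto simp: fps_eq_iff)
  qed
  have "upper_left n Ef *\<^sub>v c \<in> K"
    unfolding K_def using c mult_vertical_vec[OF E c(1)] by (auto intro: mult_mat_vec_carrier[of _ n n])
  then have "Ef *\<^sub>v (c @\<^sub>v 0\<^sub>v n) = 0\<^sub>v (n + n)"
    using K3 mult_vertical_vec[OF E c(1)] c(3) by (simp add: zero_vec_append)
  \<comment> \<open>\<open>Ef\<close> preserves a nondegenerate form, so it cannot kill (c, 0)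
    unless c = 0.\<close>
  then have "symplectic_form n (c @\<^sub>v 0\<^sub>v n) v = 0" if "v \<in> carrier_vec (n + n)" for v
    using symplectic_form_Ef[of "c @\<^sub>v 0\<^sub>v n" v] c(1) that
      symplectic_form_append[of "0\<^sub>v n" n "0\<^sub>v n"] carrier_vec_appendE[OF mult_mat_vec_carrier[OF E that]]
    by (metis append_carrier_vec zero_carrier_vec zero_vec_append scalar_prod_left_zero diff_0_right)
  then have "c \<bullet> unit_vec n i = 0" if "i < n" for i
    using c(1) that symplectic_form_append[OF c(1) zero_carrier_vec zero_carrier_vec unit_vec_carrier, of i] by simp
  then have "c = 0\<^sub>v n" using c(1) by (intro eq_vecI) auto
  then show False using c(2) by blast
qed

end

subsection \<open>Conjugate times\<close>

text \<open>Componentwise, because vectors of variable length carry no topology; only the components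
  below n count.\<close>

definition vderiv :: "nat \<Rightarrow> (real \<Rightarrow> real vec) \<Rightarrow> real vec \<Rightarrow> real \<Rightarrow> bool" where
  "vderiv n f f' t \<longleftrightarrow> (\<forall>i<n. ((\<lambda>s. f s $ i) has_real_derivative f' $ i) (at t))"

lemma vderiv_mult:
  assumes M: "M \<in> carrier_mat m n" and f: "\<And>s. f s \<in> carrier_vec n" "f' \<in> carrier_vec n"
    and d: "vderiv n f f' t"
  shows "vderiv m (\<lambda>s. M *\<^sub>v f s) (M *\<^sub>v f') t"
  unfolding vderiv_def
proof (intro allI impI)
  fix i assume i: "i < m"
  have idx: "(M *\<^sub>v v) $ i = (\<Sum>j = 0..<n. M $$ (i, j) * v $ j)" if "v \<in> carrier_vec n" for v
    using M i that by (auto simp: scalar_prod_def)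
  show "((\<lambda>s. (M *\<^sub>v f s) $ i) has_real_derivative (M *\<^sub>v f') $ i) (at t)"
    unfolding idx[OF f(1)] idx[OF f(2)] using d unfolding vderiv_def
    by (intro DERIV_sum DERIV_cmult) auto
qed

lemma vderiv_diff:
  assumes "\<And>s. f s \<in> carrier_vec n" "f' \<in> carrier_vec n" "\<And>s. g s \<in> carrier_vec n" "g' \<in> carrier_vec n"
    and "vderiv n f f' t" "vderiv n g g' t"
  shows "vderiv n (\<lambda>s. f s - g s) (f' - g') t"
  unfolding vderiv_def
proof (intro allI impI)
  fix i assume i: "i < n"
  have "((\<lambda>s. f s $ i - g s $ i) has_real_derivative f' $ i - g' $ i) (at t)"
    using assms(5,6) i unfolding vderiv_def by (intro DERIV_diff) auto
  moreover have "(f s - g s) $ i = f s $ i - g s $ i" for s using assms(3)[of s] i by simp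
  ultimately show "((\<lambda>s. (f s - g s) $ i) has_real_derivative (f' - g') $ i) (at t)"
    using assms(4) i by simp
qed

lemma vderiv_scalar_prod:
  assumes "\<And>s. f s \<in> carrier_vec n" "f' \<in> carrier_vec n" "\<And>s. g s \<in> carrier_vec n" "g' \<in> carrier_vec n"
    and "vderiv n f f' t" "vderiv n g g' t"
  shows "((\<lambda>s. f s \<bullet> g s) has_real_derivative f' \<bullet> g t + f t \<bullet> g') (at t)"
proof -
  have "((\<lambda>s. \<Sum>i = 0..<n. f s $ i * g s $ i) has_real_derivative (\<Sum>i = 0..<n. f' $ i * g t $ i + g' $ i * f t $ i)) (at t)"
    using assms(5,6) unfolding vderiv_def by (intro DERIV_sum DERIV_mult) auto
  moreover have "f s \<bullet> g s = (\<Sum>i = 0..<n. f s $ i * g s $ i)" for s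
    using assms(3)[of s] by (auto simp: scalar_prod_def)
  moreover have "(\<Sum>i = 0..<n. f' $ i * g t $ i + g' $ i * f t $ i) = f' \<bullet> g t + f t \<bullet> g'"
    using assms(3)[of t] assms(4) by (auto simp: scalar_prod_def sum.distrib mult.commute)
  ultimately show ?thesis by simp
qed

lemma vderiv_zero:
  assumes "vderiv n f f' t" "f' \<in> carrier_vec n" "open U" "t \<in> U" "\<And>s. s \<in> U \<Longrightarrow> f s = 0\<^sub>v n"
  shows "f' = 0\<^sub>v n"
proof (rule eq_vecI)
  fix i assume "i < dim_vec (0\<^sub>v n :: real vec)"
  then have i: "i < n" by simp
  have "((\<lambda>s. f s $ i) has_real_derivative f' $ i) (at t)" using assms(1) i by (simp add: vderiv_def)
  moreover have "((\<lambda>s. f s $ i) has_real_derivative 0) (at t)"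
    by (rule has_field_derivative_transform_within_open[of "\<lambda>_. 0" _ _ U]) (use assms i in auto)
  ultimately show "f' $ i = 0\<^sub>v n $ i" using i by (auto dest: DERIV_unique)
qed (use assms in simp)

lemma vderiv_append:
  assumes "vderiv (n + m) (\<lambda>s. p s @\<^sub>v x s) (p' @\<^sub>v x') t"
    and "\<And>s. p s \<in> carrier_vec n" "p' \<in> carrier_vec n" "\<And>s. x s \<in> carrier_vec m" "x' \<in> carrier_vec m"
  shows "vderiv n p p' t" "vderiv m x x' t"
proof -
  show "vderiv n p p' t"
    unfolding vderiv_def
  proof (intro allI impI)
    fix i assume i: "i < n"
    have "(p s @\<^sub>v x s) $ i = p s $ i" for s using assms(2)[of s] assms(4)[of s] i by simp
    then show "((\<lambda>s. p s $ i) has_real_derivative p' $ i) (at t)"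
      using assms(1)[unfolded vderiv_def, rule_format, of i] assms(3,5) i by simp
  qed
  show "vderiv m x x' t"
    unfolding vderiv_def
  proof (intro allI impI)
    fix i assume i: "i < m"
    have "(p s @\<^sub>v x s) $ (n + i) = x s $ i" for s using assms(2)[of s] assms(4)[of s] i by simp
    then show "((\<lambda>s. x s $ i) has_real_derivative x' $ i) (at t)"
      using assms(1)[unfolded vderiv_def, rule_format, of "n + i"] assms(3,5) i by simp
  qed
qed

lemma vderiv_flow:
  assumes "matrix_flow N H" "v \<in> carrier_vec N"
  shows "vderiv N (\<lambda>s. flow H s *\<^sub>v v) (H *\<^sub>v (flow H t *\<^sub>v v)) t"
  unfolding vderiv_def
proof (intro allI impI)
  interpret matrix_flow N H by fact
  fix i assume i: "i < N"
  have idx: "(M *\<^sub>v v) $ i = (\<Sum>j = 0..<N. M $$ (i, j) * v $ j)" if "M \<in> carrier_mat N N" for M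
    using that i assms(2) by (auto simp: scalar_prod_def)
  have eq: "H *\<^sub>v (flow H t *\<^sub>v v) = (H * flow H t) *\<^sub>v v"
    using assms(2) by (simp add: assoc_mult_mat_vec[of _ N N _ N])
  show "((\<lambda>s. (flow H s *\<^sub>v v) $ i) has_real_derivative (H *\<^sub>v (flow H t *\<^sub>v v)) $ i) (at t)"
    unfolding eq idx[OF flow_carrier] idx[OF mult_carrier_mat[OF H flow_carrier]]
    using flow_has_derivative(1)[OF i] by (intro DERIV_sum DERIV_cmult_right) auto
qed

context lq
begin

text \<open>The left block column of the flow: the solution that starts at (c, 0) is
  (\<open>Pm t\<close> c, \<open>Xm t\<close> c).\<close>

definition Pm :: "real \<Rightarrow> real mat" where "Pm t = upper_left n (flow H t)"
definition Xm :: "real \<Rightarrow> real mat" where "Xm t = lower_left n (flow H t)"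

lemma PX_carrier [simp]: "Pm t \<in> carrier_mat n n" "Xm t \<in> carrier_mat n n"
  by (simp_all add: Pm_def Xm_def)

lemma PX_vec_carrier [simp]: "c \<in> carrier_vec n \<Longrightarrow> Pm t *\<^sub>v c \<in> carrier_vec n" "c \<in> carrier_vec n \<Longrightarrow> Xm t *\<^sub>v c \<in> carrier_vec n"
  by (auto intro: mult_mat_vec_carrier[of _ n n])

lemma flow_vertical: "c \<in> carrier_vec n \<Longrightarrow> flow H t *\<^sub>v (c @\<^sub>v 0\<^sub>v n) = (Pm t *\<^sub>v c) @\<^sub>v (Xm t *\<^sub>v c)"
  unfolding Pm_def Xm_def by (rule mult_vertical_vec[OF fl.flow_carrier])

lemma flow_flow: "v \<in> carrier_vec (n + n) \<Longrightarrow> flow H s *\<^sub>v (flow H t *\<^sub>v v) = flow H (s + t) *\<^sub>v v"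
  unfolding fl.flow_add by (rule assoc_mult_mat_vec[symmetric, OF fl.flow_carrier fl.flow_carrier])

lemma flow_vec_carrier [simp]: "v \<in> carrier_vec (n + n) \<Longrightarrow> flow H t *\<^sub>v v \<in> carrier_vec (n + n)"
  by (rule mult_mat_vec_carrier[OF fl.flow_carrier])

lemma flow_minus: "v \<in> carrier_vec (n + n) \<Longrightarrow> flow H (- t) *\<^sub>v (flow H t *\<^sub>v v) = v"
  by (simp add: flow_flow fl.flow_0)

lemma PX_0: "Pm 0 = 1\<^sub>m n" "Xm 0 = 0\<^sub>m n n"
  unfolding Pm_def Xm_def fl.flow_0 by (auto simp: upper_left_def lower_left_def intro!: eq_matI)

text \<open>Time reversal: if the flow at t carries (c, 0) to (q, 0), the flow at -t carries (q, 0)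
  back, and q is nonzero.\<close>

lemma det_Xm_uminus_aux:
  assumes "det (Xm t) = 0"
  shows "det (Xm (- t)) = 0"
proof -
  obtain c where c: "c \<in> carrier_vec n" "c \<noteq> 0\<^sub>v n" "Xm t *\<^sub>v c = 0\<^sub>v n"
    using assms det_0_iff_vec_prod_zero_field[OF PX_carrier(2)] by blast
  let ?q = "Pm t *\<^sub>v c"
  have q: "?q \<in> carrier_vec n" using c(1) by simp
  have ft: "flow H t *\<^sub>v (c @\<^sub>v 0\<^sub>v n) = ?q @\<^sub>v 0\<^sub>v n" using flow_vertical[OF c(1), of t] c(3) by simp
  have "c @\<^sub>v 0\<^sub>v n = flow H (- t) *\<^sub>v (?q @\<^sub>v 0\<^sub>v n)"
    using flow_minus[of "c @\<^sub>v 0\<^sub>v n" t] c(1) unfolding ft by simp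
  also have "\<dots> = (Pm (- t) *\<^sub>v ?q) @\<^sub>v (Xm (- t) *\<^sub>v ?q)" by (rule flow_vertical[OF q])
  finally have "Pm (- t) *\<^sub>v ?q = c" "Xm (- t) *\<^sub>v ?q = 0\<^sub>v n"
    using append_vec_eq[OF c(1) PX_vec_carrier(1)[OF q], of "0\<^sub>v n" "- t" "Xm (- t) *\<^sub>v ?q"] by auto
  moreover from this(1) have "?q \<noteq> 0\<^sub>v n" using c(2) mult_mat_zero_vec[OF PX_carrier(1), of "- t"] by auto
  ultimately show ?thesis using det_0_iff_vec_prod_zero_field[OF PX_carrier(2)] q by blast
qed

lemma det_Xm_uminus: "det (Xm (- t)) = 0 \<longleftrightarrow> det (Xm t) = 0"
  using det_Xm_uminus_aux[of t] det_Xm_uminus_aux[of "- t"] by auto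

text \<open>\<open>jacobi_curve\<close> runs the flow backwards, so the determinant that appears
  directly is the one at -t; \<open>det_Xm_uminus\<close> removes the sign.\<close>

lemma conjugate_time_iff: "conjugate_time n H t \<longleftrightarrow> t \<noteq> 0 \<and> det (Xm t) = 0"
proof -
  have J: "jacobi_curve n H t = (\<lambda>c. (Pm (- t) *\<^sub>v c) @\<^sub>v (Xm (- t) *\<^sub>v c)) ` carrier_vec n"
  proof -
    have "vertical_space n = (\<lambda>c. c @\<^sub>v 0\<^sub>v n) ` carrier_vec n" by (auto simp: vertical_space_def)
    then show ?thesis
      unfolding jacobi_curve_def fl.mat_exp_flow by (simp add: image_image flow_vertical)
  qed
  have 0: "(0\<^sub>v (2 * n) :: real vec) = 0\<^sub>v n @\<^sub>v 0\<^sub>v n" unfolding mult_2 by (rule zero_vec_append)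
  have zero_mem: "0\<^sub>v (2 * n) \<in> jacobi_curve n H t \<inter> vertical_space n"
    unfolding J 0 vertical_space_def
    using mult_mat_zero_vec[OF PX_carrier(1), of "- t"] mult_mat_zero_vec[OF PX_carrier(2), of "- t"]
    by (auto intro!: image_eqI[of _ _ "0\<^sub>v n"])
  have "jacobi_curve n H t \<inter> vertical_space n \<noteq> {0\<^sub>v (2 * n)} \<longleftrightarrow>
      (\<exists>c. c \<in> carrier_vec n \<and> c \<noteq> 0\<^sub>v n \<and> Xm (- t) *\<^sub>v c = 0\<^sub>v n)"
  proof
    assume "jacobi_curve n H t \<inter> vertical_space n \<noteq> {0\<^sub>v (2 * n)}"
    then obtain w where w: "w \<in> jacobi_curve n H t" "w \<in> vertical_space n" "w \<noteq> 0\<^sub>v (2 * n)"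
      using zero_mem by blast
    then obtain c p where c: "c \<in> carrier_vec n" "w = (Pm (- t) *\<^sub>v c) @\<^sub>v (Xm (- t) *\<^sub>v c)"
      and p: "p \<in> carrier_vec n" "w = p @\<^sub>v 0\<^sub>v n"
      unfolding J vertical_space_def by blast
    have "Xm (- t) *\<^sub>v c = 0\<^sub>v n"
      using append_vec_eq[OF PX_vec_carrier(1)[OF c(1)] p(1)] c(2) p(2) by metis
    moreover have "c \<noteq> 0\<^sub>v n"
    proof
      assume "c = 0\<^sub>v n"
      then have "w = 0\<^sub>v (2 * n)" unfolding c(2) 0
        using mult_mat_zero_vec[OF PX_carrier(1), of "- t"] mult_mat_zero_vec[OF PX_carrier(2), of "- t"] by simp
      then show False using w(3) by blast
    qed
    ultimately show "\<exists>c. c \<in> carrier_vec n \<and> c \<noteq> 0\<^sub>v n \<and> Xm (- t) *\<^sub>v c = 0\<^sub>v n" using c(1) by blast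
  next
    assume "\<exists>c. c \<in> carrier_vec n \<and> c \<noteq> 0\<^sub>v n \<and> Xm (- t) *\<^sub>v c = 0\<^sub>v n"
    then obtain c where c: "c \<in> carrier_vec n" "c \<noteq> 0\<^sub>v n" "Xm (- t) *\<^sub>v c = 0\<^sub>v n" by blast
    let ?w = "(Pm (- t) *\<^sub>v c) @\<^sub>v (Xm (- t) *\<^sub>v c)"
    have "?w \<in> jacobi_curve n H t \<inter> vertical_space n"
    proof
      show "?w \<in> jacobi_curve n H t" unfolding J by (rule imageI[OF c(1)])
      show "?w \<in> vertical_space n"
        unfolding c(3) vertical_space_def using PX_vec_carrier(1)[OF c(1), of "- t"] by blast
    qed
    moreover have "?w \<noteq> 0\<^sub>v (2 * n)"
    proof
      assume eq: "?w = 0\<^sub>v (2 * n)"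
      have cc: "c @\<^sub>v 0\<^sub>v n \<in> carrier_vec (n + n)" using c(1) by simp
      have "c @\<^sub>v 0\<^sub>v n = flow H t *\<^sub>v ?w"
        using flow_minus[OF cc, of "- t"] flow_vertical[OF c(1), of "- t"] by simp
      also have "\<dots> = 0\<^sub>v (n + n)" unfolding eq mult_2 by (rule mult_mat_zero_vec[OF fl.flow_carrier])
      finally show False using c(1,2) append_vec_eq_zero[OF c(1) zero_carrier_vec, of n] by simp
    qed
    ultimately show "jacobi_curve n H t \<inter> vertical_space n \<noteq> {0\<^sub>v (2 * n)}" by blast
  qed
  also have "\<dots> \<longleftrightarrow> det (Xm t) = 0"
    using det_0_iff_vec_prod_zero_field[OF PX_carrier(2), of "- t"] det_Xm_uminus[of t] by simp
  finally show ?thesis by (simp add: conjugate_time_def)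
qed

lemma conjugate_time_uminus: "conjugate_time n H (- t) \<longleftrightarrow> conjugate_time n H t"
  by (simp add: conjugate_time_iff det_Xm_uminus)

text \<open>The conjugate times are among the zeros of a nonzero entire power series. Without
  finiteness \<open>card\<close> would be 0 by convention and the count would carry no
  information.\<close>

lemma finite_conjugate_times: "finite {t \<in> {a..b}. conjugate_time n H t}"
proof -
  let ?L = "lower_left n Ef"
  have L: "?L \<in> carrier_mat n n" by simp
  have ent: "entire_mat ?L"
    using fl.entire_exp_fps carrier_matD[OF fl.exp_fps_carrier] by (auto simp: entire_mat_def lower_left_def)
  have ev: "eval_mat ?L t = Xm t" for t
    using carrier_matD[OF fl.exp_fps_carrier] by (intro eq_matI) (auto simp: Xm_def flow_def lower_left_def)
  have "finite {t \<in> {a..b}. eval_fps (det ?L) t = 0}"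
    by (rule finite_zeros_entire_fps[OF entire_det(1)[OF L ent] det_lower_left_Ef])
  then show ?thesis
    by (rule rev_finite_subset) (auto simp: entire_det(2)[OF L ent] ev conjugate_time_iff)
qed

lemma vderiv_PX:
  assumes "c \<in> carrier_vec n"
  shows "vderiv n (\<lambda>s. Pm s *\<^sub>v c) (- (transpose_mat A *\<^sub>v (Pm t *\<^sub>v c)) - Q *\<^sub>v (Xm t *\<^sub>v c)) t"
    "vderiv n (\<lambda>s. Xm s *\<^sub>v c) (D *\<^sub>v (Pm t *\<^sub>v c) + A *\<^sub>v (Xm t *\<^sub>v c)) t"
proof -
  have d: "vderiv (n + n) (\<lambda>s. (Pm s *\<^sub>v c) @\<^sub>v (Xm s *\<^sub>v c))
     ((- (transpose_mat A *\<^sub>v (Pm t *\<^sub>v c)) - Q *\<^sub>v (Xm t *\<^sub>v c)) @\<^sub>v (D *\<^sub>v (Pm t *\<^sub>v c) + A *\<^sub>v (Xm t *\<^sub>v c))) t"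
    using vderiv_flow[OF fl.matrix_flow_axioms, of "c @\<^sub>v 0\<^sub>v n" t] assms
    by (simp add: flow_vertical H_append)
  show "vderiv n (\<lambda>s. Pm s *\<^sub>v c) (- (transpose_mat A *\<^sub>v (Pm t *\<^sub>v c)) - Q *\<^sub>v (Xm t *\<^sub>v c)) t"
    "vderiv n (\<lambda>s. Xm s *\<^sub>v c) (D *\<^sub>v (Pm t *\<^sub>v c) + A *\<^sub>v (Xm t *\<^sub>v c)) t"
    by (rule vderiv_append[OF d]; use assms in simp)+
qed

text \<open>The function y . x is nondecreasing and vanishes at both ends, so it vanishes in
  between. Hence B^T y = 0 there, repeated differentiation gives y = 0, and y starts at c.\<close>

theorem riccati_no_conjugate_time:
  assumes S: "riccati S"
  shows "\<not> conjugate_time n H t"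
proof
  assume "conjugate_time n H t"
  then have t: "t \<noteq> 0" "det (Xm t) = 0" by (simp_all add: conjugate_time_iff)
  then obtain c where c: "c \<in> carrier_vec n" "c \<noteq> 0\<^sub>v n" "Xm t *\<^sub>v c = 0\<^sub>v n"
    using det_0_iff_vec_prod_zero_field[OF PX_carrier(2)] by blast
  have Sc: "S \<in> carrier_mat n n" and Ssym: "transpose_mat S = S"
    and ric: "S * (D * S + A) = - (transpose_mat A * S) - Q" using S by (auto simp: riccati_def)
  define p where "p s = Pm s *\<^sub>v c" for s
  define x where "x s = Xm s *\<^sub>v c" for s
  define y where "y s = p s - S *\<^sub>v x s" for s
  define y' where "y' s = - (transpose_mat A *\<^sub>v y s) - S *\<^sub>v (D *\<^sub>v y s)" for s
  have pc [simp]: "p s \<in> carrier_vec n" and xc [simp]: "x s \<in> carrier_vec n" for s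
    using c(1) by (simp_all add: p_def x_def)
  have Svc [simp]: "S *\<^sub>v v \<in> carrier_vec n" if "v \<in> carrier_vec n" for v using Sc that by simp
  have yc [simp]: "y s \<in> carrier_vec n" for s unfolding y_def by simp
  have y'c [simp]: "y' s \<in> carrier_vec n" for s unfolding y'_def by simp
  have pe: "p s = y s + S *\<^sub>v x s" for s
    unfolding y_def using vec_diff_add[OF pc Svc[OF xc]] by simp
  have dx: "vderiv n x (D *\<^sub>v p s + A *\<^sub>v x s) s" for s
    using vderiv_PX(2)[OF c(1), of s] unfolding p_def x_def .
  have dp: "vderiv n p (- (transpose_mat A *\<^sub>v p s) - Q *\<^sub>v x s) s" for s
    using vderiv_PX(1)[OF c(1), of s] unfolding p_def x_def .
  have dy: "vderiv n y (y' s) s" for s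
  proof -
    have "vderiv n (\<lambda>s. p s - S *\<^sub>v x s) ((- (transpose_mat A *\<^sub>v p s) - Q *\<^sub>v x s) - S *\<^sub>v (D *\<^sub>v p s + A *\<^sub>v x s)) s"
      by (intro vderiv_diff vderiv_mult[OF Sc] dx dp) auto
    moreover have "(- (transpose_mat A *\<^sub>v p s) - Q *\<^sub>v x s) - S *\<^sub>v (D *\<^sub>v p s + A *\<^sub>v x s) = y' s"
      unfolding pe y'_def by (rule ham_graph_coordinate[OF A D Q Sc xc yc ric])
    ultimately show ?thesis unfolding y_def[abs_def] by simp
  qed
  define f where "f s = y s \<bullet> x s" for s
  have df: "(f has_real_derivative (transpose_mat B *\<^sub>v y s) \<bullet> (transpose_mat B *\<^sub>v y s)) (at s)" for s
  proof -
    have "(f has_real_derivative y' s \<bullet> x s + y s \<bullet> (D *\<^sub>v p s + A *\<^sub>v x s)) (at s)"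
      unfolding f_def[abs_def] by (intro vderiv_scalar_prod[where n = n] dy dx) auto
    moreover have "y' s \<bullet> x s + y s \<bullet> (D *\<^sub>v p s + A *\<^sub>v x s) = y s \<bullet> (D *\<^sub>v y s)"
    proof -
      have 1: "(transpose_mat A *\<^sub>v y s) \<bullet> x s = y s \<bullet> (A *\<^sub>v x s)"
        by (rule transpose_vec_mult_scalar[OF A xc yc])
      have 2: "(S *\<^sub>v (D *\<^sub>v y s)) \<bullet> x s = y s \<bullet> (D *\<^sub>v (S *\<^sub>v x s))"
        using symmetric_scalar_prod[OF Sc Ssym, of "D *\<^sub>v y s" "x s"] symmetric_scalar_prod[OF D D_sym, of "y s" "S *\<^sub>v x s"]
        by simp
      have neg: "(- a) \<bullet> b = - (a \<bullet> b)" if "a \<in> carrier_vec n" "b \<in> carrier_vec n" for a b :: "real vec"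
        using that by (simp add: scalar_prod_def sum_negf)
      have 3: "y' s \<bullet> x s = - (y s \<bullet> (A *\<^sub>v x s)) - y s \<bullet> (D *\<^sub>v (S *\<^sub>v x s))"
        unfolding y'_def 1[symmetric] 2[symmetric]
        using minus_scalar_prod_distrib[of "- (transpose_mat A *\<^sub>v y s)" n "S *\<^sub>v (D *\<^sub>v y s)" "x s"]
          neg[of "transpose_mat A *\<^sub>v y s" "x s"] by simp
      have 4: "y s \<bullet> (D *\<^sub>v p s + A *\<^sub>v x s) = y s \<bullet> (D *\<^sub>v y s) + y s \<bullet> (D *\<^sub>v (S *\<^sub>v x s)) + y s \<bullet> (A *\<^sub>v x s)"
        unfolding pe using mult_add_distrib_mat_vec[OF D yc Svc[OF xc]]
        by (simp add: scalar_prod_add_distrib[of _ n])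
      show ?thesis unfolding 3 4 by simp
    qed
    ultimately show ?thesis by (simp add: D_scalar_prod)
  qed
  have x0: "x 0 = 0\<^sub>v n" "x t = 0\<^sub>v n"
    using c(1,3) unfolding x_def PX_0 by (auto intro!: eq_vecI)
  then have f0: "f 0 = 0" "f t = 0" unfolding f_def by auto
  \<comment> \<open>The end points are put in order, so that one argument covers both signs of
    t.\<close>
  define a where "a = min 0 t"
  define b where "b = max 0 t"
  have ab: "a < b" "f a = 0" "f b = 0" using t(1) f0 by (auto simp: a_def b_def min_def max_def)
  have mono: "f r \<le> f s" if "r \<le> s" for r s
    using that by (rule DERIV_nonneg_imp_nondecreasing)
      (use df in \<open>auto intro!: exI conjI simp: scalar_prod_def sum_nonneg\<close>)
  have fz: "f s = 0" if "s \<in> {a<..<b}" for s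
    using mono[of a s] mono[of s b] ab that by auto
  have By: "transpose_mat B *\<^sub>v y s = 0\<^sub>v k" if s: "s \<in> {a<..<b}" for s
  proof -
    have "(f has_real_derivative 0) (at s)"
      by (rule has_field_derivative_transform_within_open[of "\<lambda>_. 0" _ _ "{a<..<b}"]) (use s fz in auto)
    then have "(transpose_mat B *\<^sub>v y s) \<bullet> (transpose_mat B *\<^sub>v y s) = 0" using df[of s] DERIV_unique by blast
    then show ?thesis using scalar_prod_self_eq_0[of "transpose_mat B *\<^sub>v y s" k] by simp
  qed
  have tA: "transpose_mat A \<in> carrier_mat n n" and tB: "transpose_mat B \<in> carrier_mat k n" by auto
  have yz: "y s = 0\<^sub>v n" if s: "s \<in> {a<..<b}" for s
  proof (rule controllable_orthogonal[OF A B controllable yc])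
    fix j
    show "transpose_mat B *\<^sub>v ((*\<^sub>v) (transpose_mat A) ^^ j) (y s) = 0\<^sub>v k"
      using s
    proof (induction j arbitrary: s)
      case 0
      then show ?case using By by simp
    next
      \<comment> \<open>Since B^T y = 0 on the interval, also D y = 0, and there y' = - A^T y.
        Differentiating the identity for j gives the one for j + 1.\<close>
      case (Suc j)
      have Ac: "((*\<^sub>v) (transpose_mat A) ^^ j) v \<in> carrier_vec n" if "v \<in> carrier_vec n" for j v
        by (rule funpow_mult_carrier[OF tA that])
      have "vderiv n (\<lambda>s. ((*\<^sub>v) (transpose_mat A) ^^ j) (y s)) (((*\<^sub>v) (transpose_mat A) ^^ j) (y' s)) s" for s
        by (induction j) (use dy Ac in \<open>auto intro!: vderiv_mult[OF tA]\<close>)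
      then have d: "vderiv k (\<lambda>s. transpose_mat B *\<^sub>v ((*\<^sub>v) (transpose_mat A) ^^ j) (y s))
          (transpose_mat B *\<^sub>v ((*\<^sub>v) (transpose_mat A) ^^ j) (y' s)) s"
        by (intro vderiv_mult[OF tB]) (use Ac in auto)
      have 0: "transpose_mat B *\<^sub>v ((*\<^sub>v) (transpose_mat A) ^^ j) (y' s) = 0\<^sub>v k"
        by (rule vderiv_zero[OF d, of "{a<..<b}"]) (use Suc Ac in auto)
      have "D *\<^sub>v y s = 0\<^sub>v n" unfolding D_mult_vec[OF yc] By[OF Suc.prems] by (rule mult_mat_zero_vec[OF B])
      then have "S *\<^sub>v (D *\<^sub>v y s) = 0\<^sub>v n" using mult_mat_zero_vec[OF Sc] by simp
      then have "y' s = (- 1) \<cdot>\<^sub>v (transpose_mat A *\<^sub>v y s)"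
        unfolding y'_def using mult_vec_carrier(4)[OF yc, of s] by (intro eq_vecI) (auto simp del: index_mult_mat_vec mult_vec_carrier)
      then have "transpose_mat B *\<^sub>v ((*\<^sub>v) (transpose_mat A) ^^ j) (y' s) =
          (- 1) \<cdot>\<^sub>v (transpose_mat B *\<^sub>v ((*\<^sub>v) (transpose_mat A) ^^ Suc j) (y s))"
        using funpow_mult_smult[OF tA, of "transpose_mat A *\<^sub>v y s" j "- 1"] mult_mat_vec[OF tB Ac, of "transpose_mat A *\<^sub>v y s" "- 1" j]
        by (simp add: funpow_swap1)
      then have "(- 1) \<cdot>\<^sub>v ((- 1) \<cdot>\<^sub>v (transpose_mat B *\<^sub>v ((*\<^sub>v) (transpose_mat A) ^^ Suc j) (y s))) = (- 1) \<cdot>\<^sub>v 0\<^sub>v k"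
        using 0 by metis
      then show ?case by (simp add: smult_smult_assoc del: funpow.simps)
    qed
  qed
  have "c $ i = 0" if i: "i < n" for i
  proof -
    have cont: "continuous_on (closure {a<..<b}) (\<lambda>s. y s $ i)"
    proof (rule DERIV_continuous_on)
      fix s
      have "((\<lambda>s. y s $ i) has_real_derivative y' s $ i) (at s)" using dy i by (simp add: vderiv_def)
      then show "((\<lambda>s. y s $ i) has_field_derivative y' s $ i) (at s within closure {a<..<b})"
        by (rule has_field_derivative_at_within)
    qed
    \<comment> \<open>The vanishing holds on the open interval only; continuity carries it to time
      0, where y = c.\<close>
    have "0 \<in> closure {a<..<b}" using ab by (auto simp: a_def b_def)
    with continuous_constant_on_closure[OF cont, of 0] have "y 0 $ i = 0" using yz i by simp
    moreover have "y 0 = c"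
      unfolding y_def x0(1) mult_mat_zero_vec[OF Sc] p_def PX_0 using c(1) by (intro eq_vecI) auto
    ultimately show ?thesis by simp
  qed
  then have "c = 0\<^sub>v n" using c(1) by (intro eq_vecI) auto
  then show False using c(2) by blast
qed

end

subsection \<open>The limit of the Jacobi curve\<close>

text \<open>Cramer's rule as a total function: continuity of the inverse follows from continuity of
  determinants, and nothing has to be chosen where the determinant vanishes.\<close>

definition minv :: "real mat \<Rightarrow> real mat" where
  "minv M = inverse (det M) \<cdot>\<^sub>m adj_mat M"

lemma minv_carrier: "M \<in> carrier_mat n n \<Longrightarrow> minv M \<in> carrier_mat n n"
  unfolding minv_def by (simp add: adj_mat(1))

lemma minv:
  assumes M: "M \<in> carrier_mat n n" and det: "det M \<noteq> 0" and v: "v \<in> carrier_vec n"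
  shows "M *\<^sub>v (minv M *\<^sub>v v) = v" "minv M *\<^sub>v (M *\<^sub>v v) = v"
proof -
  note adj = adj_mat[OF M]
  have "M * minv M = 1\<^sub>m n"
    unfolding minv_def using mult_smult_distrib[OF M adj(1)] adj(2) det by (auto intro!: eq_matI)
  then show "M *\<^sub>v (minv M *\<^sub>v v) = v"
    using assoc_mult_mat_vec[OF M minv_carrier[OF M] v] v by simp
  have "minv M * M = 1\<^sub>m n"
    unfolding minv_def using mult_smult_assoc_mat[OF adj(1) M] adj(3) det by (auto intro!: eq_matI)
  then show "minv M *\<^sub>v (M *\<^sub>v v) = v"
    using assoc_mult_mat_vec[OF minv_carrier[OF M] M v] v by simp
qed

lemma isCont_det:
  fixes M :: "real \<Rightarrow> real mat"
  assumes M: "\<And>s. M s \<in> carrier_mat n n" and cont: "\<And>i j. i < n \<Longrightarrow> j < n \<Longrightarrow> isCont (\<lambda>s. M s $$ (i, j)) t"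
  shows "isCont (\<lambda>s. det (M s)) t"
  unfolding det_def'[OF M]
proof (intro continuous_intros cont)
  fix p i assume "p \<in> {p. p permutes {0..<n}}" "i \<in> {0..<n}"
  then show "i < n" "p i < n" using permutes_in_image[of p "{0..<n}" i] by auto
qed

lemma isCont_minv:
  fixes M :: "real \<Rightarrow> real mat"
  assumes M: "\<And>s. M s \<in> carrier_mat n n" and cont: "\<And>i j. i < n \<Longrightarrow> j < n \<Longrightarrow> isCont (\<lambda>s. M s $$ (i, j)) t"
    and det: "det (M t) \<noteq> 0" and ij: "i < n" "j < n"
  shows "isCont (\<lambda>s. minv (M s) $$ (i, j)) t"
proof -
  have del: "mat_delete (M s) j i \<in> carrier_mat (n - 1) (n - 1)" for s by (rule mat_delete_carrier[OF M])
  have "isCont (\<lambda>s. det (mat_delete (M s) j i)) t"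
  proof (rule isCont_det[OF del])
    fix a b assume "a < n - 1" "b < n - 1"
    then show "isCont (\<lambda>s. mat_delete (M s) j i $$ (a, b)) t"
      unfolding mat_delete_def using carrier_matD[OF M] by (auto intro!: cont)
  qed
  then have "isCont (\<lambda>s. cofactor (M s) j i) t"
    unfolding cofactor_def by (intro continuous_intros)
  then have "isCont (\<lambda>s. inverse (det (M s)) * cofactor (M s) j i) t"
    using isCont_det[OF M cont] det by (intro continuous_intros) auto
  moreover have "minv (M s) $$ (i, j) = inverse (det (M s)) * cofactor (M s) j i" for s
    using ij carrier_matD[OF M, of s] by (simp add: minv_def adj_mat_def)
  ultimately show ?thesis by simp
qed

lemma convergent_antimono_at_top:
  fixes f :: "real \<Rightarrow> real"
  assumes mono: "\<And>s t. a \<le> s \<Longrightarrow> s \<le> t \<Longrightarrow> f t \<le> f s" and low: "\<And>t. a \<le> t \<Longrightarrow> 0 \<le> f t"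
  shows "\<exists>l. (f \<longlongrightarrow> l) at_top"
proof -
  let ?l = "Inf (f ` {a..})"
  have bdd: "bdd_below (f ` {a..})" using low by (intro bdd_belowI[of _ 0]) auto
  have "(f \<longlongrightarrow> ?l) at_top"
  proof (rule order_tendstoI)
    fix b assume "b < ?l"
    then show "eventually (\<lambda>x. b < f x) at_top"
      using cInf_lower[OF _ bdd] by (intro eventually_mono[OF eventually_ge_at_top[of a]]) (force intro: less_le_trans)
  next
    fix b assume "?l < b"
    then obtain t0 where t0: "a \<le> t0" "f t0 < b"
      using cInf_lessD[of "f ` {a..}" b] by auto
    show "eventually (\<lambda>x. f x < b) at_top"
      using mono[OF t0(1)] t0(2) by (intro eventually_mono[OF eventually_ge_at_top[of t0]]) force
  qed
  then show ?thesis by blast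
qed

lemma tendsto_mult_mat_vec:
  fixes M :: "real mat" and F :: "real filter"
  assumes "M \<in> carrier_mat m n" "\<And>s. f s \<in> carrier_vec n" "l \<in> carrier_vec n"
    and "\<And>j. j < n \<Longrightarrow> ((\<lambda>s. f s $ j) \<longlongrightarrow> l $ j) F" and "i < m"
  shows "((\<lambda>s. (M *\<^sub>v f s) $ i) \<longlongrightarrow> (M *\<^sub>v l) $ i) F"
proof -
  have idx: "(M *\<^sub>v v) $ i = (\<Sum>j = 0..<n. M $$ (i, j) * v $ j)" if "v \<in> carrier_vec n" for v :: "real vec"
    using assms(1,5) that by (auto simp: scalar_prod_def)
  show ?thesis
    unfolding idx[OF assms(2)] idx[OF assms(3)] by (intro tendsto_sum tendsto_mult tendsto_const assms(4)) auto
qed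

lemma tendsto_mult_mat_vec':
  fixes M :: "real \<Rightarrow> real mat" and F :: "real filter"
  assumes "\<And>s. M s \<in> carrier_mat m n" "L \<in> carrier_mat m n" "\<And>s. f s \<in> carrier_vec n" "l \<in> carrier_vec n"
    and "\<And>i j. i < m \<Longrightarrow> j < n \<Longrightarrow> ((\<lambda>s. M s $$ (i, j)) \<longlongrightarrow> L $$ (i, j)) F"
    and "\<And>j. j < n \<Longrightarrow> ((\<lambda>s. f s $ j) \<longlongrightarrow> l $ j) F" and "i < m"
  shows "((\<lambda>s. (M s *\<^sub>v f s) $ i) \<longlongrightarrow> (L *\<^sub>v l) $ i) F"
proof -
  have idx: "(N *\<^sub>v v) $ i = (\<Sum>j = 0..<n. N $$ (i, j) * v $ j)"
    if "N \<in> carrier_mat m n" "v \<in> carrier_vec n" for v :: "real vec" and N :: "real mat"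
    using assms(7) that by (auto simp: scalar_prod_def)
  show ?thesis
    unfolding idx[OF assms(1,3)] idx[OF assms(2,4)]
    by (intro tendsto_sum tendsto_mult assms(5,6)) (use assms(7) in auto)
qed

lemma vec_minus_minus:
  fixes u v :: "'a::ab_group_add vec"
  assumes "u \<in> carrier_vec n" "v \<in> carrier_vec n"
  shows "u - (u - v) = v"
  using assms by (intro eq_vecI) auto

lemma vec_add_minus_add:
  fixes u v :: "'a::ab_group_add vec"
  assumes "u \<in> carrier_vec n" "v \<in> carrier_vec n" "w \<in> carrier_vec n" "z \<in> carrier_vec n"
  shows "(u + v) - (w + z) = (u - w) + (v - z)"
  using assms by (intro eq_vecI) auto

lemma vec_smult_minus:
  fixes u v :: "'a::comm_ring_1 vec"
  assumes "u \<in> carrier_vec n" "v \<in> carrier_vec n"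
  shows "c \<cdot>\<^sub>v u - c \<cdot>\<^sub>v v = c \<cdot>\<^sub>v (u - v)"
  using assms by (intro eq_vecI) (auto simp: algebra_simps)

lemma quadratic_form_add:
  fixes M :: "'a::comm_ring_1 mat"
  assumes M: "M \<in> carrier_mat n n" and u: "u \<in> carrier_vec n" and v: "v \<in> carrier_vec n"
  shows "(u + v) \<bullet> (M *\<^sub>v (u + v)) = u \<bullet> (M *\<^sub>v u) + u \<bullet> (M *\<^sub>v v) + (v \<bullet> (M *\<^sub>v u) + v \<bullet> (M *\<^sub>v v))"
proof -
  have c: "M *\<^sub>v u \<in> carrier_vec n" "M *\<^sub>v v \<in> carrier_vec n" using M u v by auto
  show ?thesis
    unfolding mult_add_distrib_mat_vec[OF M u v] add_scalar_prod_distrib[OF u v add_carrier_vec[OF c]]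
      scalar_prod_add_distrib[OF u c] scalar_prod_add_distrib[OF v c] ..
qed

lemma quadratic_form_minus:
  fixes M :: "'a::comm_ring_1 mat"
  assumes M: "M \<in> carrier_mat n n" and u: "u \<in> carrier_vec n" and v: "v \<in> carrier_vec n"
  shows "(u - v) \<bullet> (M *\<^sub>v (u - v)) = u \<bullet> (M *\<^sub>v u) - u \<bullet> (M *\<^sub>v v) - (v \<bullet> (M *\<^sub>v u) - v \<bullet> (M *\<^sub>v v))"
proof -
  have c: "M *\<^sub>v u \<in> carrier_vec n" "M *\<^sub>v v \<in> carrier_vec n" using M u v by auto
  show ?thesis
    unfolding mult_minus_distrib_mat_vec[OF M u v] minus_scalar_prod_distrib[OF u v minus_carrier_vec[OF c]]
      scalar_prod_minus_distrib[OF u c] scalar_prod_minus_distrib[OF v c] ..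
qed

section \<open>Graphs of the transported vertical space and their monotonicity\<close>

context lq
begin

text \<open>To first order in h the lower left block of the flow is h D, the corresponding block of
  h H. This is the source of monotonicity.\<close>

lemma Xm_deriv_0:
  assumes "i < n" "j < n"
  shows "((\<lambda>h. Xm h $$ (i, j) / h) \<longlongrightarrow> D $$ (i, j)) (at 0)"
proof -
  have "((\<lambda>t. flow H t $$ (n + i, j)) has_real_derivative (H * flow H 0) $$ (n + i, j)) (at 0)"
    by (rule fl.flow_has_derivative(1)) (use assms in auto)
  moreover have "(H * flow H 0) $$ (n + i, j) = D $$ (i, j)"
    unfolding fl.flow_0 using assms carrier_matD[OF A] carrier_matD[OF D] carrier_matD[OF Q] right_mult_one_mat[OF H]
    by (simp add: H_def ham_def)
  moreover have "flow H h $$ (n + i, j) = Xm h $$ (i, j)" for h using assms by (simp add: Xm_def lower_left_def)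
  ultimately have "((\<lambda>h. Xm h $$ (i, j)) has_real_derivative D $$ (i, j)) (at 0)" by simp
  then show ?thesis unfolding has_field_derivative_iff using assms by (simp add: PX_0)
qed

lemma isCont_Xm:
  assumes "i < n" "j < n"
  shows "isCont (\<lambda>s. Xm s $$ (i, j)) t"
proof -
  have "((\<lambda>t. flow H t $$ (n + i, j)) has_real_derivative (H * flow H t) $$ (n + i, j)) (at t)"
    by (rule fl.flow_has_derivative(1)) (use assms in auto)
  then show ?thesis using assms DERIV_isCont by (fastforce simp: Xm_def lower_left_def)
qed

text \<open>Where \<open>det (Xm t)\<close> is nonzero, \<open>cv t x\<close> is the initial
  momentum of the orbit that leaves the vertical space at time 0 and has position x at time t, and
  the graph of \<open>Sm t\<close> is exp(t H) V, that is, J(-t).\<close>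

definition cv :: "real \<Rightarrow> real vec \<Rightarrow> real vec" where "cv t x = minv (Xm t) *\<^sub>v x"
definition Sm :: "real \<Rightarrow> real mat" where "Sm t = Pm t * minv (Xm t)"

lemma minv_Xm [simp]: "minv (Xm t) \<in> carrier_mat n n" by (rule minv_carrier) simp
lemma cv_carrier [simp]: "x \<in> carrier_vec n \<Longrightarrow> cv t x \<in> carrier_vec n"
  unfolding cv_def by (rule mult_mat_vec_carrier[OF minv_Xm])
lemma Sm_carrier [simp]: "Sm t \<in> carrier_mat n n" unfolding Sm_def by (rule mult_carrier_mat[OF PX_carrier(1) minv_Xm])
lemma Sm_vec_carrier [simp]: "x \<in> carrier_vec n \<Longrightarrow> Sm t *\<^sub>v x \<in> carrier_vec n"
  by (rule mult_mat_vec_carrier[OF Sm_carrier])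
lemma Sm_vec: "x \<in> carrier_vec n \<Longrightarrow> Sm t *\<^sub>v x = Pm t *\<^sub>v cv t x"
  unfolding Sm_def cv_def by (rule assoc_mult_mat_vec[OF PX_carrier(1) minv_Xm])

lemma flow_cv:
  assumes "det (Xm t) \<noteq> 0" "x \<in> carrier_vec n"
  shows "flow H t *\<^sub>v (cv t x @\<^sub>v 0\<^sub>v n) = (Sm t *\<^sub>v x) @\<^sub>v x"
  using flow_vertical[OF cv_carrier[OF assms(2)], of t t] minv(1)[OF PX_carrier(2) assms] Sm_vec[OF assms(2)]
  by (simp add: cv_def)

lemma flow_graph:
  assumes "det (Xm t) \<noteq> 0" "det (Xm (h + t)) \<noteq> 0" "x \<in> carrier_vec n"
  obtains x' where "x' \<in> carrier_vec n" "flow H h *\<^sub>v ((Sm t *\<^sub>v x) @\<^sub>v x) = (Sm (h + t) *\<^sub>v x') @\<^sub>v x'"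
proof -
  let ?c = "cv t x" let ?x' = "Xm (h + t) *\<^sub>v ?c"
  have c: "?c \<in> carrier_vec n" using assms(3) by simp
  have "flow H h *\<^sub>v ((Sm t *\<^sub>v x) @\<^sub>v x) = flow H (h + t) *\<^sub>v (?c @\<^sub>v 0\<^sub>v n)"
    unfolding flow_cv[OF assms(1,3), symmetric] using c by (simp add: flow_flow)
  also have "\<dots> = (Pm (h + t) *\<^sub>v ?c) @\<^sub>v ?x'" by (rule flow_vertical[OF c])
  also have "Pm (h + t) *\<^sub>v ?c = Sm (h + t) *\<^sub>v ?x'"
    unfolding Sm_vec[OF PX_vec_carrier(2)[OF c]] unfolding cv_def[of "h + t"]
    using minv(2)[OF PX_carrier(2) assms(2) c] by simp
  finally show thesis by (rule that[OF PX_vec_carrier(2)[OF c]])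
qed

text \<open>Both graph vectors are pulled back by the flow to time s; there the first one is
  vertical, so only the block \<open>Xm (t - s)\<close> enters the form. For s = t this yields
  symmetry, for t near s the derivative.\<close>

lemma Sm_difference:
  assumes "det (Xm s) \<noteq> 0" "det (Xm t) \<noteq> 0" "x \<in> carrier_vec n" "y \<in> carrier_vec n"
  shows "(Sm s *\<^sub>v x) \<bullet> y - x \<bullet> (Sm t *\<^sub>v y) = cv s x \<bullet> (Xm (t - s) *\<^sub>v cv t y)"
proof -
  let ?a = "cv s x @\<^sub>v 0\<^sub>v n" and ?b = "cv t y @\<^sub>v 0\<^sub>v n"
  have ab: "?a \<in> carrier_vec (n + n)" "?b \<in> carrier_vec (n + n)" using assms by simp_all
  have fb: "flow H t *\<^sub>v ?b = flow H s *\<^sub>v (flow H (t - s) *\<^sub>v ?b)" using ab by (simp add: flow_flow)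
  have "symplectic_form n (flow H s *\<^sub>v ?a) (flow H t *\<^sub>v ?b) = symplectic_form n ?a (flow H (t - s) *\<^sub>v ?b)"
    unfolding fb using ab by (simp add: symplectic_form_flow)
  moreover have "symplectic_form n ?a (flow H (t - s) *\<^sub>v ?b) = cv s x \<bullet> (Xm (t - s) *\<^sub>v cv t y)"
    using assms by (simp add: flow_vertical symplectic_form_append)
  moreover have "symplectic_form n (flow H s *\<^sub>v ?a) (flow H t *\<^sub>v ?b) = (Sm s *\<^sub>v x) \<bullet> y - x \<bullet> (Sm t *\<^sub>v y)"
    using assms by (simp add: flow_cv symplectic_form_append)
  ultimately show ?thesis by simp
qed

lemma Sm_symmetric:
  assumes "det (Xm t) \<noteq> 0" "x \<in> carrier_vec n" "y \<in> carrier_vec n"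
  shows "(Sm t *\<^sub>v x) \<bullet> y = x \<bullet> (Sm t *\<^sub>v y)"
proof -
  have "Xm 0 *\<^sub>v cv t y = 0\<^sub>v n" unfolding PX_0 using cv_carrier[OF assms(3), of t] by (intro eq_vecI) auto
  then show ?thesis using Sm_difference[OF assms(1,1,2,3)] assms by simp
qed

text \<open>The difference quotient comes from \<open>Sm_difference\<close>, so continuity of
  \<open>cv\<close> and \<open>Xm_deriv_0\<close> suffice and no inverse matrix is
  differentiated.\<close>

lemma Sm_deriv:
  assumes ev: "eventually (\<lambda>t. det (Xm t) \<noteq> 0) (nhds s)" and x: "x \<in> carrier_vec n"
  shows "((\<lambda>t. x \<bullet> (Sm t *\<^sub>v x)) has_real_derivative - (cv s x \<bullet> (D *\<^sub>v cv s x))) (at s)"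
proof -
  have s: "det (Xm s) \<noteq> 0" using ev by (rule eventually_nhds_x_imp_x)
  have idx: "u \<bullet> (M *\<^sub>v v) = (\<Sum>i = 0..<n. u $ i * (\<Sum>j = 0..<n. M $$ (i, j) * v $ j))"
    if "u \<in> carrier_vec n" "M \<in> carrier_mat n n" "v \<in> carrier_vec n" for u v :: "real vec" and M
    using that by (auto simp: scalar_prod_def)
  have c: "((\<lambda>t. cv t x $ j) \<longlongrightarrow> cv s x $ j) (at s)" if j: "j < n" for j
  proof -
    have "isCont (\<lambda>t. minv (Xm t) $$ (i, l)) s" if "i < n" "l < n" for i l
      by (rule isCont_minv[OF PX_carrier(2) isCont_Xm s that])
    then have "((\<lambda>t. minv (Xm t) $$ (i, l)) \<longlongrightarrow> minv (Xm s) $$ (i, l)) (at s)" if "i < n" "l < n" for i l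
      using that by (simp add: isCont_def)
    then show ?thesis
      unfolding cv_def by (intro tendsto_mult_mat_vec'[OF minv_Xm minv_Xm x x _ _ j]) auto
  qed
  have X: "((\<lambda>t. Xm (t - s) $$ (i, j) / (t - s)) \<longlongrightarrow> D $$ (i, j)) (at s)" if "i < n" "j < n" for i j
    using Xm_deriv_0[OF that] unfolding LIM_offset_zero_iff[of s "\<lambda>t. Xm (t - s) $$ (i, j) / (t - s)", simplified]
    by simp
  have lim: "((\<lambda>t. \<Sum>i = 0..<n. cv s x $ i * (\<Sum>j = 0..<n. (Xm (t - s) $$ (i, j) / (t - s)) * cv t x $ j))
      \<longlongrightarrow> (\<Sum>i = 0..<n. cv s x $ i * (\<Sum>j = 0..<n. D $$ (i, j) * cv s x $ j))) (at s)"
    by (intro tendsto_sum tendsto_mult tendsto_const X c) auto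
  have "((\<lambda>t. (x \<bullet> (Sm t *\<^sub>v x) - x \<bullet> (Sm s *\<^sub>v x)) / (t - s)) \<longlongrightarrow> - (cv s x \<bullet> (D *\<^sub>v cv s x))) (at s)"
  proof (rule Lim_transform_eventually)
    show "((\<lambda>t. - (\<Sum>i = 0..<n. cv s x $ i * (\<Sum>j = 0..<n. (Xm (t - s) $$ (i, j) / (t - s)) * cv t x $ j)))
      \<longlongrightarrow> - (cv s x \<bullet> (D *\<^sub>v cv s x))) (at s)"
      unfolding idx[OF cv_carrier[OF x] D cv_carrier[OF x]] by (intro tendsto_minus lim)
    have "eventually (\<lambda>t. det (Xm t) \<noteq> 0) (at s)" using ev by (simp add: eventually_nhds_conv_at)
    then show "eventually (\<lambda>t. - (\<Sum>i = 0..<n. cv s x $ i * (\<Sum>j = 0..<n. (Xm (t - s) $$ (i, j) / (t - s)) * cv t x $ j)) =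
        (x \<bullet> (Sm t *\<^sub>v x) - x \<bullet> (Sm s *\<^sub>v x)) / (t - s)) (at s)"
    proof eventually_elim
      case (elim t)
      have "x \<bullet> (Sm s *\<^sub>v x) - x \<bullet> (Sm t *\<^sub>v x) = cv s x \<bullet> (Xm (t - s) *\<^sub>v cv t x)"
        using Sm_difference[OF s elim x x] Sm_symmetric[OF s x x] by simp
      then have eq: "- (x \<bullet> (Sm t *\<^sub>v x) - x \<bullet> (Sm s *\<^sub>v x)) =
          (\<Sum>i = 0..<n. cv s x $ i * (\<Sum>j = 0..<n. Xm (t - s) $$ (i, j) * cv t x $ j))"
        unfolding idx[OF cv_carrier[OF x] PX_carrier(2) cv_carrier[OF x], symmetric] by simp
      have "(x \<bullet> (Sm t *\<^sub>v x) - x \<bullet> (Sm s *\<^sub>v x)) / (t - s) =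
          - ((\<Sum>i = 0..<n. cv s x $ i * (\<Sum>j = 0..<n. Xm (t - s) $$ (i, j) * cv t x $ j)) / (t - s))"
        unfolding eq[symmetric] by (simp only: minus_divide_left minus_minus minus_diff_eq)
      then show ?case by (simp add: sum_divide_distrib sum_distrib_left)
    qed
  qed
  then show ?thesis unfolding has_field_derivative_iff .
qed

text \<open>The monotone matrices \<open>Sm t\<close> are not known to be bounded. Their limit is taken in the chart given by
  \<open>Z t = inverse (M - Sm t)\<close>, which is positive and decreasing because \<open>M - Sm t \<ge> 1\<close> for
  \<open>M = 1 + Sm a\<close> and \<open>t \<ge> a\<close>; there \<open>(p, x)\<close> lies on the graph of \<open>Sm t\<close> iff \<open>x = Z t (M x - p)\<close>.\<close>

theorem riccati_if_no_late_conjugate_time: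
  assumes T: "\<And>t. t > T \<Longrightarrow> det (Xm t) \<noteq> 0"
  obtains S where "riccati S"
proof -
  \<comment> \<open>One unit beyond T, so that every time from a on has a neighbourhood in which the
    determinant does not vanish, as \<open>Sm_deriv\<close> demands.\<close>
  define a where "a = T + 1"
  have nz: "det (Xm t) \<noteq> 0" if "a \<le> t" for t using T that by (simp add: a_def)
  have mono: "x \<bullet> (Sm t *\<^sub>v x) \<le> x \<bullet> (Sm s *\<^sub>v x)" if st: "a \<le> s" "s \<le> t" and x: "x \<in> carrier_vec n" for s t x
    using st(2)
  proof (rule DERIV_nonpos_imp_nonincreasing)
    fix r assume r: "s \<le> r" "r \<le> t"
    have "eventually (\<lambda>t. det (Xm t) \<noteq> 0) (nhds r)"
      by (rule eventually_mono[OF eventually_nhds_in_open[of "{T<..}"]]) (use r st T in \<open>auto simp: a_def\<close>)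
    from Sm_deriv[OF this x]
    show "\<exists>y. ((\<lambda>t. x \<bullet> (Sm t *\<^sub>v x)) has_real_derivative y) (at r) \<and> y \<le> 0"
      using D_scalar_prod[OF cv_carrier[OF x, of r]] by (intro exI conjI) (auto simp: scalar_prod_def sum_nonneg)
  qed
  define M where "M = 1\<^sub>m n + Sm a"
  have M [simp]: "M \<in> carrier_mat n n" by (simp add: M_def)
  have Mv: "M *\<^sub>v x = x + Sm a *\<^sub>v x" if "x \<in> carrier_vec n" for x
    unfolding M_def using add_mult_distrib_mat_vec[of "1\<^sub>m n" n n "Sm a" x] that by simp
  have Mvc [simp]: "M *\<^sub>v x \<in> carrier_vec n" if "x \<in> carrier_vec n" for x using that by (rule mult_mat_vec_carrier[OF M])
  have Msym: "(M *\<^sub>v x) \<bullet> y = x \<bullet> (M *\<^sub>v y)" if "x \<in> carrier_vec n" "y \<in> carrier_vec n" for x y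
    using that Sm_symmetric[OF nz, of a x y] by (simp add: Mv add_scalar_prod_distrib[of _ n] scalar_prod_add_distrib[of _ n])
  define N where "N t = M - Sm t" for t
  have N [simp]: "N t \<in> carrier_mat n n" for t unfolding N_def by (rule minus_carrier_mat) simp
  have Nv: "N t *\<^sub>v x = M *\<^sub>v x - Sm t *\<^sub>v x" if "x \<in> carrier_vec n" for x t
    unfolding N_def using minus_mult_distrib_mat_vec[OF M Sm_carrier that] .
  have Nvc [simp]: "N t *\<^sub>v x \<in> carrier_vec n" if "x \<in> carrier_vec n" for x t using that by (rule mult_mat_vec_carrier[OF N])
  have Nsym: "(N t *\<^sub>v x) \<bullet> y = x \<bullet> (N t *\<^sub>v y)" if "a \<le> t" "x \<in> carrier_vec n" "y \<in> carrier_vec n" for x y t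
    using that Msym[of x y] Sm_symmetric[OF nz, of t x y] by (simp add: Nv minus_scalar_prod_distrib[of _ n] scalar_prod_minus_distrib[of _ n])
  have Nquad: "x \<bullet> (N t *\<^sub>v x) = x \<bullet> x + x \<bullet> (Sm a *\<^sub>v x) - x \<bullet> (Sm t *\<^sub>v x)" if "x \<in> carrier_vec n" for x t
    using that by (simp add: Nv Mv scalar_prod_minus_distrib[of _ n] scalar_prod_add_distrib[of _ n])
  have self: "0 \<le> x \<bullet> x" for x :: "real vec" by (simp add: scalar_prod_def sum_nonneg)
  have Nge: "x \<bullet> x \<le> x \<bullet> (N t *\<^sub>v x)" if "a \<le> t" "x \<in> carrier_vec n" for x t
    using Nquad[OF that(2), of t] mono[OF order_refl that] by simp
  have Nmono: "x \<bullet> (N s *\<^sub>v x) \<le> x \<bullet> (N t *\<^sub>v x)" if "a \<le> s" "s \<le> t" "x \<in> carrier_vec n" for x s t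
    using Nquad[OF that(3), of t] Nquad[OF that(3), of s] mono[OF that] by simp
  have Ndet: "det (N t) \<noteq> 0" if t: "a \<le> t" for t
  proof
    assume "det (N t) = 0"
    then obtain v where v: "v \<in> carrier_vec n" "v \<noteq> 0\<^sub>v n" "N t *\<^sub>v v = 0\<^sub>v n"
      using det_0_iff_vec_prod_zero_field[OF N] by blast
    then have "v \<bullet> v = 0" using Nge[OF t v(1)] self[of v] by simp
    then show False using v(2) scalar_prod_self_eq_0[OF v(1)] by blast
  qed
  define Z where "Z t = minv (N t)" for t
  have Z [simp]: "Z t \<in> carrier_mat n n" for t unfolding Z_def by (rule minv_carrier[OF N])
  have Zvc [simp]: "Z t *\<^sub>v y \<in> carrier_vec n" if "y \<in> carrier_vec n" for y t using that by (rule mult_mat_vec_carrier[OF Z])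
  have NZ: "N t *\<^sub>v (Z t *\<^sub>v y) = y" and ZN: "Z t *\<^sub>v (N t *\<^sub>v y) = y" if "a \<le> t" "y \<in> carrier_vec n" for y t
    unfolding Z_def using minv[OF N Ndet that(2)] that(1) by auto
  have Zsym: "y \<bullet> (Z t *\<^sub>v y') = (Z t *\<^sub>v y) \<bullet> y'" if "a \<le> t" "y \<in> carrier_vec n" "y' \<in> carrier_vec n" for y y' t
    using Nsym[OF that(1), of "Z t *\<^sub>v y" "Z t *\<^sub>v y'"] NZ[OF that(1)] that by simp
  have Zpos: "0 \<le> y \<bullet> (Z t *\<^sub>v y)" if "a \<le> t" "y \<in> carrier_vec n" for y t
    using Nge[OF that(1), of "Z t *\<^sub>v y"] self[of "Z t *\<^sub>v y"] NZ[OF that] Zsym[OF that(1) that(2) that(2)] that by simp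
  have Zmono: "y \<bullet> (Z t *\<^sub>v y) \<le> y \<bullet> (Z s *\<^sub>v y)" if st: "a \<le> s" "s \<le> t" and y: "y \<in> carrier_vec n" for y s t
  proof -
    let ?u = "Z t *\<^sub>v y" and ?v = "Z s *\<^sub>v y"
    have t: "a \<le> t" using st by simp
    have c: "?u \<in> carrier_vec n" "?v \<in> carrier_vec n" "?u - ?v \<in> carrier_vec n" using y by simp_all
    \<comment> \<open>Inversion reverses the order of positive forms: expand the form of N s at u -
      v, use N s v = y, and replace N s by the larger N t at u.\<close>
    have "0 \<le> (?u - ?v) \<bullet> (N s *\<^sub>v (?u - ?v))"
      using Nge[OF st(1) c(3)] self[of "?u - ?v"] by linarith
    also have "\<dots> = ?u \<bullet> (N s *\<^sub>v ?u) - ?u \<bullet> (N s *\<^sub>v ?v) - ?v \<bullet> (N s *\<^sub>v ?u) + ?v \<bullet> (N s *\<^sub>v ?v)"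
      using c by (simp add: mult_minus_distrib_mat_vec[OF N] minus_scalar_prod_distrib[of _ n] scalar_prod_minus_distrib[of _ n])
    also have "?v \<bullet> (N s *\<^sub>v ?u) = (N s *\<^sub>v ?v) \<bullet> ?u" using Nsym[OF st(1) c(2,1)] by simp
    also have "N s *\<^sub>v ?v = y" by (rule NZ[OF st(1) y])
    finally have "2 * (y \<bullet> ?u) \<le> ?u \<bullet> (N s *\<^sub>v ?u) + y \<bullet> ?v"
      using comm_scalar_prod[OF y c(1)] comm_scalar_prod[OF y c(2)] by simp
    also have "?u \<bullet> (N s *\<^sub>v ?u) \<le> ?u \<bullet> (N t *\<^sub>v ?u)" by (rule Nmono[OF st c(1)])
    also have "?u \<bullet> (N t *\<^sub>v ?u) = y \<bullet> ?u" using NZ[OF t y] comm_scalar_prod[OF y c(1)] by simp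
    finally show ?thesis by simp
  qed
  have quad_lim: "\<exists>l. ((\<lambda>t. y \<bullet> (Z t *\<^sub>v y)) \<longlongrightarrow> l) at_top" if "y \<in> carrier_vec n" for y
    by (rule convergent_antimono_at_top[of a]) (use Zmono Zpos that in auto)
  \<comment> \<open>Polarization reduces convergence of the entries to that of quadratic forms,
    which are monotone and bounded below.\<close>
  have Zentry: "Z t $$ (i, j) = (((unit_vec n i + unit_vec n j) \<bullet> (Z t *\<^sub>v (unit_vec n i + unit_vec n j)))
      - ((unit_vec n i - unit_vec n j) \<bullet> (Z t *\<^sub>v (unit_vec n i - unit_vec n j)))) / 4"
    if t: "a \<le> t" and ij: "i < n" "j < n" for t i j
  proof -
    let ?e = "unit_vec n i :: real vec" and ?f = "unit_vec n j :: real vec"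
    have sym: "?f \<bullet> (Z t *\<^sub>v ?e) = ?e \<bullet> (Z t *\<^sub>v ?f)"
      using Zsym[OF t, of ?f ?e] comm_scalar_prod[of "Z t *\<^sub>v ?f" n ?e] by simp
    have "((?e + ?f) \<bullet> (Z t *\<^sub>v (?e + ?f))) - ((?e - ?f) \<bullet> (Z t *\<^sub>v (?e - ?f))) = 4 * (?e \<bullet> (Z t *\<^sub>v ?f))"
      using quadratic_form_add[OF Z, of ?e ?f t] quadratic_form_minus[OF Z, of ?e ?f t] sym by simp
    also have "?e \<bullet> (Z t *\<^sub>v ?f) = Z t $$ (i, j)"
      using ij carrier_matD[OF Z] by (simp add: scalar_prod_left_unit[of _ n] scalar_prod_right_unit)
    finally show ?thesis by simp
  qed
  have entry_lim: "\<exists>l. ((\<lambda>t. Z t $$ (i, j)) \<longlongrightarrow> l) at_top" if ij: "i < n" "j < n" for i j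
  proof -
    let ?e = "unit_vec n i :: real vec" and ?f = "unit_vec n j :: real vec"
    obtain l1 l2 where l: "((\<lambda>t. (?e + ?f) \<bullet> (Z t *\<^sub>v (?e + ?f))) \<longlongrightarrow> l1) at_top"
      "((\<lambda>t. (?e - ?f) \<bullet> (Z t *\<^sub>v (?e - ?f))) \<longlongrightarrow> l2) at_top"
      using quad_lim[of "?e + ?f"] quad_lim[of "?e - ?f"] by auto
    have "((\<lambda>t. (((?e + ?f) \<bullet> (Z t *\<^sub>v (?e + ?f))) - ((?e - ?f) \<bullet> (Z t *\<^sub>v (?e - ?f)))) / 4) \<longlongrightarrow> (l1 - l2) / 4) at_top"
      by (intro tendsto_intros l) simp
    moreover have "eventually (\<lambda>t. (((?e + ?f) \<bullet> (Z t *\<^sub>v (?e + ?f))) - ((?e - ?f) \<bullet> (Z t *\<^sub>v (?e - ?f)))) / 4 = Z t $$ (i, j)) at_top"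
      using eventually_ge_at_top[of a] by eventually_elim (rule Zentry[OF _ ij, symmetric])
    ultimately have "((\<lambda>t. Z t $$ (i, j)) \<longlongrightarrow> (l1 - l2) / 4) at_top" by (rule Lim_transform_eventually)
    then show ?thesis by blast
  qed
  then obtain l where l: "\<And>i j. i < n \<Longrightarrow> j < n \<Longrightarrow> ((\<lambda>t. Z t $$ (i, j)) \<longlongrightarrow> l i j) at_top" by metis
  define W where "W = mat n n (\<lambda>(i, j). l i j)"
  have W [simp]: "W \<in> carrier_mat n n" by (simp add: W_def)
  have ZW: "((\<lambda>t. Z t $$ (i, j)) \<longlongrightarrow> W $$ (i, j)) at_top" if "i < n" "j < n" for i j
    using l[OF that] that by (simp add: W_def)
  have Wvc [simp]: "W *\<^sub>v y \<in> carrier_vec n" if "y \<in> carrier_vec n" for y using that by (rule mult_mat_vec_carrier[OF W])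
  have Wsym: "transpose_mat W = W"
  proof (rule eq_matI)
    fix i j assume "i < dim_row W" "j < dim_col W"
    then have ij: "i < n" "j < n" by (simp_all add: W_def)
    have "((\<lambda>t. Z t $$ (j, i)) \<longlongrightarrow> W $$ (i, j)) at_top"
    proof (rule Lim_transform_eventually[OF ZW[OF ij]])
      show "eventually (\<lambda>t. Z t $$ (i, j) = Z t $$ (j, i)) at_top"
        using eventually_ge_at_top[of a]
      proof eventually_elim
        case (elim t)
        have "unit_vec n i \<bullet> (Z t *\<^sub>v unit_vec n j) = (Z t *\<^sub>v unit_vec n i) \<bullet> unit_vec n j"
          by (rule Zsym[OF elim]) auto
        then show ?case
          using ij carrier_matD[OF Z] by (simp add: scalar_prod_left_unit[of _ n] scalar_prod_right_unit)
      qed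
    qed
    then have "W $$ (j, i) = W $$ (i, j)" using tendsto_unique[OF _ ZW[OF ij(2,1)]] by simp
    then show "transpose_mat W $$ (i, j) = W $$ (i, j)" using ij carrier_matD[OF W] by simp
  qed (simp_all add: W_def)
  \<comment> \<open>The limit \<open>W\<close> could be singular, so the limiting subspace is given
    by the equation of the chart and not as a graph over x.\<close>
  define L where "L = {u \<in> carrier_vec (n + n). vec_last u n = W *\<^sub>v (M *\<^sub>v vec_last u n - vec_first u n)}"
  have L_append: "p @\<^sub>v x \<in> L \<longleftrightarrow> x = W *\<^sub>v (M *\<^sub>v x - p)" if "p \<in> carrier_vec n" "x \<in> carrier_vec n" for p x
    using that by (simp add: L_def)
  have L_param: "(M *\<^sub>v (W *\<^sub>v y) - y) @\<^sub>v (W *\<^sub>v y) \<in> L" if y: "y \<in> carrier_vec n" for y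
  proof -
    have "M *\<^sub>v (W *\<^sub>v y) - (M *\<^sub>v (W *\<^sub>v y) - y) = y"
      using y Mvc[OF Wvc[OF y]] by (intro eq_vecI) auto
    then show ?thesis using y L_append[of "M *\<^sub>v (W *\<^sub>v y) - y" "W *\<^sub>v y"] by simp
  qed
  \<comment> \<open>An element of \<open>L\<close> is the limit of vectors \<open>ut t\<close> on
    the graphs of \<open>Sm t\<close>, with y held fixed. The flow by h moves them to the graphs of
    \<open>Sm (h + t)\<close>, which have the same limit \<open>L\<close>.\<close>
  have flowL: "flow H h *\<^sub>v u \<in> L" if u: "u \<in> L" for u h
  proof -
    have uc: "u \<in> carrier_vec (n + n)" using u by (simp add: L_def)
    obtain p x where px: "u = p @\<^sub>v x" "p \<in> carrier_vec n" "x \<in> carrier_vec n" using uc by (rule carrier_vec_appendE)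
    define y where "y = M *\<^sub>v x - p"
    have y: "y \<in> carrier_vec n" using px by (simp add: y_def)
    have xW: "x = W *\<^sub>v y" using u L_append px by (simp add: y_def)
    have pW: "p = M *\<^sub>v (W *\<^sub>v y) - y"
      unfolding xW[symmetric] unfolding y_def by (rule vec_minus_minus[OF Mvc[OF px(3)] px(2), symmetric])
    define xt where "xt t = Z t *\<^sub>v y" for t
    define ut where "ut t = (M *\<^sub>v xt t - y) @\<^sub>v xt t" for t
    have xt [simp]: "xt t \<in> carrier_vec n" for t using y by (simp add: xt_def)
    have utc: "ut t \<in> carrier_vec (n + n)" for t using y by (simp add: ut_def)
    have ut_graph: "ut t = (Sm t *\<^sub>v xt t) @\<^sub>v xt t" if "a \<le> t" for t
    proof -
      have "M *\<^sub>v xt t - Sm t *\<^sub>v xt t = y" using NZ[OF that y] Nv[OF xt, of t t] by (simp add: xt_def)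
      then have "M *\<^sub>v xt t - y = M *\<^sub>v xt t - (M *\<^sub>v xt t - Sm t *\<^sub>v xt t)" by simp
      also have "\<dots> = Sm t *\<^sub>v xt t"
        using Mvc[OF xt] Sm_vec_carrier[OF xt, of t t] by (intro eq_vecI) auto
      finally show ?thesis by (simp add: ut_def)
    qed
    have xt_lim: "((\<lambda>t. xt t $ j) \<longlongrightarrow> x $ j) at_top" if "j < n" for j
      unfolding xt_def xW by (rule tendsto_mult_mat_vec'[OF Z W y y ZW _ that]) auto
    have ut_lim: "((\<lambda>t. ut t $ j) \<longlongrightarrow> u $ j) at_top" if j: "j < n + n" for j
    proof (cases "j < n")
      case True
      have "((\<lambda>t. (M *\<^sub>v xt t) $ j - y $ j) \<longlongrightarrow> (M *\<^sub>v x) $ j - y $ j) at_top"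
        by (intro tendsto_diff tendsto_const tendsto_mult_mat_vec[OF M xt px(3) xt_lim True])
      moreover have "ut t $ j = (M *\<^sub>v xt t) $ j - y $ j" for t
        using True y Mvc[OF xt, of t] by (simp add: ut_def del: index_mult_mat_vec)
      moreover have "u $ j = (M *\<^sub>v x) $ j - y $ j"
        using True y px Mvc[OF px(3)] pW xW by (simp del: index_mult_mat_vec)
      ultimately show ?thesis by simp
    next
      case False
      then have "ut t $ j = xt t $ (j - n)" "u $ j = x $ (j - n)" for t
        using j y px by (simp_all add: ut_def carrier_vecD[OF xt] carrier_vecD[OF y] carrier_vecD[OF px(2)])
      then show ?thesis using xt_lim[of "j - n"] False j by simp
    qed
    define wt where "wt t = flow H h *\<^sub>v ut t" for t
    define w where "w = flow H h *\<^sub>v u"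
    have wtc: "wt t \<in> carrier_vec (n + n)" for t using utc by (simp add: wt_def)
    have wc: "w \<in> carrier_vec (n + n)" using uc by (simp add: w_def)
    have wt_lim: "((\<lambda>t. wt t $ j) \<longlongrightarrow> w $ j) at_top" if "j < n + n" for j
      unfolding wt_def w_def by (rule tendsto_mult_mat_vec[OF fl.flow_carrier utc uc ut_lim that])
    have flc: "vec_last v n $ i = v $ (n + i)" "vec_first v n $ i = v $ i" if "v \<in> carrier_vec (n + n)" "i < n" for v :: "real vec" and i
      using that by (auto simp: vec_last_def vec_first_def)
    have l1: "((\<lambda>t. vec_last (wt t) n $ i) \<longlongrightarrow> vec_last w n $ i) at_top"
      and l2: "((\<lambda>t. vec_first (wt t) n $ i) \<longlongrightarrow> vec_first w n $ i) at_top" if "i < n" for i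
      using wt_lim[of "n + i"] wt_lim[of i] that flc[OF wtc that] flc[OF wc that] by simp_all
    have l3: "((\<lambda>t. (M *\<^sub>v vec_last (wt t) n - vec_first (wt t) n) $ i) \<longlongrightarrow> (M *\<^sub>v vec_last w n - vec_first w n) $ i) at_top"
      if i: "i < n" for i
    proof -
      have "((\<lambda>t. (M *\<^sub>v vec_last (wt t) n) $ i - vec_first (wt t) n $ i) \<longlongrightarrow> (M *\<^sub>v vec_last w n) $ i - vec_first w n $ i) at_top"
        by (intro tendsto_diff l2 i tendsto_mult_mat_vec[OF M _ _ l1]) auto
      then show ?thesis using i by (simp del: index_mult_mat_vec)
    qed
    have shift: "filterlim (\<lambda>t. h + t) at_top at_top"
      by (rule filterlim_tendsto_add_at_top[OF tendsto_const filterlim_ident])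
    have ZWh: "((\<lambda>t. Z (h + t) $$ (i, j)) \<longlongrightarrow> W $$ (i, j)) at_top" if "i < n" "j < n" for i j
      using filterlim_compose[OF ZW[OF that] shift] .
    \<comment> \<open>h may be negative, so both t and h + t have to lie beyond a; this holds for
      all large t.\<close>
    have eqn: "vec_last (wt t) n = Z (h + t) *\<^sub>v (M *\<^sub>v vec_last (wt t) n - vec_first (wt t) n)"
      if t: "a \<le> t" "a \<le> h + t" for t
    proof -
      obtain x' where x': "x' \<in> carrier_vec n" "wt t = (Sm (h + t) *\<^sub>v x') @\<^sub>v x'"
        unfolding wt_def ut_graph[OF t(1)] using flow_graph[OF nz[OF t(1)] nz[OF t(2)] xt] by metis
      have "M *\<^sub>v x' - Sm (h + t) *\<^sub>v x' = N (h + t) *\<^sub>v x'" using Nv[OF x'(1)] by simp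
      then show ?thesis using x' ZN[OF t(2) x'(1)] by simp
    qed
    have "vec_last w n = W *\<^sub>v (M *\<^sub>v vec_last w n - vec_first w n)"
    proof (rule eq_vecI)
      fix i assume "i < dim_vec (W *\<^sub>v (M *\<^sub>v vec_last w n - vec_first w n))"
      then have i: "i < n" by (simp add: W_def)
      have "((\<lambda>t. (Z (h + t) *\<^sub>v (M *\<^sub>v vec_last (wt t) n - vec_first (wt t) n)) $ i) \<longlongrightarrow> (W *\<^sub>v (M *\<^sub>v vec_last w n - vec_first w n)) $ i) at_top"
        by (rule tendsto_mult_mat_vec'[OF Z W _ _ ZWh l3 i]) auto
      moreover have "eventually (\<lambda>t. (Z (h + t) *\<^sub>v (M *\<^sub>v vec_last (wt t) n - vec_first (wt t) n)) $ i = vec_last (wt t) n $ i) at_top"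
        using eventually_ge_at_top[of a] eventually_ge_at_top[of "a - h"]
      proof eventually_elim
        case (elim t)
        then show ?case using eqn[of t] by (metis add.commute diff_le_eq)
      qed
      ultimately have "((\<lambda>t. vec_last (wt t) n $ i) \<longlongrightarrow> (W *\<^sub>v (M *\<^sub>v vec_last w n - vec_first w n)) $ i) at_top"
        by (rule Lim_transform_eventually)
      then show "vec_last w n $ i = (W *\<^sub>v (M *\<^sub>v vec_last w n - vec_first w n)) $ i"
        using tendsto_unique[OF _ l1[OF i]] by simp
    qed (simp add: W_def)
    then show ?thesis using wc unfolding L_def w_def by simp
  qed
  show thesis
  proof (rule riccati_if_lagrangian[of L])
    show sub: "lin_subspace (n + n) L"
      unfolding lin_subspace_def
    proof (intro conjI ballI allI)
      show "L \<subseteq> carrier_vec (n + n)" by (auto simp: L_def)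
      have "M *\<^sub>v 0\<^sub>v n = 0\<^sub>v n" "W *\<^sub>v 0\<^sub>v n = 0\<^sub>v n"
        by (rule mult_mat_zero_vec[OF M], rule mult_mat_zero_vec[OF W])
      then show "0\<^sub>v (n + n) \<in> L" unfolding zero_vec_append by (simp add: L_append)
    next
      fix u v assume uv: "u \<in> L" "v \<in> L"
      obtain p x where u: "u = p @\<^sub>v x" "p \<in> carrier_vec n" "x \<in> carrier_vec n"
        using carrier_vec_appendE[of u n n] uv(1) by (auto simp: L_def)
      obtain q z where v: "v = q @\<^sub>v z" "q \<in> carrier_vec n" "z \<in> carrier_vec n"
        using carrier_vec_appendE[of v n n] uv(2) by (auto simp: L_def)
      have "M *\<^sub>v (x + z) - (p + q) = (M *\<^sub>v x - p) + (M *\<^sub>v z - q)"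
        unfolding mult_add_distrib_mat_vec[OF M u(3) v(3)]
        by (rule vec_add_minus_add[OF Mvc[OF u(3)] Mvc[OF v(3)] u(2) v(2)])
      moreover have "W *\<^sub>v ((M *\<^sub>v x - p) + (M *\<^sub>v z - q)) = x + z"
        using mult_add_distrib_mat_vec[OF W, of "M *\<^sub>v x - p" "M *\<^sub>v z - q"] u v uv L_append by simp
      ultimately show "u + v \<in> L"
        unfolding u(1) v(1) append_vec_add[OF u(2) v(2) u(3) v(3)] using L_append[of "p + q" "x + z"] u v by simp
    next
      fix c u assume "u \<in> L"
      then obtain p x where u: "u = p @\<^sub>v x" "p \<in> carrier_vec n" "x \<in> carrier_vec n" and uL: "p @\<^sub>v x \<in> L"
      proof -
        have "u \<in> carrier_vec (n + n)" using \<open>u \<in> L\<close> by (simp add: L_def)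
        then show ?thesis by (rule carrier_vec_appendE) (use \<open>u \<in> L\<close> that in blast)
      qed
      have "M *\<^sub>v (c \<cdot>\<^sub>v x) - c \<cdot>\<^sub>v p = c \<cdot>\<^sub>v (M *\<^sub>v x - p)"
        unfolding mult_mat_vec[OF M u(3)] by (rule vec_smult_minus[OF Mvc[OF u(3)] u(2)])
      moreover have "W *\<^sub>v (c \<cdot>\<^sub>v (M *\<^sub>v x - p)) = c \<cdot>\<^sub>v x"
        using mult_mat_vec[OF W, of "M *\<^sub>v x - p" c] u uL L_append by simp
      ultimately show "c \<cdot>\<^sub>v u \<in> L"
        unfolding u(1) smult_append_vec using L_append[of "c \<cdot>\<^sub>v p" "c \<cdot>\<^sub>v x"] u by simp
    qed
    show "symplectic_form n u v = 0" if uv: "u \<in> L" "v \<in> L" for u v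
    proof -
      have par: "\<exists>y\<in>carrier_vec n. u = (M *\<^sub>v (W *\<^sub>v y) - y) @\<^sub>v (W *\<^sub>v y)" if "u \<in> L" for u
      proof -
        obtain p x where u: "u = p @\<^sub>v x" "p \<in> carrier_vec n" "x \<in> carrier_vec n"
          using carrier_vec_appendE[of u n n] \<open>u \<in> L\<close> by (auto simp: L_def)
        let ?y = "M *\<^sub>v x - p"
        have x: "x = W *\<^sub>v ?y" using L_append \<open>u \<in> L\<close> u by simp
        have "M *\<^sub>v x - ?y = p" using u Mvc[OF u(3)] by (intro eq_vecI) auto
        then show ?thesis using x u by (intro bexI[of _ ?y]) auto
      qed
      obtain y z where y: "y \<in> carrier_vec n" "u = (M *\<^sub>v (W *\<^sub>v y) - y) @\<^sub>v (W *\<^sub>v y)"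
        and z: "z \<in> carrier_vec n" "v = (M *\<^sub>v (W *\<^sub>v z) - z) @\<^sub>v (W *\<^sub>v z)"
        using par[OF uv(1)] par[OF uv(2)] by blast
      show ?thesis
        unfolding y(2) z(2)
        using y(1) z(1) Msym[of "W *\<^sub>v y" "W *\<^sub>v z"] symmetric_scalar_prod[OF W Wsym y(1) z(1)]
        by (simp add: symplectic_form_append minus_scalar_prod_distrib[of _ n] scalar_prod_minus_distrib[of _ n])
    qed
    show "H *\<^sub>v u \<in> L" if u: "u \<in> L" for u
    proof -
      have uc: "u \<in> carrier_vec (n + n)" using u by (simp add: L_def)
      define p where "p h = vec_first (flow H h *\<^sub>v u) n" for h
      define x where "x h = vec_last (flow H h *\<^sub>v u) n" for h
      obtain p' x' where px': "H *\<^sub>v u = p' @\<^sub>v x'" "p' \<in> carrier_vec n" "x' \<in> carrier_vec n"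
        using carrier_vec_appendE[OF mult_mat_vec_carrier[OF H uc]] by metis
      have px [simp]: "p h \<in> carrier_vec n" "x h \<in> carrier_vec n" for h by (simp_all add: p_def x_def)
      have "vderiv (n + n) (\<lambda>s. flow H s *\<^sub>v u) (p' @\<^sub>v x') 0"
        using vderiv_flow[OF fl.matrix_flow_axioms uc, of 0] uc px' by (simp add: fl.flow_0)
      moreover have "flow H s *\<^sub>v u = p s @\<^sub>v x s" for s
        using vec_first_last_append[OF flow_vec_carrier[OF uc]] by (simp add: p_def x_def)
      ultimately have d: "vderiv (n + n) (\<lambda>s. p s @\<^sub>v x s) (p' @\<^sub>v x') 0" by simp
      note dpx = vderiv_append[OF d px(1) px'(2) px(2) px'(3)]
      \<comment> \<open>The chart equation holds along the whole orbit, and its derivative at time 0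
        says that \<open>H\<close> u satisfies it as well.\<close>
      have dd: "vderiv n (\<lambda>s. x s - W *\<^sub>v (M *\<^sub>v x s - p s)) (x' - W *\<^sub>v (M *\<^sub>v x' - p')) 0"
        by (intro vderiv_diff vderiv_mult[OF W] vderiv_mult[OF M] dpx) (use px' in auto)
      have "x' - W *\<^sub>v (M *\<^sub>v x' - p') = 0\<^sub>v n"
      proof (rule vderiv_zero[OF dd, of UNIV])
        fix s
        have "x s = W *\<^sub>v (M *\<^sub>v x s - p s)" using flowL[OF u, of s] by (simp add: L_def p_def x_def)
        then show "x s - W *\<^sub>v (M *\<^sub>v x s - p s) = 0\<^sub>v n"
          using px(2)[of s] by (metis minus_cancel_vec)
      qed (use px' in auto)
      then have "x' = W *\<^sub>v (M *\<^sub>v x' - p')"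
        using vec_diff_add[OF px'(3), of "W *\<^sub>v (M *\<^sub>v x' - p')"] px' by simp
      then show ?thesis using px' L_append by simp
    qed
    show "v \<in> L" if v: "v \<in> carrier_vec (n + n)" and orth: "\<And>u. u \<in> L \<Longrightarrow> symplectic_form n u v = 0" for v
    proof -
      obtain p x where px: "v = p @\<^sub>v x" "p \<in> carrier_vec n" "x \<in> carrier_vec n" using v by (rule carrier_vec_appendE)
      \<comment> \<open>Testing \<open>v\<close> against the elements of \<open>L\<close>
        parametrized by y, for every y, forces the chart equation.\<close>
      have "x = W *\<^sub>v (M *\<^sub>v x - p)"
      proof (rule scalar_prod_eq_imp_eq[of _ n])
        fix y :: "real vec" assume y: "y \<in> carrier_vec n"
        have "symplectic_form n ((M *\<^sub>v (W *\<^sub>v y) - y) @\<^sub>v (W *\<^sub>v y)) v = 0" by (rule orth[OF L_param[OF y]])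
        then have "(M *\<^sub>v (W *\<^sub>v y)) \<bullet> x - y \<bullet> x - (W *\<^sub>v y) \<bullet> p = 0"
          unfolding px(1) using px y by (simp add: symplectic_form_append minus_scalar_prod_distrib[of _ n])
        moreover have "(M *\<^sub>v (W *\<^sub>v y)) \<bullet> x = (W *\<^sub>v y) \<bullet> (M *\<^sub>v x)" using Msym px y by simp
        moreover have "y \<bullet> (W *\<^sub>v (M *\<^sub>v x - p)) = (W *\<^sub>v y) \<bullet> (M *\<^sub>v x - p)"
          using symmetric_scalar_prod[OF W Wsym y, of "M *\<^sub>v x - p"] px by simp
        ultimately show "y \<bullet> x = y \<bullet> (W *\<^sub>v (M *\<^sub>v x - p))"
          using px y by (simp add: scalar_prod_minus_distrib[of _ n])
      qed (use px in auto)
      then show ?thesis using px L_append by simp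
    qed
  qed (rule that)
qed

section \<open>The dichotomy\<close>

lemma odd_block_iff:
  "has_odd_imaginary_jordan_block cH \<longleftrightarrow> (\<exists>b e. b \<noteq> 0 \<and> odd e \<and> \<not> no_jordan_block (n + n) (cx.N b) e)"
proof
  assume "has_odd_imaginary_jordan_block cH"
  then obtain n_as d b where *: "jordan_nf cH n_as" "(d, \<i> * complex_of_real b) \<in> set n_as" "odd d" "b \<noteq> 0"
    unfolding has_odd_imaginary_jordan_block_def by blast
  then show "\<exists>b e. b \<noteq> 0 \<and> odd e \<and> \<not> no_jordan_block (n + n) (cx.N b) e"
    using jordan_nf_block_iff[OF cx.M *(1), of d "\<i> * complex_of_real b"] odd_pos[OF *(3)] unfolding cx.N_def by blast
next
  assume "\<exists>b e. b \<noteq> 0 \<and> odd e \<and> \<not> no_jordan_block (n + n) (cx.N b) e"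
  then obtain b e where *: "b \<noteq> 0" "odd e" "\<not> no_jordan_block (n + n) (cx.N b) e" by blast
  obtain n_as where jnf: "jordan_nf cH n_as"
    using char_poly_factorized[OF cx.M] jordan_nf_exists[OF cx.M] by blast
  show "has_odd_imaginary_jordan_block cH"
    using jordan_nf_block_iff[OF cx.M jnf odd_pos[OF *(2)], of "\<i> * complex_of_real b"] * jnf
    unfolding has_odd_imaginary_jordan_block_def cx.N_def by blast
qed

lemma odd_block_iff_no_riccati: "has_odd_imaginary_jordan_block cH \<longleftrightarrow> \<not> (\<exists>S. riccati S)"
  using odd_block_iff riccati_no_odd_block riccati_if_no_odd_block by metis

text \<open>A conjugate time exists beyond every T, for otherwise the Riccati equation would be
  solvable. Each of them raises the count by at least one, because the sets are finite. The bound
  max T 0 takes care of t = 0, which is never a conjugate time.\<close>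

lemma conjugate_times_at_top:
  assumes "\<not> (\<exists>S. riccati S)"
  shows "filterlim (\<lambda>T::real. card {t \<in> {0..T}. conjugate_time n H t}) at_top at_top"
proof -
  let ?c = "\<lambda>T::real. card {t \<in> {0..T}. conjugate_time n H t}"
  have mono: "?c s \<le> ?c t" if "s \<le> t" for s t
    using that by (intro card_mono[OF finite_conjugate_times]) auto
  have later: "\<exists>t>T. t > 0 \<and> conjugate_time n H t" for T
  proof (rule ccontr)
    assume "\<not> ?thesis"
    then have "det (Xm t) \<noteq> 0" if "t > max T 0" for t using that by (auto simp: conjugate_time_iff)
    then obtain S where "riccati S" by (rule riccati_if_no_late_conjugate_time)
    with assms show False by blast
  qed
  have unbounded: "\<exists>T. m \<le> ?c T" for m
  proof (induction m)
    case (Suc m)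
    then obtain T where T: "m \<le> ?c T" by blast
    obtain t where t: "t > T" "t > 0" "conjugate_time n H t" using later by blast
    have "insert t {s \<in> {0..T}. conjugate_time n H s} \<subseteq> {s \<in> {0..t}. conjugate_time n H s}" using t by auto
    then have "card (insert t {s \<in> {0..T}. conjugate_time n H s}) \<le> ?c t"
      by (rule card_mono[OF finite_conjugate_times])
    then have "Suc (?c T) \<le> ?c t" using t finite_conjugate_times[of 0 T] by simp
    with T show ?case by (intro exI[of _ t]) simp
  qed simp
  show ?thesis
    unfolding filterlim_at_top
  proof
    fix m
    obtain T where "m \<le> ?c T" using unbounded by blast
    then show "eventually (\<lambda>t. m \<le> ?c t) at_top"
      using mono order_trans by (intro eventually_mono[OF eventually_ge_at_top[of T]]) blast
  qed
qed

text \<open>The set of conjugate times is symmetric about 0, so counting on [T, 0] is counting on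
  [0, -T].\<close>

lemma conjugate_times_at_bot:
  assumes "\<not> (\<exists>S. riccati S)"
  shows "filterlim (\<lambda>T::real. card {t \<in> {T..0}. conjugate_time n H t}) at_top at_bot"
proof -
  have "card {t \<in> {T..0}. conjugate_time n H t} = card {t \<in> {0..- T}. conjugate_time n H t}" for T
    by (rule bij_betw_same_card[of uminus], rule bij_betw_byWitness[where f' = uminus])
      (auto simp: conjugate_time_uminus)
  then show ?thesis
    using filterlim_compose[OF conjugate_times_at_top[OF assms] filterlim_uminus_at_top_at_bot] by simp
qed

end

theorem theorem1:
  fixes n k :: nat and A B Q H :: "real mat"
  assumes "n \<ge> 1" and "k \<ge> 1"
    and "A \<in> carrier_mat n n"
    and "B \<in> carrier_mat n k"
    and "Q \<in> carrier_mat n n"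
    and "transpose_mat Q = Q"
    and "controllable n A B"
  defines "H \<equiv> hamiltonian_mat A B Q"
  shows "(has_odd_imaginary_jordan_block (map_mat complex_of_real H) \<longrightarrow>
            filterlim (\<lambda>T::real. card {t \<in> {0..T}. conjugate_time n H t}) at_top at_top \<and>
            filterlim (\<lambda>T::real. card {t \<in> {T..0}. conjugate_time n H t}) at_top at_bot)
       \<and> (\<not> has_odd_imaginary_jordan_block (map_mat complex_of_real H) \<longrightarrow>
            \<not> (\<exists>t. conjugate_time n H t))"
proof -
  interpret L: lq n k A B Q by unfold_locales fact+
  have "H = L.H"
    unfolding H_def hamiltonian_mat_eq_ham L.H_def L.D_def ..
  then show ?thesis
    using L.odd_block_iff_no_riccati L.conjugate_times_at_top L.conjugate_times_at_bot
      L.riccati_no_conjugate_time by blast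
qed

end
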